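(* Let $D=G/V$ be the classifying space of polarized Hodge structures, $D_1=G/K$ the associated symmetric space, $\pi:D\to D_1$ the natural projection, and $U\subset D$ a horizontal slice. Then the restriction to $U$ (the pull-back via $\pi|_U$) of the $G$-invariant Riemannian metric on $D_1$ is a Kähler metric on $U$. Moreover, the holomorphic bisectional curvature of this metric is nonpositive. Furthermore, its Ricci curvature and its holomorphic sectional curvature are negative and bounded away from zero, i.e. bounded above by a negative constant.
   Context: Classifying space. Fix a weight $n\ge 1$, a free abelian group $H_{\mathbb Z}$ of finite rank, $H_{\mathbb R}=H_{\mathbb Z}\otimes\mathbb R$, $H=H_{\mathbb Z}\otimes\mathbb C$, a nondegenerate bilinear form $Q:H_{\mathbb Z}\times H_{\mathbb Z}\to\mathbb Z$, symmetric if $n$ is even and skew-symmetric if $n$ is odd (extended to $H$), and Hodge numbers $h^{r,s}$ ($r+s=n$). The classifying space $D$ is the set of all decompositions $H=\bigoplus_{r+s=n}H^{r,s}$ with $H^{r,s}=\overline{H^{s,r}}$, $\dim H^{r,s}=h^{r,s}$, such that $Q(H^{r,s},H^{r',s'})=0$ unless $r'=n-r,\ s'=n-s$, and $(\sqrt{-1})^{r-s}Q(\phi,\bar\phi)>0$ for $0\ne\phi\in H^{r,s}$; equivalently the set of filtrations $F^r=\bigoplus_{a\ge r}H^{a,n-a}$. $D$ is a complex manifold whose holomorphic tangent bundle $T(D)$ is a subbundle of $\bigoplus_r \mathrm{Hom}(F^r,H/F^r)$; $J$ denotes its complex structure. Groups. $G=\mathrm{Aut}(H_{\mathbb R},Q)$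 (its identity component where needed for connectedness) acts transitively on $D$; fix a base point $\{H_0^{r,s}\}$, let $V$ be the stabilizer of all $H_0^{r,s}$ and $K$ the stabilizer of $H_0^+=H_0^{n,0}\oplus H_0^{n-2,2}\oplus\cdots$. Standing assumptions: $G$ is a semisimple Lie group of noncompact type without compact factors, $V$ is a connected compact subgroup, and $K\supset V$ is the maximal connected compact subgroup. So $D=G/V$, and $D_1=G/K$ is a Riemannian symmetric space. The natural projection $\pi:D\to D_1$ is $aV\mapsto aK$. The invariant metric on $D_1$ is, up to a positive constant, the $G$-invariant metric given at the base point by the Killing form restricted to $\mathfrak p$, where $\mathfrak g=\mathfrak f\oplus\mathfrak p$ is the Cartan decomposition with $\mathfrak f=\mathrm{Lie}(K)$. Horizontal slices. The horizontal bundle is $T_h(D)=\{\xi\in T(D):\xi F^r\subset F^{r-1},\ r=1,\dots,n\}$ (i.e. $\xi F^r\subset F^{r-1}/F^r$). A horizontal slice is a complex integral submanifold of the distribution $T_h(D)$, i.e. a complex submanifold of $D$ all of whose tangent spaces lie in $T_h(D)$. Curvatures are those of the Kähler metric on $U$; Kähler is with respect to the complex structure $U$ inherits from $D$. *)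

theory Defs
  imports "HOL-Analysis.Analysis"
begin

section \<open>Polarized Hodge structures\<close>

text \<open>
  A basis of the lattice is fixed, so that \<open>H\<^sub>\<int> = int ^ 'm\<close>, \<open>H\<^sub>\<real> = real ^ 'm\<close> and
  \<open>H = complex ^ 'm\<close>.  The form \<open>Q\<close> is given by its integral Gram matrix; \<open>qform\<close> is its
  bilinear extension to any of the three modules.
\<close>

definition qform :: "int^'m^'m \<Rightarrow> 'a::comm_ring_1^'m \<Rightarrow> 'a^'m \<Rightarrow> 'a" where
  "qform Q x y = (\<Sum>i\<in>UNIV. \<Sum>j\<in>UNIV. of_int (Q $ i $ j) * x $ i * y $ j)"

definition polarization_form :: "nat \<Rightarrow> int^'m^'m \<Rightarrow> bool" where
  "polarization_form n Q \<longleftrightarrow>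
     (\<forall>x::int^'m. (\<forall>y. qform Q x y = 0) \<longrightarrow> x = 0) \<and>
     (if even n then \<forall>x y::int^'m. qform Q x y = qform Q y x
      else \<forall>x y::int^'m. qform Q x y = - qform Q y x)"

definition vcnj :: "complex^'m \<Rightarrow> complex^'m" where
  "vcnj v = (\<chi> i. cnj (v $ i))"

text \<open>
  A decomposition \<open>H = \<Oplus> H\<^sup>r\<^sup>,\<^sup>s\<close> (\<open>r + s = n\<close>) is the function \<open>r \<mapsto> H\<^sup>r\<^sup>,\<^sup>n\<^sup>-\<^sup>r\<close>, normalized to
  the zero space for \<open>r > n\<close>, so that decompositions are equal iff they are equal as functions.
\<close>

type_synonym 'm decomp = "nat \<Rightarrow> (complex^'m) set"

definition classifying_space :: "nat \<Rightarrow> int^'m^'m \<Rightarrow> (nat \<Rightarrow> nat) \<Rightarrow> 'm decomp set" where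
  "classifying_space n Q h = {H.
     (\<forall>r. vec.subspace (H r)) \<and> (\<forall>r>n. H r = {0}) \<and>
     (\<forall>v. \<exists>!x. (\<forall>r. x r \<in> H r) \<and> v = (\<Sum>r\<le>n. x r)) \<and>
     (\<forall>r\<le>n. H r = vcnj ` H (n - r)) \<and>
     (\<forall>r\<le>n. vec.dim (H r) = h r) \<and>
     (\<forall>r\<le>n. \<forall>r'\<le>n. r' \<noteq> n - r \<longrightarrow> (\<forall>x\<in>H r. \<forall>y\<in>H r'. qform Q x y = 0)) \<and>
     (\<forall>r\<le>n. \<forall>x\<in>H r. x \<noteq> 0 \<longrightarrow>
        (\<exists>t>0. \<i> powi (int r - int (n - r)) * qform Q x (vcnj x) = complex_of_real t))}"

definition filtration :: "'m::finite decomp \<Rightarrow> nat \<Rightarrow> (complex^'m) set" where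
  "filtration H r = vec.span (\<Union>a\<in>{r..}. H a)"

definition H_plus :: "nat \<Rightarrow> 'm::finite decomp \<Rightarrow> (complex^'m) set" where
  "H_plus n H = vec.span (\<Union>r\<in>{r. r \<le> n \<and> even (n - r)}. H r)"


section \<open>The groups and the symmetric space\<close>

definition cmul :: "real^'m^'m \<Rightarrow> complex^'m \<Rightarrow> complex^'m" where
  "cmul a v = (\<chi> i. \<Sum>j\<in>UNIV. complex_of_real (a $ i $ j) * v $ j)"

definition act :: "real^'m^'m \<Rightarrow> 'm decomp \<Rightarrow> 'm decomp" where
  "act a H = (\<lambda>r. cmul a ` H r)"

definition matrix_group :: "(real^'m^'m) set \<Rightarrow> bool" where
  "matrix_group L \<longleftrightarrow> mat 1 \<in> L \<and> (\<forall>a\<in>L. \<forall>b\<in>L. a ** b \<in> L) \<and>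
     (\<forall>a\<in>L. invertible a \<and> matrix_inv a \<in> L)"

definition Aut :: "int^'m^'m \<Rightarrow> (real^'m^'m) set" where
  "Aut Q = {a. invertible a \<and> (\<forall>x y::real^'m. qform Q (a *v x) (a *v y) = qform Q x y)}"

definition stab_V :: "(real^'m^'m) set \<Rightarrow> 'm decomp \<Rightarrow> (real^'m^'m) set" where
  "stab_V G H0 = {a\<in>G. \<forall>r. cmul a ` H0 r = H0 r}"

definition stab_K :: "nat \<Rightarrow> (real^'m^'m) set \<Rightarrow> 'm decomp \<Rightarrow> (real^'m^'m) set" where
  "stab_K n G H0 = {a\<in>G. cmul a ` H_plus n H0 = H_plus n H0}"

text \<open>The Lie algebra of a closed matrix group: the velocities at the identity of curves in it.\<close>

definition lie_algebra :: "(real^'m^'m) set \<Rightarrow> (real^'m^'m) set" where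
  "lie_algebra G = {X. \<exists>\<gamma>. \<gamma> 0 = mat 1 \<and> (\<forall>t::real. \<gamma> t \<in> G) \<and>
     (\<gamma> has_vector_derivative X) (at 0)}"

definition comm :: "real^'m^'m \<Rightarrow> real^'m^'m \<Rightarrow> real^'m^'m" where
  "comm X Y = X ** Y - Y ** X"

text \<open>Trace of an endomorphism of a subspace; the chosen basis is irrelevant.\<close>

definition trace_on :: "'a::euclidean_space set \<Rightarrow> ('a \<Rightarrow> 'a) \<Rightarrow> real" where
  "trace_on S f = (let B = (SOME B. independent B \<and> span B = S)
                   in \<Sum>b\<in>B. representation B (f b) b)"

definition killing :: "(real^'m^'m) set \<Rightarrow> real^'m^'m \<Rightarrow> real^'m^'m \<Rightarrow> real" where
  "killing g X Y = trace_on g (\<lambda>Z. comm X (comm Y Z))"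

definition semisimple :: "(real^'m^'m) set \<Rightarrow> bool" where
  "semisimple g \<longleftrightarrow> (\<forall>X\<in>g. (\<forall>Y\<in>g. killing g X Y = 0) \<longrightarrow> X = 0)"

definition lie_ideal :: "(real^'m^'m) set \<Rightarrow> (real^'m^'m) set \<Rightarrow> bool" where
  "lie_ideal I g \<longleftrightarrow> subspace I \<and> I \<subseteq> g \<and> (\<forall>X\<in>g. \<forall>Y\<in>I. comm X Y \<in> I)"

text \<open>
  An ideal of a semisimple Lie algebra is compact iff the Killing form is negative definite on it.
\<close>

definition no_compact_factors :: "(real^'m^'m) set \<Rightarrow> bool" where
  "no_compact_factors g \<longleftrightarrow>
     (\<forall>I. lie_ideal I g \<and> (\<forall>X\<in>I. X \<noteq> 0 \<longrightarrow> killing g X X < 0) \<longrightarrow> I = {0})"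

text \<open>
  The connectedness assumptions refer to the identity component of \<open>Aut Q\<close>; the full group
  \<open>Aut Q\<close>, which is the one acting transitively on the classifying space, is in general
  disconnected.
\<close>

definition standing_assumptions :: "nat \<Rightarrow> int^'m^'m \<Rightarrow> 'm decomp \<Rightarrow> bool" where
  "standing_assumptions n Q H0 \<longleftrightarrow>
     (let G = connected_component_set (Aut Q) (mat 1);
          V = stab_V G H0; K = stab_K n G H0
      in semisimple (lie_algebra G) \<and> no_compact_factors (lie_algebra G) \<and>
         connected V \<and> compact V \<and> V \<subseteq> K \<and> connected K \<and> compact K \<and>
         (\<forall>L. matrix_group L \<and> L \<subseteq> G \<and> connected L \<and> compact L \<and> K \<subseteq> L \<longrightarrow> L = K))"

text \<open>
  \<open>D\<^sub>1 = G/K\<close> consists of the left cosets \<open>aK\<close>, with \<open>G = Aut Q\<close> and \<open>K\<close> the full stabilizer of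
  \<open>H_plus n H0\<close> in it.  For the identity components this gives the same space, as \<open>K\<close> meets every
  component of \<open>G\<close>.
\<close>

definition coset :: "nat \<Rightarrow> int^'m^'m \<Rightarrow> 'm decomp \<Rightarrow> real^'m^'m \<Rightarrow> (real^'m^'m) set" where
  "coset n Q H0 a = (\<lambda>k. a ** k) ` stab_K n (Aut Q) H0"

definition proj :: "nat \<Rightarrow> int^'m^'m \<Rightarrow> 'm decomp \<Rightarrow> 'm decomp \<Rightarrow> (real^'m^'m) set" where
  "proj n Q H0 H = (THE c. \<exists>a\<in>Aut Q. H = act a H0 \<and> c = coset n Q H0 a)"

text \<open>The Cartan decomposition \<open>\<gg> = \<ff> \<oplus> \<pp>\<close> at the base point, and the projection onto \<open>\<pp>\<close>.\<close>

definition f_part :: "nat \<Rightarrow> int^'m^'m \<Rightarrow> 'm decomp \<Rightarrow> (real^'m^'m) set" where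
  "f_part n Q H0 = lie_algebra (stab_K n (Aut Q) H0)"

definition p_part :: "nat \<Rightarrow> int^'m^'m \<Rightarrow> 'm decomp \<Rightarrow> (real^'m^'m) set" where
  "p_part n Q H0 = {X \<in> lie_algebra (Aut Q).
     \<forall>Y\<in>f_part n Q H0. killing (lie_algebra (Aut Q)) X Y = 0}"

definition p_proj :: "nat \<Rightarrow> int^'m^'m \<Rightarrow> 'm decomp \<Rightarrow> real^'m^'m \<Rightarrow> real^'m^'m" where
  "p_proj n Q H0 X = (THE Y. Y \<in> p_part n Q H0 \<and> X - Y \<in> f_part n Q H0)"


section \<open>The complex structure of \<open>D\<close> and horizontal slices\<close>

definition holo_on :: "(complex^'k) set \<Rightarrow> (complex^'k \<Rightarrow> complex^'m) \<Rightarrow> bool" where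
  "holo_on W s \<longleftrightarrow> (\<forall>w\<in>W. \<exists>s'. (s has_derivative s') (at w) \<and>
     (\<forall>c v. s' (c *s v) = c *s s' v))"

text \<open>
  \<open>D\<close> carries the complex structure of a submanifold of a product of Grassmannians, via
  \<open>H \<mapsto> (F\<^sup>r)\<^sub>r\<close>.  A map into a Grassmannian is holomorphic iff locally the subspaces have a
  holomorphic frame.
\<close>

definition holo_map ::
  "'m::finite decomp set \<Rightarrow> (complex^'k) set \<Rightarrow> (complex^'k \<Rightarrow> 'm decomp) \<Rightarrow> bool" where
  "holo_map D W f \<longleftrightarrow> open W \<and> f ` W \<subseteq> D \<and>
     (\<forall>r. \<forall>w\<in>W. \<exists>W' e. open W' \<and> w \<in> W' \<and> W' \<subseteq> W \<and>
        (\<forall>j < vec.dim (filtration (f w) r). holo_on W' (e j)) \<and>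
        (\<forall>w'\<in>W'. filtration (f w') r =
           vec.span {e j w' | j::nat. j < vec.dim (filtration (f w) r)}))"

text \<open>
  The differential of \<open>f\<close> at \<open>w\<close> in the direction \<open>v\<close>, as an element of
  \<open>\<Oplus>\<^sub>r Hom(F\<^sup>r, H/F\<^sup>r)\<close>: it maps \<open>\<phi> \<in> F\<^sup>r\<close> to the coset modulo \<open>F\<^sup>r\<close> of the derivative along \<open>v\<close>
  of any holomorphic local section of \<open>F\<^sup>r\<close> through \<open>\<phi>\<close>.
\<close>

definition differential ::
  "(complex^'k) set \<Rightarrow> (complex^'k \<Rightarrow> 'm::finite decomp) \<Rightarrow> complex^'k \<Rightarrow> complex^'k
     \<Rightarrow> nat \<Rightarrow> complex^'m \<Rightarrow> (complex^'m) set" where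
  "differential W f w v r \<phi> = {s' v + \<psi> | s s' \<psi>.
     \<psi> \<in> filtration (f w) r \<and> s w = \<phi> \<and> (s has_derivative s') (at w) \<and>
     (\<exists>W'. open W' \<and> w \<in> W' \<and> W' \<subseteq> W \<and> holo_on W' s \<and>
        (\<forall>w'\<in>W'. s w' \<in> filtration (f w') r))}"

text \<open>The zero element of \<open>H/F\<^sup>r\<close> is the coset \<open>F\<^sup>r\<close> itself.\<close>

definition immersion_on :: "(complex^'k) set \<Rightarrow> (complex^'k \<Rightarrow> 'm::finite decomp) \<Rightarrow> bool" where
  "immersion_on W f \<longleftrightarrow> (\<forall>w\<in>W. \<forall>v. v \<noteq> 0 \<longrightarrow>
     (\<exists>r. \<exists>\<phi>\<in>filtration (f w) r. differential W f w v r \<phi> \<noteq> filtration (f w) r))"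

definition horizontal_on ::
  "nat \<Rightarrow> (complex^'k) set \<Rightarrow> (complex^'k \<Rightarrow> 'm::finite decomp) \<Rightarrow> bool" where
  "horizontal_on n W f \<longleftrightarrow> (\<forall>w\<in>W. \<forall>v. \<forall>r\<in>{1..n}. \<forall>\<phi>\<in>filtration (f w) r.
     differential W f w v r \<phi> \<subseteq> filtration (f w) (r - 1))"

text \<open>
  A complex submanifold \<open>U\<close> of \<open>D\<close> is given with a holomorphic atlas \<open>A\<close>, consisting of pairs
  \<open>(W, f)\<close> of an open set \<open>W\<close> and a parametrization \<open>f\<close> of an open part of \<open>U\<close>, such that the
  inclusion of \<open>U\<close> in \<open>D\<close> is a holomorphic immersion.  The topology of \<open>U\<close> is allowed to be finer
  than the one induced from \<open>D\<close> (as for leaves of distributions); embedded submanifolds are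
  included.
\<close>

definition complex_submanifold ::
  "'m::finite decomp set \<Rightarrow> 'm decomp set \<Rightarrow> ((complex^'k) set \<times> (complex^'k \<Rightarrow> 'm decomp)) set \<Rightarrow> bool"
  where
  "complex_submanifold D U A \<longleftrightarrow>
     U = (\<Union>(W, f)\<in>A. f ` W) \<and>
     (\<forall>(W, f)\<in>A. holo_map D W f \<and> inj_on f W \<and> immersion_on W f) \<and>
     (\<forall>(W, f)\<in>A. \<forall>(W', f')\<in>A.
        let O' = {w\<in>W. f w \<in> f' ` W'} in open O' \<and> holo_on O' (the_inv_into W' f' \<circ> f))"

definition horizontal_slice ::
  "nat \<Rightarrow> 'm::finite decomp set \<Rightarrow> 'm decomp set \<Rightarrow> ((complex^'k) set \<times> (complex^'k \<Rightarrow> 'm decomp)) set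
     \<Rightarrow> bool" where
  "horizontal_slice n D U A \<longleftrightarrow>
     complex_submanifold D U A \<and> (\<forall>(W, f)\<in>A. horizontal_on n W f)"

text \<open>
  The invariant metric on \<open>D\<^sub>1\<close> is \<open>c\<close> times the Killing form on \<open>\<pp>\<close>, moved around by \<open>G\<close>.  For
  a local lift \<open>a\<close> of \<open>\<pi> \<circ> f\<close> to \<open>G\<close>, the vector \<open>d(\<pi> \<circ> f)(u)\<close> is the translate by \<open>a(w)\<close> of the
  \<open>\<pp>\<close>-component of \<open>a(w)\<^sup>-\<^sup>1 da(u)\<close>; this gives the pull-back of the metric in the chart \<open>f\<close>.
\<close>

definition pullback_metric ::
  "nat \<Rightarrow> int^'m^'m \<Rightarrow> 'm decomp \<Rightarrow> real \<Rightarrow> (complex^'k \<Rightarrow> 'm decomp)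
     \<Rightarrow> complex^'k \<Rightarrow> complex^'k \<Rightarrow> complex^'k \<Rightarrow> real" where
  "pullback_metric n Q H0 c f w u v = (THE y. \<exists>a a'.
     (\<forall>\<^sub>F w' in nhds w. a w' \<in> Aut Q \<and> proj n Q H0 (f w') = coset n Q H0 (a w')) \<and>
     (a has_derivative a') (at w) \<and>
     y = c * killing (lie_algebra (Aut Q)) (p_proj n Q H0 (matrix_inv (a w) ** a' u))
                                           (p_proj n Q H0 (matrix_inv (a w) ** a' v)))"


section \<open>Riemannian and Kaehler metrics in a chart\<close>

fun Ck_on :: "nat \<Rightarrow> 'a::euclidean_space set \<Rightarrow> ('a \<Rightarrow> real) \<Rightarrow> bool" where
  "Ck_on 0 W F \<longleftrightarrow> continuous_on W F"
| "Ck_on (Suc k) W F \<longleftrightarrow> (\<exists>F'. (\<forall>w\<in>W. (F has_derivative F' w) (at w)) \<and>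
     (\<forall>v. Ck_on k W (\<lambda>w. F' w v)))"

definition riemannian_metric ::
  "'a::euclidean_space set \<Rightarrow> ('a \<Rightarrow> 'a \<Rightarrow> 'a \<Rightarrow> real) \<Rightarrow> bool" where
  "riemannian_metric W g \<longleftrightarrow>
     (\<forall>w\<in>W. bilinear (g w) \<and> (\<forall>u v. g w u v = g w v u) \<and> (\<forall>u. u \<noteq> 0 \<longrightarrow> 0 < g w u u)) \<and>
     (\<forall>u v. \<forall>k. Ck_on k W (\<lambda>w. g w u v))"

abbreviation dirD :: "('a::euclidean_space \<Rightarrow> real) \<Rightarrow> 'a \<Rightarrow> 'a \<Rightarrow> real" where
  "dirD F w u \<equiv> frechet_derivative F (at w) u"

definition J :: "complex^'k \<Rightarrow> complex^'k" where
  "J v = \<i> *s v"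

definition kaehler_form ::
  "(complex^'k \<Rightarrow> complex^'k \<Rightarrow> complex^'k \<Rightarrow> real)
     \<Rightarrow> complex^'k \<Rightarrow> complex^'k \<Rightarrow> complex^'k \<Rightarrow> real" where
  "kaehler_form g w u v = g w (J u) v"

text \<open>The last clause is \<open>d\<omega> = 0\<close>, evaluated on constant vector fields \<open>u\<close>, \<open>v\<close>, \<open>x\<close>.\<close>

definition kaehler_metric ::
  "(complex^'k) set \<Rightarrow> (complex^'k \<Rightarrow> complex^'k \<Rightarrow> complex^'k \<Rightarrow> real) \<Rightarrow> bool" where
  "kaehler_metric W g \<longleftrightarrow> riemannian_metric W g \<and>
     (\<forall>w\<in>W. \<forall>u v. g w (J u) (J v) = g w u v) \<and>
     (\<forall>w\<in>W. \<forall>u v x.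
        dirD (\<lambda>z. kaehler_form g z v x) w u + dirD (\<lambda>z. kaehler_form g z x u) w v
        + dirD (\<lambda>z. kaehler_form g z u v) w x = 0)"

text \<open>
  \<open>christoffel g w u v\<close> is \<open>\<nabla>\<^sub>u v\<close> at \<open>w\<close> for constant vector fields, \<open>\<nabla>\<close> being the Levi-Civita
  connection (Koszul formula).
\<close>

definition christoffel :: "('a::euclidean_space \<Rightarrow> 'a \<Rightarrow> 'a \<Rightarrow> real) \<Rightarrow> 'a \<Rightarrow> 'a \<Rightarrow> 'a \<Rightarrow> 'a" where
  "christoffel g w u v = (THE y. \<forall>x. 2 * g w y x =
     dirD (\<lambda>z. g z v x) w u + dirD (\<lambda>z. g z u x) w v - dirD (\<lambda>z. g z u v) w x)"

text \<open>\<open>R(u,v)x = \<nabla>\<^sub>u\<nabla>\<^sub>v x - \<nabla>\<^sub>v\<nabla>\<^sub>u x\<close> for constant vector fields (whose brackets vanish).\<close>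

definition curvature :: "('a::euclidean_space \<Rightarrow> 'a \<Rightarrow> 'a \<Rightarrow> real) \<Rightarrow> 'a \<Rightarrow> 'a \<Rightarrow> 'a \<Rightarrow> 'a \<Rightarrow> 'a"
  where
  "curvature g w u v x =
     frechet_derivative (\<lambda>z. christoffel g z v x) (at w) u
     - frechet_derivative (\<lambda>z. christoffel g z u x) (at w) v
     + christoffel g w u (christoffel g w v x) - christoffel g w v (christoffel g w u x)"

text \<open>Signs: the sectional curvature of the plane of \<open>u\<close>, \<open>v\<close> is a positive multiple of
  \<open>g (R(u,v)v) u\<close>.\<close>

definition bisectional_curvature ::
  "(complex^'k \<Rightarrow> complex^'k \<Rightarrow> complex^'k \<Rightarrow> real)
     \<Rightarrow> complex^'k \<Rightarrow> complex^'k \<Rightarrow> complex^'k \<Rightarrow> real" where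
  "bisectional_curvature g w u v =
     g w (curvature g w u (J u) (J v)) v / (g w u u * g w v v)"

definition holomorphic_sectional_curvature ::
  "(complex^'k \<Rightarrow> complex^'k \<Rightarrow> complex^'k \<Rightarrow> real) \<Rightarrow> complex^'k \<Rightarrow> complex^'k \<Rightarrow> real" where
  "holomorphic_sectional_curvature g w u =
     g w (curvature g w u (J u) (J u)) u / (g w u u)\<^sup>2"

definition ricci_tensor ::
  "('a::euclidean_space \<Rightarrow> 'a \<Rightarrow> 'a \<Rightarrow> real) \<Rightarrow> 'a \<Rightarrow> 'a \<Rightarrow> 'a \<Rightarrow> real" where
  "ricci_tensor g w u v = trace_on UNIV (\<lambda>x. curvature g w x u v)"

definition ricci_curvature ::
  "('a::euclidean_space \<Rightarrow> 'a \<Rightarrow> 'a \<Rightarrow> real) \<Rightarrow> 'a \<Rightarrow> 'a \<Rightarrow> real" where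
  "ricci_curvature g w u = ricci_tensor g w u u / g w u u"

end

theory Submission imports Defs "HOL-Complex_Analysis.Cauchy_Integral_Formula" begin

text \<open>
  A Hodge structure is encoded by the real matrix \<open>Y\<close> acting as \<open>\<i> (r - n/2)\<close> on \<open>H\<^sup>r\<^sup>,\<^sup>n\<^sup>-\<^sup>r\<close>,
  together with its Weil operator \<open>C\<close>.  Along a slice, holomorphy and horizontality say that
  \<open>dY(Ju) = - [Y, dY(u)]\<close>.  The Killing form of the Lie algebra of \<open>Aut Q\<close> is
  \<open>N - 2 (-1)\<^sup>n\<close> times the trace form (\<open>N\<close> the rank), so the pulled back metric is a multiple of
  \<open>tr (dY(u) dY(v))\<close>: up to a constant, \<open>Y\<close> is an isometric immersion of the slice into a space
  of matrices with an indefinite flat metric.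

  The second fundamental form of \<open>Y\<close> is \<open>c(u,v) + N(u,v)\<close>, where \<open>c(u,v) = [[Y, dY(u)], dY(v)]\<close>
  commutes with \<open>C\<close> and \<open>N(u,v)\<close> anticommutes with \<open>C\<close>.  The Gauss equation expresses the
  bisectional curvature as a positive multiple of
  \<open>tr c(u,v)\<^sup>2 + tr [dY(u), dY(v)]\<^sup>2 - 2 tr N(u,v)\<^sup>2\<close>.  The trace form is negative definite on the
  part of the Lie algebra commuting with \<open>C\<close> and positive definite on the anticommuting part, so
  each term is nonpositive.  Since \<open>tr (c(u,u) Y) = - tr dY(u)\<^sup>2\<close>, the Cauchy--Schwarz inequality
  bounds \<open>tr c(u,u)\<^sup>2\<close> away from zero by means of \<open>tr Y\<^sup>2\<close>, a constant on the classifying space.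
  This is the bound on the holomorphic sectional curvature; the Ricci curvature is half the sum of
  the bisectional curvatures over an orthonormal basis.
\<close>

section \<open>Holomorphic and smooth functions of several variables\<close>

text \<open>A Hodge decomposition grades the endomorphisms of H, and \<open>comm Y\<close> acts on
  degree p by i p. Holomorphy and horizontality put dY into degrees \<plusminus> 1, which is the
  single linear identity \<open>comm Y (comm Y X) = - X\<close>; it can be differentiated and spares
  all splitting into complex types. As C has eigenvalues i^(r-s), it anticommutes with degrees
  \<plusminus> 1 and commutes with degree 0. No degree \<plusminus> 2 occurs in second derivatives:
  their symmetry forces the integrability condition \<open>cc_sym\<close>. Two obstacles shape the
  rest. First, \<open>proj\<close> and \<open>pullback_metric\<close> are definite descriptions over
  group elements and over differentiable lifts to the group, so transitivity of \<open>Aut Q\<close>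
  and a local lift (a square root of matrices near 1) have to be proved before the metric can be
  evaluated at all. Second, a chart offers one complex derivative, while the curvature takes three
  derivatives of Y. Regularity comes from Cauchy's formula; the projectors onto the Hodge
  filtration, which involve conjugate spaces and are not holomorphic in general, inherit it through
  linear systems with smooth coefficients.\<close>

lemma norm_vsmult: "norm (c *s v) = cmod c * norm (v :: complex^'k)"
  by (simp add: norm_vec_def norm_mult L2_set_right_distrib)

lemma bounded_linear_vsmult_left: "bounded_linear (\<lambda>c. c *s (v :: complex^'k))"
  by (rule bounded_linear_intro[where K = "norm v"])
     (simp_all add: vec_eq_iff distrib_right norm_vsmult mult.commute)

section \<open>Cauchy's formula on complex lines and the regularity of holomorphic functions\<close>

definition complex_differentiable_on :: "(complex^'k) set \<Rightarrow> (complex^'k \<Rightarrow> complex) \<Rightarrow> bool" where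
  "complex_differentiable_on W s \<longleftrightarrow>
     (\<forall>w\<in>W. \<exists>s'. (s has_derivative s') (at w) \<and> (\<forall>c v. s' (c *s v) = c * s' v))"

text \<open>On the complex line of the points x + \<zeta> v the function is holomorphic in one
  variable. This is Cauchy's formula for its derivative at 0; parametrizing the circle over [0,1]
  turns d\<zeta> / \<zeta>^2 into a constant multiple of dt / \<zeta>.\<close>

lemma cauchy_directional_derivative:
  fixes s :: "complex^'k \<Rightarrow> complex"
  assumes s: "\<And>w. w \<in> cball x R \<Longrightarrow> (s has_derivative s' w) (at w)"
    and s'lin: "\<And>w c v. w \<in> cball x R \<Longrightarrow> s' w (c *s v) = c * s' w v"
    and "0 < \<rho>" and \<rho>: "\<rho> * norm v \<le> R"
  shows "((\<lambda>t. s (x + (\<rho> * exp (2 * of_real pi * \<i> * of_real t)) *s v) /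
     (\<rho> * exp (2 * of_real pi * \<i> * of_real t))) has_integral s' x v) {0..1}"
proof -
  let ?\<phi> = "\<lambda>\<zeta>. s (x + \<zeta> *s v)"
  have inc: "x + \<zeta> *s v \<in> cball x R" if "\<zeta> \<in> cball 0 \<rho>" for \<zeta>
  proof -
    have "cmod \<zeta> * norm v \<le> \<rho> * norm v" using that by (intro mult_right_mono) auto
    then show ?thesis using \<rho> by (auto simp: dist_norm norm_vsmult)
  qed
  have der: "(?\<phi> has_field_derivative s' (x + \<zeta> *s v) v) (at \<zeta>)" if "\<zeta> \<in> cball 0 \<rho>" for \<zeta>
  proof -
    have "((\<lambda>\<zeta>. x + \<zeta> *s v) has_derivative (\<lambda>h. h *s v)) (at \<zeta>)"
      by (auto intro!: derivative_eq_intros bounded_linear.has_derivative[OF bounded_linear_vsmult_left])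
    then have "(?\<phi> has_derivative (\<lambda>h. s' (x + \<zeta> *s v) (h *s v))) (at \<zeta>)"
      by (rule has_derivative_compose) (rule s[OF inc[OF that]])
    then show ?thesis
      unfolding has_field_derivative_def using s'lin[OF inc[OF that]] by (simp add: mult_commute_abs)
  qed
  have hol: "?\<phi> holomorphic_on cball 0 \<rho>"
    using der by (meson has_field_derivative_at_within holomorphic_onI field_differentiable_def)
  have cont: "continuous_on (cball 0 \<rho>) ?\<phi>" using hol by (rule holomorphic_on_imp_continuous_on)
  have holb: "?\<phi> holomorphic_on ball 0 \<rho>" using hol by (rule holomorphic_on_subset) auto
  have 0: "(0::complex) \<in> ball 0 \<rho>" using \<open>0 < \<rho>\<close> by simp
  let ?I = "contour_integral (circlepath 0 \<rho>) (\<lambda>u. ?\<phi> u / (u - 0)^2)"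
  have int: "(\<lambda>u. ?\<phi> u / (u - 0)^2) contour_integrable_on (circlepath 0 \<rho>)"
    and "(?\<phi> has_field_derivative 1 / (2 * of_real pi * \<i>) * ?I) (at 0)"
    using Cauchy_derivative_integral_circlepath[OF cont holb 0] by blast+
  then have "1 / (2 * of_real pi * \<i>) * ?I = s' x v"
    using der[of 0] \<open>0 < \<rho>\<close> by (auto intro: DERIV_unique)
  then have I: "?I = 2 * of_real pi * \<i> * s' x v" by (auto simp: field_simps)
  have "((\<lambda>u. ?\<phi> u / (u - 0)^2) has_contour_integral (2 * of_real pi * \<i> * s' x v)) (circlepath 0 \<rho>)"
    using has_contour_integral_integral[OF int] unfolding I .
  then have "((\<lambda>t. ?\<phi> (circlepath 0 \<rho> t) / (circlepath 0 \<rho> t)^2 * vector_derivative (circlepath 0 \<rho>) (at t within {0..1}))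
      has_integral (2 * of_real pi * \<i> * s' x v)) {0..1}"
    by (simp add: has_contour_integral_def)
  then have "((\<lambda>t. ?\<phi> (circlepath 0 \<rho> t) / (circlepath 0 \<rho> t)^2 * (2 * pi * \<i> * \<rho> * exp (2 * of_real pi * \<i> * t)))
      has_integral (2 * of_real pi * \<i> * s' x v)) {0..1}"
    by (rule has_integral_eq[rotated]) (simp add: vector_derivative_circlepath01)
  then have "((\<lambda>t. 1 / (2 * of_real pi * \<i>) * (?\<phi> (circlepath 0 \<rho> t) / (circlepath 0 \<rho> t)^2 *
      (2 * pi * \<i> * \<rho> * exp (2 * of_real pi * \<i> * t))))
      has_integral (1 / (2 * of_real pi * \<i>) * (2 * of_real pi * \<i> * s' x v))) {0..1}"
    by (rule has_integral_mult_right)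
  moreover have "1 / (2 * of_real pi * \<i>) * (?\<phi> (circlepath 0 \<rho> t) / (circlepath 0 \<rho> t)^2 *
      (2 * pi * \<i> * \<rho> * exp (2 * of_real pi * \<i> * t))) =
      s (x + (\<rho> * exp (2 * of_real pi * \<i> * of_real t)) *s v) /
     (\<rho> * exp (2 * of_real pi * \<i> * of_real t))" for t
    unfolding circlepath add_0 power2_eq_square using \<open>0 < \<rho>\<close> by (simp add: field_simps)
  moreover have "1 / (2 * of_real pi * \<i>) * (2 * of_real pi * \<i> * s' x v) = s' x v" by simp
  ultimately show ?thesis by simp
qed

text \<open>One circle z serves all centres x of the smaller ball, so that x becomes a mere
  parameter of the integral.\<close>

lemma cauchy_directional_derivative_ball:
  fixes s :: "complex^'k \<Rightarrow> complex"
  assumes der: "\<And>w. w \<in> W \<Longrightarrow> (s has_derivative s' w) (at w)"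
    and lin: "\<And>w c v. w \<in> W \<Longrightarrow> s' w (c *s v) = c * s' w v"
    and r: "0 < r" "cball w0 r \<subseteq> W"
  obtains z where "continuous_on UNIV z" "\<And>t. z t \<noteq> 0"
    "\<And>x t. x \<in> ball w0 (r / 2) \<Longrightarrow> x + z t *s v \<in> W"
    "\<And>x. x \<in> ball w0 (r / 2) \<Longrightarrow>
       ((\<lambda>t::real. s (x + z t *s v) / z t) has_integral s' x v) {0..1}"
proof -
  define R where "R = r / 2"
  have "0 < R" using r by (simp add: R_def)
  have v: "1 + norm v > 0" by (rule add_pos_nonneg) auto
  have BW: "cball x R \<subseteq> W" if "x \<in> ball w0 R" for x
  proof -
    have "cball x R \<subseteq> cball w0 r"
    proof
      fix y assume "y \<in> cball x R"
      then have "dist w0 y \<le> dist w0 x + dist x y" "dist x y \<le> R" by (auto intro: dist_triangle)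
      then show "y \<in> cball w0 r" using that by (auto simp: R_def)
    qed
    then show ?thesis using r by blast
  qed
  \<comment> \<open>The added 1 keeps the radius meaningful for v = 0 and still gives \<rho> * norm
    v \<le> R.\<close>
  define \<rho> where "\<rho> = R / (1 + norm v)"
  define z where "z t = complex_of_real \<rho> * exp (2 * of_real pi * \<i> * complex_of_real t)" for t
  have "0 < \<rho>" using v \<open>0 < R\<close> by (simp add: \<rho>_def)
  have \<rho>v: "\<rho> * norm v \<le> R" using v \<open>0 < R\<close> by (simp add: \<rho>_def divide_simps)
  have zn: "norm (z t *s v) \<le> R" for t
    using \<rho>v \<open>0 < \<rho>\<close> by (simp add: z_def norm_vsmult norm_mult)
  show ?thesis
  proof
    show "continuous_on UNIV z" unfolding z_def by (intro continuous_intros)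
    show "z t \<noteq> 0" for t using \<open>0 < \<rho>\<close> by (simp add: z_def)
    show "x + z t *s v \<in> W" if "x \<in> ball w0 (r / 2)" for x t
      using BW[of x] that zn[of t] by (auto simp: R_def dist_norm subset_iff)
    show "((\<lambda>t. s (x + z t *s v) / z t) has_integral s' x v) {0..1}"
      if "x \<in> ball w0 (r / 2)" for x
      unfolding z_def
    proof (rule cauchy_directional_derivative[OF _ _ \<open>0 < \<rho>\<close> \<rho>v])
      have "cball x R \<subseteq> W" using BW that by (simp add: R_def)
      then show "(s has_derivative s' w) (at w)" "s' w (c *s u) = c * s' w u"
        if "w \<in> cball x R" for w c u
        using that der lin by blast+
    qed
  qed
qed

text \<open>The Cauchy integral depends continuously on its centre. Differentiation under the
  integral sign, in the next lemma, asks for this continuity.\<close>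

lemma complex_derivative_continuous:
  fixes s :: "complex^'k \<Rightarrow> complex"
  assumes "open W"
    and der: "\<And>w. w \<in> W \<Longrightarrow> (s has_derivative s' w) (at w)"
    and lin: "\<And>w c v. w \<in> W \<Longrightarrow> s' w (c *s v) = c * s' w v"
  shows "continuous_on W (\<lambda>x. Blinfun (s' x))"
proof (rule continuous_on_blinfun_componentwise)
  fix v :: "complex^'k"
  have bl: "bounded_linear (s' x)" if "x \<in> W" for x using der[OF that] by (rule has_derivative_bounded_linear)
  have "isCont (\<lambda>x. s' x v) w0" if w0: "w0 \<in> W" for w0
  proof -
    obtain r where r: "0 < r" "cball w0 r \<subseteq> W" using \<open>open W\<close> w0 open_contains_cball by blast
    let ?B = "ball w0 (r / 2)"
    obtain z where zc: "continuous_on UNIV z" and z0: "\<And>t. z t \<noteq> 0"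
      and inW: "\<And>x t. x \<in> ?B \<Longrightarrow> x + z t *s v \<in> W"
      and int: "\<And>x. x \<in> ?B \<Longrightarrow> ((\<lambda>t::real. s (x + z t *s v) / z t) has_integral s' x v) {0..1}"
      using cauchy_directional_derivative_ball[OF der lin r] by blast
    have contW: "continuous_on W s"
      using der by (meson continuous_at_imp_continuous_on has_derivative_continuous)
    have "continuous_on ?B (\<lambda>x. integral (cbox 0 1) (\<lambda>t. s (x + z t *s v) / z t))"
    proof (rule integral_continuous_on_param)
      have m: "continuous_on (?B \<times> cbox 0 1) (\<lambda>p. fst p + z (snd p) *s v)"
        by (intro continuous_intros continuous_on_compose2[OF linear_continuous_on[OF bounded_linear_vsmult_left]]
            continuous_on_compose2[OF zc]) auto
      have "continuous_on (?B \<times> cbox 0 1) (\<lambda>p. s (fst p + z (snd p) *s v))"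
        by (rule continuous_on_compose2[OF contW m]) (auto intro: inW)
      then show "continuous_on (?B \<times> cbox 0 1) (\<lambda>(x, t). s (x + z t *s v) / z t)"
        unfolding case_prod_unfold
        by (intro continuous_intros continuous_on_compose2[OF zc]) (auto simp: z0)
    qed
    moreover have "integral (cbox 0 1) (\<lambda>t. s (x + z t *s v) / z t) = s' x v" if "x \<in> ?B" for x
      using int[OF that] by (simp add: integral_unique)
    ultimately have "continuous_on ?B (\<lambda>x. s' x v)" by (rule continuous_on_eq)
    then show ?thesis using r by (simp add: continuous_on_eq_continuous_at)
  qed
  then have "continuous_on W (\<lambda>x. s' x v)" by (simp add: continuous_at_imp_continuous_on)
  moreover have "\<And>x. x \<in> W \<Longrightarrow> blinfun_apply (Blinfun (s' x)) v = s' x v"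
    using bl by (simp add: bounded_linear_Blinfun_apply)
  ultimately show "continuous_on W (\<lambda>x. blinfun_apply (Blinfun (s' x)) v)"
    by (simp cong: continuous_on_cong)
qed

text \<open>Differentiate the Cauchy integral under the integral sign; complex factors pass through
  the integral, so the new derivative is again complex linear.\<close>

lemma complex_differentiable_on_derivative:
  fixes s :: "complex^'k \<Rightarrow> complex"
  assumes "open W"
    and der: "\<And>w. w \<in> W \<Longrightarrow> (s has_derivative s' w) (at w)"
    and lin: "\<And>w c v. w \<in> W \<Longrightarrow> s' w (c *s v) = c * s' w v"
  shows "complex_differentiable_on W (\<lambda>w. s' w v)"
  unfolding complex_differentiable_on_def
proof
  fix w0 assume "w0 \<in> W"
  then obtain r where r: "0 < r" "cball w0 r \<subseteq> W" using \<open>open W\<close> open_contains_cball by blast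
  let ?B = "ball w0 (r / 2)"
  obtain z where zc: "continuous_on UNIV z" and z0: "\<And>t. z t \<noteq> 0"
    and inW: "\<And>x t. x \<in> ?B \<Longrightarrow> x + z t *s v \<in> W"
    and int: "\<And>x. x \<in> ?B \<Longrightarrow> ((\<lambda>t::real. s (x + z t *s v) / z t) has_integral s' x v) {0..1}"
    using cauchy_directional_derivative_ball[OF der lin r] by blast
  have bl: "bounded_linear (s' x)" if "x \<in> W" for x using der[OF that] by (rule has_derivative_bounded_linear)
  have contW: "continuous_on W (\<lambda>x. Blinfun (s' x))"
    using complex_derivative_continuous[OF assms] .
  define fx where "fx x t = blinfun_mult_right (inverse (z t)) o\<^sub>L Blinfun (s' (x + z t *s v))" for x t
  have fx: "blinfun_apply (fx x t) = (\<lambda>h. inverse (z t) * s' (x + z t *s v) h)" if "x \<in> ?B" for x t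
    unfolding fx_def using bl[OF inW[OF that]] by (auto simp: bounded_linear_Blinfun_apply)
  have m: "continuous_on (?B \<times> cbox 0 1) (\<lambda>p. fst p + z (snd p) *s v)"
    by (intro continuous_intros continuous_on_compose2[OF linear_continuous_on[OF bounded_linear_vsmult_left]]
        continuous_on_compose2[OF zc]) auto
  have cfx: "continuous_on (?B \<times> cbox 0 1) (\<lambda>(x, t). fx x t)"
    unfolding case_prod_unfold fx_def
    by (intro continuous_intros continuous_on_compose2[OF contW m]
        continuous_on_compose2[OF linear_continuous_on[OF bounded_linear_blinfun_mult_right]]
        continuous_on_compose2[OF zc]) (auto simp: z0 intro: inW)
  have w0: "w0 \<in> ?B" using r by simp
  have "((\<lambda>x. integral (cbox 0 1) (\<lambda>t. s (x + z t *s v) / z t)) has_derivative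
      integral (cbox 0 1) (fx w0)) (at w0 within ?B)"
  proof (rule leibniz_rule[OF _ _ cfx w0])
    fix x t assume x: "x \<in> ?B"
    have "((\<lambda>x. x + z t *s v) has_derivative (\<lambda>h. h)) (at x)"
      by (auto intro!: derivative_eq_intros)
    then have "((\<lambda>x. s (x + z t *s v)) has_derivative s' (x + z t *s v)) (at x)"
      using has_derivative_compose[where f = "\<lambda>x. x + z t *s v" and g = s] der[OF inW[OF x]] by fastforce
    then have "((\<lambda>x. inverse (z t) * s (x + z t *s v)) has_derivative (\<lambda>h. inverse (z t) * s' (x + z t *s v) h)) (at x)"
      by (rule has_derivative_mult_right)
    then show "((\<lambda>x. s (x + z t *s v) / z t) has_derivative blinfun_apply (fx x t)) (at x within ?B)"
      unfolding fx[OF x] divide_inverse mult.commute[of _ "inverse (z t)"]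
      by (rule has_derivative_at_withinI)
  next
    show "(\<lambda>t. s (x + z t *s v) / z t) integrable_on cbox 0 1" if "x \<in> ?B" for x
      using int[OF that] by auto
  qed simp
  then have "((\<lambda>x. integral (cbox 0 1) (\<lambda>t. s (x + z t *s v) / z t)) has_derivative
      integral (cbox 0 1) (fx w0)) (at w0)"
    unfolding at_within_open[OF w0 open_ball] .
  then have D: "((\<lambda>x. s' x v) has_derivative integral (cbox 0 1) (fx w0)) (at w0)"
    by (rule has_derivative_transform_within_open[OF _ open_ball w0]) (simp add: int[THEN integral_unique])
  have "continuous_on (cbox 0 1) (fx w0)"
  proof -
    have "continuous_on (cbox 0 1) (\<lambda>t::real. (w0, t))" by (intro continuous_intros)
    from continuous_on_compose2[OF cfx this] show ?thesis using w0 by (auto simp: image_subset_iff)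
  qed
  then have i: "fx w0 integrable_on cbox 0 1" by (rule integrable_continuous)
  have ap: "blinfun_apply (integral (cbox 0 1) (fx w0)) h =
      integral (cbox 0 1) (\<lambda>t. inverse (z t) * s' (w0 + z t *s v) h)" for h
    using blinfun_apply_integral[OF i, of h] fx[OF w0] by simp
  have "integral (cbox 0 1) (fx w0) (c *s u) = c * integral (cbox 0 1) (fx w0) u" for c u
    unfolding ap lin[OF inW[OF w0]] mult.left_commute[of _ c]
    by (rule integral_mult_right)
  then show "\<exists>s''. ((\<lambda>w. s' w v) has_derivative s'') (at w0) \<and> (\<forall>c u. s'' (c *s u) = c * s'' u)"
    using D by blast
qed

text \<open>
  Working with an inductive class closed under the operations that occur avoids all higher-order
  chain rules: the class is closed under derivatives, hence consists of smooth functions.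
\<close>

inductive smoothC :: "(complex^'k) set \<Rightarrow> (complex^'k \<Rightarrow> complex) \<Rightarrow> bool" where
  holo: "open W \<Longrightarrow> complex_differentiable_on W f \<Longrightarrow> smoothC W f"
| cnj: "smoothC W f \<Longrightarrow> smoothC W (\<lambda>w. cnj (f w))"
| add: "smoothC W f \<Longrightarrow> smoothC W g \<Longrightarrow> smoothC W (\<lambda>w. f w + g w)"
| mult: "smoothC W f \<Longrightarrow> smoothC W g \<Longrightarrow> smoothC W (\<lambda>w. f w * g w)"
| inverse: "smoothC W f \<Longrightarrow> (\<And>w. w \<in> W \<Longrightarrow> f w \<noteq> 0) \<Longrightarrow> smoothC W (\<lambda>w. inverse (f w))"
| local: "open W \<Longrightarrow> (\<And>w. w \<in> W \<Longrightarrow> \<exists>W' g. open W' \<and> w \<in> W' \<and> smoothC W' g \<and> (\<forall>x\<in>W' \<inter> W. f x = g x))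
    \<Longrightarrow> smoothC W f"

section \<open>Calculus of the smooth class\<close>

lemma smoothC_open: "smoothC W f \<Longrightarrow> open W"
  by (induction rule: smoothC.induct) auto

lemma smoothC_cong: "smoothC W f \<Longrightarrow> (\<And>w. w \<in> W \<Longrightarrow> f w = g w) \<Longrightarrow> smoothC W g"
  by (rule smoothC.local[OF smoothC_open]) (assumption, metis IntD2 smoothC_open)

lemma smoothC_subset: "smoothC W f \<Longrightarrow> open W' \<Longrightarrow> W' \<subseteq> W \<Longrightarrow> smoothC W' f"
  by (rule smoothC.local) (assumption, metis smoothC_open subsetD)

lemma smoothC_const [simp]: "open W \<Longrightarrow> smoothC W (\<lambda>w. c)"
  by (rule smoothC.holo) (auto simp: complex_differentiable_on_def intro!: exI[where x = "\<lambda>_. 0"])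

lemma smoothC_minus: "smoothC W f \<Longrightarrow> smoothC W (\<lambda>w. - f w)"
  using smoothC.mult[OF smoothC_const[of W "-1"]] by (fastforce dest: smoothC_open)

lemma smoothC_diff: "smoothC W f \<Longrightarrow> smoothC W g \<Longrightarrow> smoothC W (\<lambda>w. f w - g w)"
  using smoothC.add[OF _ smoothC_minus] by fastforce

lemma smoothC_sum: "open W \<Longrightarrow> (\<And>i. i \<in> I \<Longrightarrow> smoothC W (f i)) \<Longrightarrow> smoothC W (\<lambda>w. \<Sum>i\<in>I. f i w)"
  by (induction I rule: infinite_finite_induct) (auto intro: smoothC.add)

lemma smoothC_prod: "open W \<Longrightarrow> (\<And>i. i \<in> I \<Longrightarrow> smoothC W (f i)) \<Longrightarrow> smoothC W (\<lambda>w. \<Prod>i\<in>I. f i w)"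
  by (induction I rule: infinite_finite_induct) (auto intro: smoothC.mult)

lemma smoothC_divide: "smoothC W f \<Longrightarrow> smoothC W g \<Longrightarrow> (\<And>w. w \<in> W \<Longrightarrow> g w \<noteq> 0) \<Longrightarrow> smoothC W (\<lambda>w. f w / g w)"
  unfolding divide_inverse by (intro smoothC.mult smoothC.inverse)

lemma smoothC_det:
  fixes M :: "complex^'k \<Rightarrow> complex^'m^'m"
  shows "open W \<Longrightarrow> (\<And>i j. smoothC W (\<lambda>w. M w $ i $ j)) \<Longrightarrow> smoothC W (\<lambda>w. det (M w))"
  unfolding det_def by (intro smoothC_sum smoothC_prod smoothC.mult smoothC_const) auto

text \<open>Cramer's rule writes the solution as a quotient of determinants. It serves twice: for
  the Christoffel symbols and for the projectors onto the Hodge filtration.\<close>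

lemma smoothC_solve:
  fixes M :: "complex^'k \<Rightarrow> complex^'m^'m"
  assumes "open W" and M: "\<And>i j. smoothC W (\<lambda>w. M w $ i $ j)" and b: "\<And>i. smoothC W (\<lambda>w. b w $ i)"
    and "\<And>w. w \<in> W \<Longrightarrow> det (M w) \<noteq> 0" and "\<And>w. w \<in> W \<Longrightarrow> M w *v y w = b w"
  shows "smoothC W (\<lambda>w. y w $ i)"
proof (rule smoothC_cong)
  show "smoothC W (\<lambda>w. det (\<chi> i' j. if j = i then b w $ i' else M w $ i' $ j) / det (M w))"
  proof (intro smoothC_divide smoothC_det)
    show "smoothC W (\<lambda>w. (\<chi> i' j. if j = i then b w $ i' else M w $ i' $ j) $ a $ c)" for a c
      by (cases "c = i") (simp_all add: M b)
  qed (use assms in auto)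
  show "det (\<chi> i' j. if j = i then b w $ i' else M w $ i' $ j) / det (M w) = y w $ i" if "w \<in> W" for w
    using assms(4,5)[OF that] by (simp add: cramer)
qed

lemma smoothC_has_derivative:
  assumes "smoothC W f"
  shows "\<exists>f'. (\<forall>w\<in>W. (f has_derivative f' w) (at w)) \<and> (\<forall>v. smoothC W (\<lambda>w. f' w v))"
  using assms
proof (induction rule: smoothC.induct)
  case (holo W f)
  then obtain f' where f': "\<And>w. w \<in> W \<Longrightarrow> (f has_derivative f' w) (at w)"
      "\<And>w c v. w \<in> W \<Longrightarrow> f' w (c *s v) = c * f' w v"
    unfolding complex_differentiable_on_def by metis
  then show ?case
    using complex_differentiable_on_derivative[OF holo(1) f'] smoothC.holo[OF holo(1)] by blast
next
  case (cnj W f)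
  then obtain f' where "\<forall>w\<in>W. (f has_derivative f' w) (at w)" "\<forall>v. smoothC W (\<lambda>w. f' w v)" by blast
  then show ?case
    by (intro exI[where x = "\<lambda>w v. cnj (f' w v)"])
       (auto intro!: smoothC.cnj has_derivative_cnj)
next
  case (add W f g)
  then obtain f' g' where "\<forall>w\<in>W. (f has_derivative f' w) (at w)" "\<forall>v. smoothC W (\<lambda>w. f' w v)"
    "\<forall>w\<in>W. (g has_derivative g' w) (at w)" "\<forall>v. smoothC W (\<lambda>w. g' w v)" by blast
  then show ?case
    by (intro exI[where x = "\<lambda>w v. f' w v + g' w v"])
       (auto intro!: smoothC.add has_derivative_add)
next
  case (mult W f g)
  then obtain f' g' where "\<forall>w\<in>W. (f has_derivative f' w) (at w)" "\<forall>v. smoothC W (\<lambda>w. f' w v)"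
    "\<forall>w\<in>W. (g has_derivative g' w) (at w)" "\<forall>v. smoothC W (\<lambda>w. g' w v)" by blast
  then show ?case
    using mult.hyps
    by (intro exI[where x = "\<lambda>w v. f w * g' w v + f' w v * g w"])
       (auto intro!: smoothC.add smoothC.mult has_derivative_mult)
next
  case (inverse W f)
  then obtain f' where "\<forall>w\<in>W. (f has_derivative f' w) (at w)" "\<forall>v. smoothC W (\<lambda>w. f' w v)" by blast
  then show ?case
    using inverse.hyps
    by (intro exI[where x = "\<lambda>w v. - (inverse (f w) * f' w v * inverse (f w))"])
       (auto intro!: smoothC_minus smoothC.mult smoothC.inverse has_derivative_inverse)
next
  case (local W f)
  have loc: "\<exists>W' g'. open W' \<and> w \<in> W' \<and> (\<forall>v. smoothC W' (\<lambda>w. g' w v)) \<and>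
      (\<forall>x\<in>W' \<inter> W. (f has_derivative g' x) (at x))" if w: "w \<in> W" for w
  proof -
    obtain W' g g' where W': "open W'" "w \<in> W'" and g: "\<forall>x\<in>W' \<inter> W. f x = g x"
      and g': "\<forall>w\<in>W'. (g has_derivative g' w) (at w)" "\<forall>v. smoothC W' (\<lambda>w. g' w v)"
      using local(2)[OF w] by blast
    have "(f has_derivative g' x) (at x)" if "x \<in> W' \<inter> W" for x
      by (rule has_derivative_transform_within_open[of g "g' x" x UNIV "W' \<inter> W"])
         (use that g g' W' local(1) in auto)
    then show ?thesis using W' g' by blast
  qed
  then have "\<forall>w\<in>W. \<exists>f'. (f has_derivative f') (at w)" by blast
  then obtain f' where f': "\<forall>w\<in>W. (f has_derivative f' w) (at w)" by metis
  \<comment> \<open>Derivatives of different local representatives agree by uniqueness of the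
    derivative, so the glued f' is locally smooth.\<close>
  have "smoothC W (\<lambda>w. f' w v)" for v
  proof (rule smoothC.local[OF local(1)])
    fix w assume "w \<in> W"
    then obtain W' g' where W': "open W'" "w \<in> W'" "\<forall>v. smoothC W' (\<lambda>w. g' w v)"
        and g': "\<forall>x\<in>W' \<inter> W. (f has_derivative g' x) (at x)"
      using loc by blast
    have "f' x v = g' x v" if "x \<in> W' \<inter> W" for x
      using has_derivative_unique[of f "f' x" x "g' x"] g' f' that by auto
    then show "\<exists>W' g. open W' \<and> w \<in> W' \<and> smoothC W' g \<and> (\<forall>x\<in>W' \<inter> W. f' x v = g x)"
      using W' by blast
  qed
  then show ?case using f' by blast
qed

text \<open>The derivative of a real-valued member of the class is real-valued, hence equal to its
  real part, and the induction continues with a real function.\<close>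

lemma smoothC_Ck_on:
  assumes "smoothC W (\<lambda>w. complex_of_real (F w))"
  shows "Ck_on k W F"
  using assms
proof (induction k arbitrary: F)
  case 0
  then obtain f' where "\<forall>w\<in>W. ((\<lambda>w. complex_of_real (F w)) has_derivative f' w) (at w)"
    using smoothC_has_derivative by blast
  then have "continuous_on W (\<lambda>w. complex_of_real (F w))"
    by (meson continuous_at_imp_continuous_on has_derivative_continuous)
  from continuous_on_Re[OF this] show ?case by simp
next
  case (Suc k)
  then obtain f' where f': "\<forall>w\<in>W. ((\<lambda>w. complex_of_real (F w)) has_derivative f' w) (at w)"
      "\<And>v. smoothC W (\<lambda>w. f' w v)"
    using smoothC_has_derivative by blast
  have F': "(F has_derivative (\<lambda>v. Re (f' w v))) (at w)" if "w \<in> W" for w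
    using has_derivative_Re[OF f'(1)[rule_format, OF that]] by simp
  have "f' w v = complex_of_real (Re (f' w v))" if "w \<in> W" for w v
    using fun_cong[OF has_derivative_unique[OF f'(1)[rule_format, OF that]
        has_derivative_of_real[OF F'[OF that]]]] .
  then have "smoothC W (\<lambda>w. complex_of_real (Re (f' w v)))" for v
    by (rule smoothC_cong[OF f'(2)])
  then show ?case using F' Suc.IH by (auto intro!: exI[where x = "\<lambda>w v. Re (f' w v)"])
qed

section \<open>Smooth maps into Euclidean spaces\<close>

definition smooth_on :: "(complex^'k) set \<Rightarrow> (complex^'k \<Rightarrow> 'b::euclidean_space) \<Rightarrow> bool" where
  "smooth_on W F \<longleftrightarrow> open W \<and> (\<forall>b\<in>Basis. smoothC W (\<lambda>w. complex_of_real (F w \<bullet> b)))"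

lemma smooth_on_open: "smooth_on W F \<Longrightarrow> open W"
  by (simp add: smooth_on_def)

lemma smooth_on_real: "smooth_on W F \<longleftrightarrow> smoothC W (\<lambda>w. complex_of_real (F w))"
  unfolding smooth_on_def by (auto simp: smoothC_open)

lemma smooth_on_Ck_on: "smooth_on W F \<Longrightarrow> Ck_on k W F"
  by (simp add: smooth_on_real smoothC_Ck_on)

lemma smooth_on_cong: "smooth_on W f \<Longrightarrow> (\<And>w. w \<in> W \<Longrightarrow> f w = g w) \<Longrightarrow> smooth_on W g"
  unfolding smooth_on_def by (auto intro: smoothC_cong)

lemma smooth_on_inner: "smooth_on W F \<Longrightarrow> smooth_on W (\<lambda>w. F w \<bullet> b)"
  unfolding smooth_on_real euclidean_inner[of _ b] of_real_sum of_real_mult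
  by (intro smoothC_sum smoothC.mult smoothC_const) (auto simp: smooth_on_def)

lemma smooth_on_linear:
  fixes T :: "'b::euclidean_space \<Rightarrow> 'c::euclidean_space"
  assumes "linear T" and "smooth_on W F"
  shows "smooth_on W (\<lambda>w. T (F w))"
  unfolding smooth_on_def
proof safe
  show "open W" using assms smooth_on_open by auto
  fix b :: 'c assume "b \<in> Basis"
  have "T x \<bullet> b = (\<Sum>e\<in>Basis. (x \<bullet> e) * (T e \<bullet> b))" for x
  proof -
    have "T x = T (\<Sum>e\<in>Basis. (x \<bullet> e) *\<^sub>R e)" by (simp add: euclidean_representation)
    then show ?thesis using assms(1) by (simp add: linear_sum linear_cmul inner_sum_left)
  qed
  then have "(\<lambda>w. complex_of_real (T (F w) \<bullet> b)) =
      (\<lambda>w. \<Sum>e\<in>Basis. complex_of_real (F w \<bullet> e) * complex_of_real (T e \<bullet> b))"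
    unfolding of_real_mult[symmetric] of_real_sum[symmetric] by (intro ext arg_cong[where f = complex_of_real])
  then show "smoothC W (\<lambda>w. complex_of_real (T (F w) \<bullet> b))"
    using assms(2) unfolding smooth_on_def
    by (auto intro!: smoothC_sum smoothC.mult)
qed

lemma smooth_on_bilinear:
  fixes T :: "'a::euclidean_space \<Rightarrow> 'b::euclidean_space \<Rightarrow> 'c::euclidean_space"
  assumes "bilinear T" and "smooth_on W F" and "smooth_on W G"
  shows "smooth_on W (\<lambda>w. T (F w) (G w))"
  unfolding smooth_on_def
proof safe
  show "open W" using assms smooth_on_open by auto
  fix b :: 'c assume "b \<in> Basis"
  have "T x y \<bullet> b = (\<Sum>i\<in>Basis. \<Sum>j\<in>Basis. (x \<bullet> i) * (y \<bullet> j) * (T i j \<bullet> b))" for x y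
  proof -
    have "T x y = T (\<Sum>e\<in>Basis. (x \<bullet> e) *\<^sub>R e) (\<Sum>e\<in>Basis. (y \<bullet> e) *\<^sub>R e)" by (simp add: euclidean_representation)
    also have "\<dots> = (\<Sum>i\<in>Basis. \<Sum>j\<in>Basis. ((x \<bullet> i) * (y \<bullet> j)) *\<^sub>R T i j)"
      unfolding bilinear_sum[OF assms(1)] sum.cartesian_product
      by (simp add: bilinear_lmul[OF assms(1)] bilinear_rmul[OF assms(1)] mult.commute)
    finally show ?thesis by (simp add: inner_sum_left)
  qed
  then have "(\<lambda>w. complex_of_real (T (F w) (G w) \<bullet> b)) = (\<lambda>w. \<Sum>i\<in>Basis. \<Sum>j\<in>Basis.
      complex_of_real (F w \<bullet> i) * complex_of_real (G w \<bullet> j) * complex_of_real (T i j \<bullet> b))"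
    unfolding of_real_mult[symmetric] of_real_sum[symmetric] by (intro ext arg_cong[where f = complex_of_real])
  then show "smoothC W (\<lambda>w. complex_of_real (T (F w) (G w) \<bullet> b))"
    using assms(2,3) unfolding smooth_on_def
    by (auto intro!: smoothC_sum smoothC.mult)
qed

text \<open>Real and imaginary part are linear combinations of f and its conjugate.\<close>

lemma smooth_on_complex: "smoothC W f \<Longrightarrow> smooth_on W f"
proof -
  assume f: "smoothC W f"
  have "smoothC W (\<lambda>w. (f w + cnj (f w)) * (1/2))" "smoothC W (\<lambda>w. (f w - cnj (f w)) * (- \<i>/2))"
    using f by (intro smoothC.mult smoothC.add smoothC_diff smoothC.cnj smoothC_const; simp add: smoothC_open)+
  moreover have "(z + cnj z) * (1/2) = complex_of_real (Re z)" "(z - cnj z) * (- \<i>/2) = complex_of_real (Im z)" for z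
    by (auto simp: complex_eq_iff)
  ultimately show ?thesis using f by (auto simp: smooth_on_def Basis_complex_def smoothC_open)
qed

lemma smooth_on_has_derivative:
  fixes F :: "complex^'k \<Rightarrow> 'b::euclidean_space"
  assumes "smooth_on W F"
  shows "w \<in> W \<Longrightarrow> (F has_derivative frechet_derivative F (at w)) (at w)"
    and "smooth_on W (\<lambda>w. frechet_derivative F (at w) v)"
proof -
  have W: "open W" using assms by (simp add: smooth_on_def)
  have "\<forall>b\<in>Basis. \<exists>f'. (\<forall>w\<in>W. ((\<lambda>w. F w \<bullet> b) has_derivative f' w) (at w)) \<and>
      (\<forall>v. smoothC W (\<lambda>w. complex_of_real (f' w v)))"
  proof
    fix b :: 'b assume "b \<in> Basis"
    then obtain f' where f': "\<forall>w\<in>W. ((\<lambda>w. complex_of_real (F w \<bullet> b)) has_derivative f' w) (at w)"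
      "\<And>v. smoothC W (\<lambda>w. f' w v)"
      using assms smoothC_has_derivative unfolding smooth_on_def by blast
    have F': "((\<lambda>w. F w \<bullet> b) has_derivative (\<lambda>v. Re (f' w v))) (at w)" if "w \<in> W" for w
      using has_derivative_Re[OF f'(1)[rule_format, OF that]] by simp
    have "f' w v = complex_of_real (Re (f' w v))" if "w \<in> W" for w v
      using fun_cong[OF has_derivative_unique[OF f'(1)[rule_format, OF that]
          has_derivative_of_real[OF F'[OF that]]]] .
    then have "smoothC W (\<lambda>w. complex_of_real (Re (f' w v)))" for v
      by (rule smoothC_cong[OF f'(2)])
    then show "\<exists>f'. (\<forall>w\<in>W. ((\<lambda>w. F w \<bullet> b) has_derivative f' w) (at w)) \<and>
      (\<forall>v. smoothC W (\<lambda>w. complex_of_real (f' w v)))"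
      using F' by (intro exI[where x = "\<lambda>w v. Re (f' w v)"]) auto
  qed
  then obtain f' where f': "\<And>b w. b \<in> Basis \<Longrightarrow> w \<in> W \<Longrightarrow> ((\<lambda>w. F w \<bullet> b) has_derivative f' b w) (at w)"
    "\<And>b v. b \<in> Basis \<Longrightarrow> smoothC W (\<lambda>w. complex_of_real (f' b w v))" by metis
  define F' where "F' w v = (\<Sum>b\<in>Basis. f' b w v *\<^sub>R b)" for w v
  have F': "(F has_derivative F' w) (at w)" if "w \<in> W" for w
    using f'(1)[OF _ that] by (subst has_derivative_componentwise_within) (auto simp: F'_def inner_sum_left inner_Basis if_distrib cong: if_cong)
  then show D: "(F has_derivative frechet_derivative F (at w)) (at w)" if "w \<in> W" for w
    using that differentiableI frechet_derivative_works by blast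
  have "smooth_on W (\<lambda>w. F' w v)"
    using W f'(2) by (auto simp: smooth_on_def F'_def inner_sum_left inner_Basis if_distrib cong: if_cong)
  moreover have "F' w v = frechet_derivative F (at w) v" if "w \<in> W" for w
    using has_derivative_unique[OF F'[OF that] D[OF that]] by simp
  ultimately show "smooth_on W (\<lambda>w. frechet_derivative F (at w) v)" by (rule smooth_on_cong)
qed


section \<open>Symmetry of second derivatives\<close>

lemma DERIV_along_line:
  fixes F :: "'a::real_normed_vector \<Rightarrow> real"
  assumes "(F has_derivative F') (at (x + s *\<^sub>R u))"
  shows "((\<lambda>s. F (x + s *\<^sub>R u)) has_real_derivative F' u) (at s)"
proof -
  have "((\<lambda>s. x + s *\<^sub>R u) has_derivative (\<lambda>h. h *\<^sub>R u)) (at s)"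
    by (auto intro!: derivative_eq_intros)
  then have "((\<lambda>s. F (x + s *\<^sub>R u)) has_derivative (\<lambda>h. F' (h *\<^sub>R u))) (at s)"
    by (rule has_derivative_compose) (rule assms)
  moreover have "F' (h *\<^sub>R u) = F' u * h" for h
    using linear_cmul[OF has_derivative_linear[OF assms]] by simp
  ultimately show ?thesis by (simp add: has_field_derivative_def)
qed

text \<open>The mean value theorem twice: in direction u for the difference of F at points t v
  apart, then in direction v for the derivative along u.\<close>

lemma second_difference_mvt:
  fixes F :: "complex^'k \<Rightarrow> real"
  assumes F: "smooth_on W F" and "0 < t" and sub: "cball w (t * (norm u + norm v)) \<subseteq> W"
  shows "\<exists>p\<in>cball w (t * (norm u + norm v)). F (w + t *\<^sub>R u + t *\<^sub>R v) - F (w + t *\<^sub>R u) - F (w + t *\<^sub>R v) + F w =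
     t * t * frechet_derivative (\<lambda>z. frechet_derivative F (at z) u) (at p) v"
proof -
  let ?G = "\<lambda>z. frechet_derivative F (at z) u"
  have in0: "w + a *\<^sub>R u + b *\<^sub>R v \<in> cball w (t * (norm u + norm v))"
    if "0 \<le> a" "a \<le> t" "0 \<le> b" "b \<le> t" for a b
  proof -
    have "norm (a *\<^sub>R u + b *\<^sub>R v) \<le> a * norm u + b * norm v"
      using that by (metis abs_of_nonneg norm_scaleR norm_triangle_ineq)
    also have "\<dots> \<le> t * (norm u + norm v)"
      using that by (simp add: distrib_left add_mono mult_right_mono)
    finally have "norm (a *\<^sub>R u + b *\<^sub>R v) \<le> t * (norm u + norm v)" .
    moreover have "dist w (w + (a *\<^sub>R u + b *\<^sub>R v)) = norm (a *\<^sub>R u + b *\<^sub>R v)"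
      by (metis add_diff_cancel_left' dist_commute dist_norm)
    ultimately show ?thesis by (simp add: add.assoc)
  qed
  have inW: "w + a *\<^sub>R u + b *\<^sub>R v \<in> W" if "0 \<le> a" "a \<le> t" "0 \<le> b" "b \<le> t" for a b
    using in0[OF that] sub by blast
  have "\<exists>\<xi>>0. \<xi> < t \<and> (F (w + t *\<^sub>R v + t *\<^sub>R u) - F (w + t *\<^sub>R u)) - (F (w + t *\<^sub>R v + 0 *\<^sub>R u) - F (w + 0 *\<^sub>R u))
     = (t - 0) * (?G (w + t *\<^sub>R v + \<xi> *\<^sub>R u) - ?G (w + \<xi> *\<^sub>R u))"
  proof (rule MVT2[OF \<open>0 < t\<close>])
    fix s assume s: "0 \<le> s" "s \<le> t"
    have "w + t *\<^sub>R v + s *\<^sub>R u \<in> W" "w + s *\<^sub>R u \<in> W"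
      using inW[OF s, of t] inW[OF s, of 0] \<open>0 < t\<close> by (simp_all add: add.assoc add.commute[of "t *\<^sub>R v"])
    then show "((\<lambda>s. F (w + t *\<^sub>R v + s *\<^sub>R u) - F (w + s *\<^sub>R u)) has_real_derivative
       ?G (w + t *\<^sub>R v + s *\<^sub>R u) - ?G (w + s *\<^sub>R u)) (at s)"
      by (intro DERIV_diff DERIV_along_line smooth_on_has_derivative(1)[OF F])
  qed
  then obtain \<xi> where \<xi>: "0 < \<xi>" "\<xi> < t" and 1: "(F (w + t *\<^sub>R v + t *\<^sub>R u) - F (w + t *\<^sub>R u)) - (F (w + t *\<^sub>R v) - F w)
     = t * (?G (w + t *\<^sub>R v + \<xi> *\<^sub>R u) - ?G (w + \<xi> *\<^sub>R u))" by auto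
  have "\<exists>\<eta>>0. \<eta> < t \<and> ?G (w + \<xi> *\<^sub>R u + t *\<^sub>R v) - ?G (w + \<xi> *\<^sub>R u + 0 *\<^sub>R v)
     = (t - 0) * frechet_derivative ?G (at (w + \<xi> *\<^sub>R u + \<eta> *\<^sub>R v)) v"
  proof (rule MVT2[OF \<open>0 < t\<close>])
    fix s assume s: "0 \<le> s" "s \<le> t"
    show "((\<lambda>s. ?G (w + \<xi> *\<^sub>R u + s *\<^sub>R v)) has_real_derivative
       frechet_derivative ?G (at (w + \<xi> *\<^sub>R u + s *\<^sub>R v)) v) (at s)"
      by (intro DERIV_along_line smooth_on_has_derivative(1)[OF smooth_on_has_derivative(2)[OF F]] inW)
         (use s \<xi> in auto)
  qed
  then obtain \<eta> where \<eta>: "0 < \<eta>" "\<eta> < t" and 2: "?G (w + \<xi> *\<^sub>R u + t *\<^sub>R v) - ?G (w + \<xi> *\<^sub>R u)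
     = t * frechet_derivative ?G (at (w + \<xi> *\<^sub>R u + \<eta> *\<^sub>R v)) v" by auto
  have "F (w + t *\<^sub>R u + t *\<^sub>R v) - F (w + t *\<^sub>R u) - F (w + t *\<^sub>R v) + F w =
     t * t * frechet_derivative ?G (at (w + \<xi> *\<^sub>R u + \<eta> *\<^sub>R v)) v"
    using 1 2 by (simp add: add.assoc add.commute[of "t *\<^sub>R v"])
  then show ?thesis using in0[of \<xi> \<eta>] \<xi> \<eta> by (auto intro!: bexI[of _ "w + \<xi> *\<^sub>R u + \<eta> *\<^sub>R v"])
qed

text \<open>The second difference does not change when u and v are exchanged. So
  \<open>second_difference_mvt\<close> yields equal mixed derivatives at two points which both tend
  to w with t, and continuity concludes.\<close>

lemma symmetric_second_derivative_real:
  fixes F :: "complex^'k \<Rightarrow> real"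
  assumes F: "smooth_on W F" and "w \<in> W"
  shows "frechet_derivative (\<lambda>z. frechet_derivative F (at z) u) (at w) v =
     frechet_derivative (\<lambda>z. frechet_derivative F (at z) v) (at w) u"
proof -
  define A where "A u v z = frechet_derivative (\<lambda>z. frechet_derivative F (at z) u) (at z) v" for u v z
  obtain \<delta> where "0 < \<delta>" and \<delta>: "cball w \<delta> \<subseteq> W"
    using smooth_on_open[OF F] \<open>w \<in> W\<close> open_contains_cball by blast
  define K where "K = norm u + norm v"
  have "0 \<le> K" by (simp add: K_def)
  \<comment> \<open>Chosen so that t n * K \<le> \<delta>; 1 + K instead of K covers u = v =
    0.\<close>
  define t where "t n = \<delta> / (1 + K) / real (Suc n)" for n
  have t0: "0 < t n" for n using \<open>0 < \<delta>\<close> \<open>0 \<le> K\<close> by (simp add: t_def)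
  have tK: "t n * K \<le> \<delta>" for n
  proof -
    have "K \<le> (1 + K) * real (Suc n)" using \<open>0 \<le> K\<close> by (simp add: algebra_simps)
    then have "K / ((1 + K) * real (Suc n)) \<le> 1" using \<open>0 \<le> K\<close> by (simp add: divide_le_eq_1)
    then have "\<delta> * (K / ((1 + K) * real (Suc n))) \<le> \<delta> * 1"
      using \<open>0 < \<delta>\<close> by (intro mult_left_mono) auto
    then show ?thesis by (simp add: t_def)
  qed
  have sub: "cball w (t n * K) \<subseteq> W" for n
    using tK[of n] \<delta> by (meson subset_cball order_trans)
  have "\<exists>p q. dist w p \<le> t n * K \<and> dist w q \<le> t n * K \<and> A u v p = A v u q" for n
  proof -
    from second_difference_mvt[OF F t0[of n] sub[of n, unfolded K_def]]
    obtain p where p: "dist w p \<le> t n * K" and 1: "F (w + t n *\<^sub>R u + t n *\<^sub>R v) - F (w + t n *\<^sub>R u) - F (w + t n *\<^sub>R v) + F w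
        = t n * t n * A u v p"
      unfolding A_def K_def by auto
    from second_difference_mvt[OF F t0[of n] sub[of n, unfolded K_def add.commute[of "norm u"]]]
    obtain q where q: "dist w q \<le> t n * K" and 2: "F (w + t n *\<^sub>R v + t n *\<^sub>R u) - F (w + t n *\<^sub>R v) - F (w + t n *\<^sub>R u) + F w
        = t n * t n * A v u q"
      unfolding A_def K_def add.commute[of "norm u"] by auto
    have "w + t n *\<^sub>R v + t n *\<^sub>R u = w + t n *\<^sub>R u + t n *\<^sub>R v" by simp
    from 1 2[unfolded this] have "t n * t n * A u v p = t n * t n * A v u q"
      by linarith
    then show ?thesis using p q t0[of n] by (intro exI[of _ p] exI[of _ q]) simp
  qed
  then obtain p q where p: "\<And>n. dist w (p n) \<le> t n * K" and q: "\<And>n. dist w (q n) \<le> t n * K"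
    and pq: "\<And>n. A u v (p n) = A v u (q n)" by metis
  have "(\<lambda>n. \<delta> / (1 + K) * (1 / real (Suc n))) \<longlonglongrightarrow> \<delta> / (1 + K) * 0"
    using lim_inverse_n'[THEN LIMSEQ_Suc] by (intro tendsto_mult tendsto_const) simp
  then have "(\<lambda>n. t n * K) \<longlonglongrightarrow> 0 * K" unfolding t_def by (intro tendsto_mult tendsto_const) simp
  then have tl: "(\<lambda>n. t n * K) \<longlonglongrightarrow> 0" by simp
  have lim: "r \<longlonglongrightarrow> w" if "\<And>n. dist w (r n) \<le> t n * K" for r
    unfolding tendsto_dist_iff[of r] by (rule tendsto_sandwich[OF _ _ tendsto_const tl]) (use that in \<open>auto simp: dist_commute\<close>)
  have cont: "isCont (A u v) w" for u v
    unfolding A_def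
    using smooth_on_has_derivative(1)[OF smooth_on_has_derivative(2)[OF smooth_on_has_derivative(2)[OF F]] \<open>w \<in> W\<close>]
    by (rule has_derivative_continuous)
  have "(\<lambda>n. A u v (p n)) \<longlonglongrightarrow> A u v w" "(\<lambda>n. A v u (q n)) \<longlonglongrightarrow> A v u w"
    by (rule isCont_tendsto_compose[OF cont lim], rule p q)+
  then show ?thesis unfolding pq using LIMSEQ_unique unfolding A_def by blast
qed

lemma frechet_derivative_eqI: "(f has_derivative f') (at x) \<Longrightarrow> frechet_derivative f (at x) = f'"
  by (rule frechet_derivative_at[symmetric])

text \<open>Both functions have the same set of derivatives at x, so the choice operator in
  \<open>frechet_derivative\<close> picks the same map even where none exists.\<close>

lemma frechet_derivative_cong_open:
  assumes "open S" "x \<in> S" "\<And>y. y \<in> S \<Longrightarrow> f y = g y"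
  shows "frechet_derivative f (at x) = frechet_derivative g (at x)"
proof -
  have "(f has_derivative D) (at x) \<longleftrightarrow> (g has_derivative D) (at x)" for D
    using assms has_derivative_transform_within_open[of f D x UNIV S g]
      has_derivative_transform_within_open[of g D x UNIV S f] by auto
  then show ?thesis by (simp add: frechet_derivative_def)
qed

lemma symmetric_second_derivative:
  fixes F :: "complex^'k \<Rightarrow> 'b::euclidean_space"
  assumes F: "smooth_on W F" and "w \<in> W"
  shows "frechet_derivative (\<lambda>z. frechet_derivative F (at z) u) (at w) v =
     frechet_derivative (\<lambda>z. frechet_derivative F (at z) v) (at w) u"
proof (rule euclidean_eqI)
  fix b :: 'b assume "b \<in> Basis"
  have 1: "frechet_derivative (\<lambda>z. G z \<bullet> b) (at z) u = frechet_derivative G (at z) u \<bullet> b"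
    if "smooth_on W G" "z \<in> W" for G :: "complex^'k \<Rightarrow> 'b" and z u
    using frechet_derivative_eqI[OF has_derivative_inner_left[OF smooth_on_has_derivative(1)[OF that]]] by simp
  have 2: "frechet_derivative (\<lambda>z. frechet_derivative F (at z) u) (at w) v \<bullet> b =
     frechet_derivative (\<lambda>z. frechet_derivative (\<lambda>z. F z \<bullet> b) (at z) u) (at w) v" for u v
    unfolding 1[OF smooth_on_has_derivative(2)[OF F] \<open>w \<in> W\<close>, symmetric]
    by (rule fun_cong[OF frechet_derivative_cong_open[OF smooth_on_open[OF F] \<open>w \<in> W\<close>]]) (simp add: 1[OF F])
  show "frechet_derivative (\<lambda>z. frechet_derivative F (at z) u) (at w) v \<bullet> b =
     frechet_derivative (\<lambda>z. frechet_derivative F (at z) v) (at w) u \<bullet> b"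
    unfolding 2 by (rule symmetric_second_derivative_real[OF smooth_on_inner[OF F] \<open>w \<in> W\<close>])
qed

section \<open>The induced metric and its curvature\<close>

lemma matrix_mult_diff_left: "(A - B) ** C = A ** C - B ** (C::'a::ring_1^_^_)"
  and matrix_mult_diff_right: "C ** (A - B) = C ** A - C ** (B::'a::ring_1^_^_)"
  and matrix_mult_minus_left: "(- A) ** C = - (A ** (C::'a::ring_1^_^_))"
  and matrix_mult_minus_right: "C ** (- A) = - (C ** (A::'a::ring_1^_^_))"
  and matrix_mult_zero_left: "0 ** C = (0::'a::ring_1^_^_)"
  and matrix_mult_zero_right: "C ** 0 = (0::'a::ring_1^_^_)"
  by (simp_all add: matrix_matrix_mult_def vec_eq_iff sum_subtractf sum_negf algebra_simps)

lemma matrix_add_rdistrib: "(A + B) ** C = A ** C + B ** (C::'a::semiring_1^_^_)"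
  by (simp add: matrix_matrix_mult_def vec_eq_iff sum.distrib algebra_simps)

lemma matrix_mult_scaleR_left: "(r *\<^sub>R A) ** C = r *\<^sub>R (A ** (C::'a::real_algebra_1^_^_))"
  and matrix_mult_scaleR_right: "C ** (r *\<^sub>R A) = r *\<^sub>R (C ** (A::'a::real_algebra_1^_^_))"
  by (simp_all add: matrix_matrix_mult_def vec_eq_iff scaleR_sum_right)

lemmas matrix_ring_simps = matrix_add_ldistrib matrix_add_rdistrib matrix_mult_diff_left matrix_mult_diff_right
  matrix_mult_minus_left matrix_mult_minus_right matrix_mult_zero_left matrix_mult_zero_right
  matrix_mult_scaleR_left matrix_mult_scaleR_right matrix_mul_assoc[symmetric]

lemma trace_scaleR: "trace (r *\<^sub>R A) = r * trace (A :: real^'n^'n)"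
  and trace_minus: "trace (- B) = - trace (B :: 'a::comm_ring_1^'n^'n)"
  by (simp_all add: trace_def sum_distrib_left sum_negf)

section \<open>The trace form and commutators\<close>

definition trace_form :: "real^'m^'m \<Rightarrow> real^'m^'m \<Rightarrow> real" where
  "trace_form X Y = trace (X ** Y)"

lemma trace_form_commute: "trace_form X Y = trace_form Y X"
  unfolding trace_form_def by (rule trace_mul_sym)

lemma trace_form_simps [simp]:
  "trace_form (X + X') Y = trace_form X Y + trace_form X' Y"
  "trace_form X (Y + Y') = trace_form X Y + trace_form X Y'"
  "trace_form (X - X') Y = trace_form X Y - trace_form X' Y"
  "trace_form X (Y - Y') = trace_form X Y - trace_form X Y'"
  "trace_form (- X) Y = - trace_form X Y"
  "trace_form X (- Y) = - trace_form X Y"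
  "trace_form (r *\<^sub>R X) Y = r * trace_form X Y"
  "trace_form X (r *\<^sub>R Y) = r * trace_form X Y"
  "trace_form 0 Y = 0" "trace_form X 0 = 0"
  unfolding trace_form_def by (simp_all add: matrix_ring_simps trace_add trace_sub trace_minus trace_scaleR trace_0[unfolded mat_0])

lemma bilinear_trace_form: "bilinear trace_form"
  by (auto simp: bilinear_def linear_iff)

lemma comm_simps [simp]:
  "comm (X + X') Y = comm X Y + comm X' Y"
  "comm X (Y + Y') = comm X Y + comm X Y'"
  "comm (X - X') Y = comm X Y - comm X' Y"
  "comm X (Y - Y') = comm X Y - comm X Y'"
  "comm (- X) Y = - comm X Y"
  "comm X (- Y) = - comm X Y"
  "comm (r *\<^sub>R X) Y = r *\<^sub>R comm X Y"
  "comm X (r *\<^sub>R Y) = r *\<^sub>R comm X Y"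
  "comm 0 Y = 0" "comm X 0 = 0" "comm X X = 0"
  unfolding comm_def by (simp_all add: matrix_ring_simps algebra_simps)

lemma comm_commute: "comm X Y = - comm Y X"
  by (simp add: comm_def)

lemma comm_jacobi: "comm X (comm Y Z) = comm (comm X Y) Z + comm Y (comm X Z)"
  unfolding comm_def by (simp add: matrix_ring_simps algebra_simps)

text \<open>Invariance of the trace form, from the cyclicity of the trace: \<open>comm X\<close> is
  skew-adjoint.\<close>

lemma trace_form_comm: "trace_form (comm X Y) Z = - trace_form Y (comm X Z)"
proof -
  have "trace (X ** (Y ** Z)) = trace (Y ** (Z ** X))"
    using trace_mul_sym[of X "Y ** Z"] by (simp add: matrix_mul_assoc)
  then show ?thesis unfolding trace_form_def comm_def
    by (simp add: matrix_ring_simps trace_sub)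
qed

lemma bilinear_comm: "bilinear comm"
  by (auto simp: bilinear_def linear_iff)

lemmas bounded_bilinear_comm = bilinear_comm[unfolded bilinear_conv_bounded_bilinear]
lemmas bounded_bilinear_trace_form = bilinear_trace_form[unfolded bilinear_conv_bounded_bilinear]

lemma matrix_inv_right: "invertible A \<Longrightarrow> A ** matrix_inv A = mat 1"
  and matrix_inv_left: "invertible A \<Longrightarrow> matrix_inv A ** A = mat 1"
  unfolding invertible_def matrix_inv_def by (rule someI2_ex; blast)+

lemma eq_uminus_self_imp_0:
  fixes x :: "'a::real_vector"
  assumes "x = - x"
  shows "x = 0"
proof -
  have "x + x = 0" using assms by (simp only: eq_neg_iff_add_eq_0)
  then have "2 *\<^sub>R x = 0" by (simp only: scaleR_2)
  then show ?thesis by (simp only: scaleR_eq_0_iff) simp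
qed

lemma rearrange_neg: "- d = p + q + r \<Longrightarrow> p + d = - q - (r :: 'a::ab_group_add)"
  by (drule arg_cong[where f = uminus]) simp

lemma J_simps [simp]: "J (J v) = - v" "J (u + v) = J u + J v" "J (r *\<^sub>R v) = r *\<^sub>R J v" "J (- v) = - J v"
  by (simp_all add: J_def vec_eq_iff algebra_simps)

lemma vsmult_decompose: "c *s v = Re c *\<^sub>R v + Im c *\<^sub>R J v"
  by (simp add: J_def vec_eq_iff complex_eq_iff)

lemma linear_J: "linear J"
  by (simp add: linear_iff)

lemma J_eq_0 [simp]: "J v = 0 \<longleftrightarrow> v = 0"
  by (metis J_simps(1) J_simps(3) neg_equal_0_iff_equal scaleR_zero_left)

text \<open>
  The condition \<open>odd_C\<close> says that the components of degree \<open>\<plusminus> 1\<close> of an endomorphism anticommute with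
  \<open>C\<close>; the map \<open>T\<close> serves to keep derivatives of \<open>\<gg>\<close>-valued maps inside \<open>\<gg>\<close>.
\<close>

locale period_chart =
  fixes W :: "(complex^'k) set" and Y C :: "complex^'k \<Rightarrow> real^'m^'m"
    and T :: "real^'m^'m \<Rightarrow> real^'m^'m" and \<gg> :: "(real^'m^'m) set" and \<kappa> :: real
  assumes smooth_Y: "smooth_on W Y"
    and \<kappa>_pos: "0 < \<kappa>"
    and linear_T: "linear T" and \<gg>_def: "\<gg> = {X. T X = 0}"
    and comm_\<gg>: "X \<in> \<gg> \<Longrightarrow> Z \<in> \<gg> \<Longrightarrow> comm X Z \<in> \<gg>"
    and Y_\<gg>: "w \<in> W \<Longrightarrow> Y w \<in> \<gg>"
    and C_inv: "w \<in> W \<Longrightarrow> invertible (C w)"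
    and C_Y: "w \<in> W \<Longrightarrow> C w ** Y w = Y w ** C w"
    and odd_C: "w \<in> W \<Longrightarrow> comm (Y w) (comm (Y w) X) = - X \<Longrightarrow> C w ** X = - (X ** C w)"
    and trace_even: "w \<in> W \<Longrightarrow> X \<in> \<gg> \<Longrightarrow> C w ** X = X ** C w \<Longrightarrow> trace_form X X \<le> 0"
    and trace_odd: "w \<in> W \<Longrightarrow> X \<in> \<gg> \<Longrightarrow> C w ** X = - (X ** C w) \<Longrightarrow> X \<noteq> 0 \<Longrightarrow> trace_form X X > 0"
    and dY_J: "w \<in> W \<Longrightarrow> frechet_derivative Y (at w) (J u) = - comm (Y w) (frechet_derivative Y (at w) u)"
    and immersion: "w \<in> W \<Longrightarrow> frechet_derivative Y (at w) u = 0 \<Longrightarrow> u = 0"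
begin

section \<open>Derivatives of Y and their degrees\<close>

definition d1 where "d1 w u = frechet_derivative Y (at w) u"
definition d2 where "d2 w u v = frechet_derivative (\<lambda>z. d1 z v) (at w) u"
definition g where "g w u v = \<kappa> * trace_form (d1 w u) (d1 w v)"

lemma open_W: "open W" using smooth_Y by (rule smooth_on_open)

lemma smooth_d1: "smooth_on W (\<lambda>w. d1 w u)"
  unfolding d1_def by (rule smooth_on_has_derivative(2)[OF smooth_Y])

lemma smooth_d2: "smooth_on W (\<lambda>w. d2 w u v)"
  unfolding d2_def by (rule smooth_on_has_derivative(2)[OF smooth_d1])

lemma Y_der: "w \<in> W \<Longrightarrow> (Y has_derivative d1 w) (at w)"
  using smooth_on_has_derivative(1)[OF smooth_Y] by (simp add: d1_def[abs_def])

lemma d1_der: "w \<in> W \<Longrightarrow> ((\<lambda>z. d1 z v) has_derivative (\<lambda>u. d2 w u v)) (at w)"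
  using smooth_on_has_derivative(1)[OF smooth_d1] by (simp add: d2_def)

lemma linear_d1: "w \<in> W \<Longrightarrow> linear (d1 w)"
  using Y_der has_derivative_linear by blast

lemma d2_sym: "w \<in> W \<Longrightarrow> d2 w u v = d2 w v u"
  unfolding d2_def d1_def by (rule symmetric_second_derivative[OF smooth_Y])

lemma linear_d2: "w \<in> W \<Longrightarrow> linear (\<lambda>u. d2 w u v)" "w \<in> W \<Longrightarrow> linear (d2 w u)"
proof -
  show *: "linear (\<lambda>u. d2 w u v)" if "w \<in> W" for v using d1_der[OF that] has_derivative_linear by blast
  show "linear (d2 w u)" if "w \<in> W" using *[OF that, of u] d2_sym[OF that, of u] by presburger
qed

lemma d1_simps:
  assumes "w \<in> W"
  shows "d1 w (u + v) = d1 w u + d1 w v" "d1 w (r *\<^sub>R u) = r *\<^sub>R d1 w u" "d1 w (- u) = - d1 w u"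
    "d1 w (u - v) = d1 w u - d1 w v" "d1 w 0 = 0"
  using linear_d1[OF assms] by (simp_all add: linear_add linear_cmul linear_neg linear_diff linear_0)

lemma d1_J: "w \<in> W \<Longrightarrow> d1 w (J u) = - comm (Y w) (d1 w u)"
  by (simp add: d1_def dY_J)

text \<open>Two applications of \<open>d1_J\<close>, since J (J u) = - u. In the grading: dY has
  only components of degree \<plusminus> 1.\<close>

lemma comm_comm_d1: "w \<in> W \<Longrightarrow> comm (Y w) (comm (Y w) (d1 w u)) = - d1 w u"
  using d1_J[of w "J u"] by (simp add: d1_simps d1_J)

lemma derivative_in_\<gg>:
  assumes F: "\<And>w. w \<in> W \<Longrightarrow> F w \<in> \<gg>" and "w \<in> W" and F': "(F has_derivative F') (at w)"
  shows "F' u \<in> \<gg>"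
proof -
  have "((\<lambda>z. T (F z)) has_derivative (\<lambda>u. T (F' u))) (at w)"
    using bounded_linear.has_derivative[OF _ F'] linear_T linear_conv_bounded_linear by blast
  then have "((\<lambda>z. 0) has_derivative (\<lambda>u. T (F' u))) (at w)"
    by (rule has_derivative_transform_within_open[OF _ open_W \<open>w \<in> W\<close>]) (use F \<gg>_def in auto)
  from fun_cong[OF has_derivative_unique[OF this has_derivative_const]] show ?thesis
    by (simp add: \<gg>_def)
qed

lemma d1_\<gg>: "w \<in> W \<Longrightarrow> d1 w u \<in> \<gg>"
  using derivative_in_\<gg>[OF Y_\<gg> _ Y_der] .

lemma d2_\<gg>: "w \<in> W \<Longrightarrow> d2 w u v \<in> \<gg>"
  using derivative_in_\<gg>[OF d1_\<gg> _ d1_der] .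

definition cc where "cc w u v = comm (comm (Y w) (d1 w u)) (d1 w v)"

lemma d2_J:
  assumes w: "w \<in> W"
  shows "d2 w v (J u) = - (comm (d1 w v) (d1 w u) + comm (Y w) (d2 w v u))"
proof -
  have "((\<lambda>z. - comm (Y z) (d1 z u)) has_derivative
      (\<lambda>v. - (comm (Y w) (d2 w v u) + comm (d1 w v) (d1 w u)))) (at w)"
    by (intro has_derivative_minus bounded_bilinear.FDERIV[OF bounded_bilinear_comm] Y_der d1_der w)
  then have "((\<lambda>z. d1 z (J u)) has_derivative
      (\<lambda>v. - (comm (Y w) (d2 w v u) + comm (d1 w v) (d1 w u)))) (at w)"
    by (rule has_derivative_transform_within_open[OF _ open_W w]) (simp add: d1_J)
  from has_derivative_unique[OF d1_der[OF w] this] show ?thesis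
    by (metis add.commute)
qed

text \<open>\<open>comm_comm_d1\<close> differentiated along v and regrouped by Jacobi. The right
  side is left unsymmetric on purpose: comparing it with the version for u and v exchanged gives
  \<open>cc_sym\<close>.\<close>

lemma comm_comm_d2':
  assumes w: "w \<in> W"
  shows "comm (Y w) (comm (Y w) (d2 w v u)) + d2 w v u = 2 *\<^sub>R cc w u v - cc w v u"
proof -
  note mj = comm_jacobi[of "Y w" "d1 w v" "d1 w u"]
  have "((\<lambda>z. comm (Y z) (comm (Y z) (d1 z u))) has_derivative
      (\<lambda>v. comm (Y w) (comm (Y w) (d2 w v u) + comm (d1 w v) (d1 w u)) + comm (d1 w v) (comm (Y w) (d1 w u)))) (at w)"
    by (intro bounded_bilinear.FDERIV[OF bounded_bilinear_comm] Y_der d1_der w)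
  then have "((\<lambda>z. - d1 z u) has_derivative
      (\<lambda>v. comm (Y w) (comm (Y w) (d2 w v u) + comm (d1 w v) (d1 w u)) + comm (d1 w v) (comm (Y w) (d1 w u)))) (at w)"
    by (rule has_derivative_transform_within_open[OF _ open_W w]) (simp add: comm_comm_d1)
  from fun_cong[OF has_derivative_unique[OF has_derivative_minus[OF d1_der[OF w]] this], of v]
  have "comm (Y w) (comm (Y w) (d2 w v u)) + d2 w v u =
      - comm (Y w) (comm (d1 w v) (d1 w u)) - comm (d1 w v) (comm (Y w) (d1 w u))"
    unfolding comm_simps by (rule rearrange_neg)
  then show ?thesis
    unfolding cc_def mj comm_commute[of "comm (Y w) (d1 w u)" "d1 w v"]
    by (simp add: scaleR_2)
qed

text \<open>In \<open>comm_comm_d2'\<close> the left side is symmetric in u and v, hence so is 2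
  cc(u,v) - cc(v,u). By Jacobi the result says that [dY(u), dY(v)] commutes with Y, which is the
  integrability condition of horizontality along the slice.\<close>

lemma cc_sym:
  assumes w: "w \<in> W"
  shows "cc w u v = cc w v u"
proof -
  have "2 *\<^sub>R cc w u v - cc w v u = 2 *\<^sub>R cc w v u - cc w u v"
    using comm_comm_d2'[OF w, of u v] comm_comm_d2'[OF w, of v u] d2_sym[OF w, of u v] by simp
  then have "2 * cc w u v $ i $ j - cc w v u $ i $ j = 2 * cc w v u $ i $ j - cc w u v $ i $ j" for i j
    by (metis vector_minus_component vector_scaleR_component real_scaleR_def)
  then have "cc w u v $ i $ j = cc w v u $ i $ j" for i j by (simp add: algebra_simps)
  then show ?thesis by (simp add: vec_eq_iff)
qed

lemma comm_comm_d2: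
  assumes w: "w \<in> W"
  shows "comm (Y w) (comm (Y w) (d2 w u v)) + d2 w u v = cc w u v"
  using comm_comm_d2'[OF w, of u v] cc_sym[OF w, of u v] by (simp add: scaleR_2)

text \<open>Expanded by Jacobi, [Y, cc(u,v)] is antisymmetric in u and v, whereas \<open>cc\<close>
  is symmetric; so it equals its own negative.\<close>

lemma comm_cc:
  assumes w: "w \<in> W"
  shows "comm (Y w) (cc w u v) = 0"
proof -
  have *: "comm (Y w) (cc w u v) = - comm (d1 w u) (d1 w v) + comm (comm (Y w) (d1 w u)) (comm (Y w) (d1 w v))" for u v
    unfolding cc_def comm_jacobi[of "Y w" "comm (Y w) (d1 w u)"] comm_comm_d1[OF w] by simp
  have "comm (Y w) (cc w u v) = - comm (Y w) (cc w v u)"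
    unfolding * comm_commute[of "d1 w v" "d1 w u"] comm_commute[of "comm (Y w) (d1 w v)" "comm (Y w) (d1 w u)"] by simp
  then show ?thesis unfolding cc_sym[OF w, of v u] by (rule eq_uminus_self_imp_0)
qed

text \<open>The components of \<open>d2\<close> of degree \<open>\<plusminus> 1\<close>; \<open>cc\<close> is the one of degree \<open>0\<close>.\<close>

definition LL where "LL w u v = d2 w u v - cc w u v"

lemma LL_sym: "w \<in> W \<Longrightarrow> LL w u v = LL w v u"
  unfolding LL_def using d2_sym cc_sym by metis

lemma comm_comm_LL: "w \<in> W \<Longrightarrow> comm (Y w) (comm (Y w) (LL w u v)) = - LL w u v"
  using comm_comm_d2[of w u v] by (simp add: LL_def comm_cc) (metis add_diff_cancel_right' minus_diff_eq)

lemma cc_J: "w \<in> W \<Longrightarrow> cc w (J u) v = comm (d1 w u) (d1 w v)"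
  unfolding cc_def by (simp add: d1_J comm_comm_d1)

lemma LL_J: "w \<in> W \<Longrightarrow> LL w (J u) v = - comm (Y w) (LL w u v)"
  unfolding LL_def by (simp add: comm_cc cc_J d2_sym[of w "J u"] d2_J d2_sym[of w u v] comm_commute[of "d1 w v"])

text \<open>Write X as - [Y, [Y, X]] and move one bracket with Y onto \<open>cc\<close>, which it
  kills: degree 0 is orthogonal to degrees \<plusminus> 1.\<close>

lemma trace_form_LL_d1: "w \<in> W \<Longrightarrow> trace_form (cc w u v) X = 0" if "comm (Y w) (comm (Y w) X) = - X"
  using trace_form_comm[of "Y w" "cc w u v" "comm (Y w) X"] by (simp add: that comm_cc)

end

section \<open>The metric, its Christoffel symbols and the Gauss equation\<close>

lemma linear_eq_complex_basis:
  fixes f g :: "complex^'k \<Rightarrow> 'b::real_vector"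
  assumes "linear f" "linear g"
    and "\<And>i. f (axis i 1) = g (axis i 1)" "\<And>i. f (J (axis i 1)) = g (J (axis i 1))"
  shows "f = g"
proof (rule linear_eq_stdbasis[OF assms(1,2)])
  fix b :: "complex^'k" assume "b \<in> Basis"
  then obtain i u where "b = axis i u" "u \<in> Basis" by (auto simp: Basis_vec_def)
  moreover have "axis i \<i> = J (axis i 1)" by (simp add: J_def vec_eq_iff axis_def)
  ultimately show "f b = g b" using assms(3,4) by (auto simp: Basis_complex_def)
qed

context period_chart begin

lemma g_simps:
  assumes "w \<in> W"
  shows "g w (u + u') v = g w u v + g w u' v" "g w (r *\<^sub>R u) v = r * g w u v"
    "g w v (u + u') = g w v u + g w v u'" "g w v (r *\<^sub>R u) = r * g w v u"
    "g w (- u) v = - g w u v" "g w v (- u) = - g w v u"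
    "g w (u - u') v = g w u v - g w u' v" "g w v (u - u') = g w v u - g w v u'"
  using assms by (simp_all add: g_def d1_simps algebra_simps)

lemma g_sym: "g w u v = g w v u"
  by (simp add: g_def trace_form_commute)

lemma g_J: "w \<in> W \<Longrightarrow> g w (J u) (J v) = g w u v"
  by (simp add: g_def d1_J trace_form_comm comm_comm_d1)

lemma g_J_left: "w \<in> W \<Longrightarrow> g w (J u) v = - g w u (J v)"
  using g_J[of w "J u" v] by (simp add: g_simps)

lemma d1_odd: "w \<in> W \<Longrightarrow> C w ** d1 w u = - (d1 w u ** C w)"
  by (rule odd_C[OF _ comm_comm_d1])

lemma trace_form_d1_pos: "w \<in> W \<Longrightarrow> u \<noteq> 0 \<Longrightarrow> 0 < trace_form (d1 w u) (d1 w u)"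
  using trace_odd[OF _ d1_\<gg> d1_odd] immersion by (auto simp: d1_def)

lemma g_pos: "w \<in> W \<Longrightarrow> u \<noteq> 0 \<Longrightarrow> 0 < g w u u"
  using trace_form_d1_pos \<kappa>_pos by (simp add: g_def)

lemma g_eqI:
  assumes "w \<in> W" "\<And>x. g w y x = g w y' x"
  shows "y = y'"
  using g_pos[OF assms(1), of "y - y'"] assms(2)[of "y - y'"] by (auto simp: g_simps assms(1))

lemma linear_g: "w \<in> W \<Longrightarrow> linear (g w u)" "w \<in> W \<Longrightarrow> linear (\<lambda>u. g w u v)"
  by (auto simp: linear_iff g_simps)

lemma smooth_g: "smooth_on W (\<lambda>w. g w u v)"
  unfolding g_def
  by (intro smooth_on_linear[where T = "\<lambda>x. \<kappa> * x"] smooth_on_bilinear[OF bilinear_trace_form] smooth_d1)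
     (auto simp: linear_iff algebra_simps)

text \<open>Half the Koszul expression of the induced metric, i.e. the Christoffel symbols with
  lowered index.\<close>

definition bb where "bb z u v x = \<kappa> * trace_form (d2 z u v) (d1 z x)"

lemma smooth_bb: "smooth_on W (\<lambda>w. bb w u v x)"
  unfolding bb_def
  by (intro smooth_on_linear[where T = "\<lambda>x. \<kappa> * x"] smooth_on_bilinear[OF bilinear_trace_form] smooth_d1 smooth_d2)
     (auto simp: linear_iff algebra_simps)

text \<open>
  Written through the complex Gram matrix, the Christoffel symbols are solutions of a linear system
  with smooth coefficients, hence smooth by Cramer's rule.
\<close>

definition hermitian :: "complex^'k \<Rightarrow> complex^'k^'k" where
  "hermitian z = (\<chi> i j. Complex (g z (axis j 1) (axis i 1)) (g z (axis j 1) (J (axis i 1))))"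

text \<open>By invariance of g under J, y \<mapsto> g(y,e) + i g(y,Je) is complex linear. So one
  square complex system records the real equations against all basis vectors e and Je.\<close>

lemma hermitian_mult:
  assumes z: "z \<in> W"
  shows "(hermitian z *v y) $ i = Complex (g z y (axis i 1)) (g z y (J (axis i 1)))"
proof -
  have y: "y = (\<Sum>j\<in>UNIV. Re (y $ j) *\<^sub>R axis j 1 + Im (y $ j) *\<^sub>R J (axis j 1))"
    by (subst basis_expansion[of y, symmetric]) (simp add: vsmult_decompose)
  have *: "g z y x = (\<Sum>j\<in>UNIV. Re (y $ j) * g z (axis j 1) x + Im (y $ j) * g z (J (axis j 1)) x)" for x
    by (subst y) (simp add: linear_sum[OF linear_g(2)[OF z]] g_simps[OF z])
  show ?thesis
    unfolding matrix_vector_mult_def hermitian_def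
    by (rule complex_eqI) (simp_all add: * g_J[OF z] g_J_left[OF z] g_simps(6)[OF z] algebra_simps)
qed

lemma det_hermitian:
  assumes z: "z \<in> W"
  shows "det (hermitian z) \<noteq> 0"
proof -
  have "y = 0" if "hermitian z *v y = 0" for y
  proof -
    have "g z y (axis i 1) = 0 \<and> g z y (J (axis i 1)) = 0" for i
      using arg_cong[OF that, of "\<lambda>v. v $ i"] by (simp add: hermitian_mult[OF z] complex_eq_iff)
    then have "g z y = (\<lambda>_. 0)"
      by (intro linear_eq_complex_basis linear_g z) (auto simp: linear_iff)
    then have "g z y y = 0" by simp
    then show ?thesis using g_pos[OF z, of y] by auto
  qed
  then have "\<exists>B. B ** hermitian z = mat 1" unfolding matrix_left_invertible_ker by blast
  then show ?thesis unfolding invertible_left_inverse[symmetric] invertible_det_nz .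
qed

definition \<Gamma> :: "complex^'k \<Rightarrow> complex^'k \<Rightarrow> complex^'k \<Rightarrow> complex^'k" where
  "\<Gamma> z u v = matrix_inv (hermitian z) *v (\<chi> i. Complex (bb z u v (axis i 1)) (bb z u v (J (axis i 1))))"

lemma hermitian_\<Gamma>:
  assumes z: "z \<in> W"
  shows "hermitian z *v \<Gamma> z u v = (\<chi> i. Complex (bb z u v (axis i 1)) (bb z u v (J (axis i 1))))"
proof -
  have "hermitian z ** matrix_inv (hermitian z) = mat 1"
    using det_hermitian[OF z] by (intro matrix_inv_right) (simp add: invertible_det_nz)
  then show ?thesis by (simp add: \<Gamma>_def matrix_vector_mul_assoc)
qed

lemma g_\<Gamma>:
  assumes z: "z \<in> W"
  shows "g z (\<Gamma> z u v) x = bb z u v x"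
proof -
  have "g z (\<Gamma> z u v) (axis i 1) = bb z u v (axis i 1) \<and> g z (\<Gamma> z u v) (J (axis i 1)) = bb z u v (J (axis i 1))" for i
    using arg_cong[OF hermitian_\<Gamma>[OF z], of "\<lambda>v. v $ i" u v] by (simp add: hermitian_mult[OF z])
  moreover have "linear (bb z u v)"
    using z by (auto simp: linear_iff bb_def d1_simps algebra_simps)
  ultimately have "g z (\<Gamma> z u v) = bb z u v"
    by (intro linear_eq_complex_basis linear_g z) auto
  then show ?thesis by simp
qed

lemma smooth_\<Gamma>: "smooth_on W (\<lambda>z. \<Gamma> z u v)"
proof -
  have smC: "smoothC W (\<lambda>w. Complex (f w) (f' w))" if "smooth_on W f" "smooth_on W f'" for f f'
    unfolding Complex_eq using that open_W
    by (intro smoothC.add smoothC.mult smoothC_const) (auto simp: smooth_on_real)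
  have "smoothC W (\<lambda>z. \<Gamma> z u v $ i)" for i
    by (rule smoothC_solve[OF open_W _ _ det_hermitian hermitian_\<Gamma>])
       (auto simp: hermitian_def intro!: smC smooth_g smooth_bb)
  then show ?thesis
    using smooth_on_complex open_W unfolding smooth_on_def
    by (auto simp: Basis_vec_def inner_axis)
qed

lemma g_der:
  assumes w: "w \<in> W"
  shows "frechet_derivative (\<lambda>z. g z v x) (at w) u = bb w u v x + bb w u x v"
proof -
  have "((\<lambda>z. g z v x) has_derivative (\<lambda>u. \<kappa> * (trace_form (d1 w v) (d2 w u x) + trace_form (d2 w u v) (d1 w x)))) (at w)"
    unfolding g_def
    by (intro has_derivative_mult_right bounded_bilinear.FDERIV[OF bounded_bilinear_trace_form] d1_der w)
  then show ?thesis
    by (simp add: frechet_derivative_eqI bb_def trace_form_commute[of "d1 w v"] algebra_simps)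
qed

text \<open>As \<open>d2\<close> is symmetric, the derivatives of g in the Koszul formula cancel to
  2 \<open>bb\<close>; positivity of g makes the described vector unique.\<close>

lemma christoffel_eq:
  assumes w: "w \<in> W"
  shows "christoffel g w u v = \<Gamma> w u v"
proof -
  have bb_sym: "bb w u v x = bb w v u x" for u v x by (simp add: bb_def d2_sym[OF w, of u v])
  have *: "frechet_derivative (\<lambda>z. g z v x) (at w) u + frechet_derivative (\<lambda>z. g z u x) (at w) v
      - frechet_derivative (\<lambda>z. g z u v) (at w) x = 2 * g w (\<Gamma> w u v) x" for x
    unfolding g_der[OF w] g_\<Gamma>[OF w] by (simp add: bb_sym)
  show ?thesis unfolding christoffel_def *
    by (rule the_equality) (auto intro: g_eqI[OF w])
qed

text \<open>Expanding p in the fixed basis leaves derivatives of \<open>d1 z b\<close> for constant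
  b, which linearity reassembles.\<close>

lemma d1_comp_der:
  assumes w: "w \<in> W" and p: "(p has_derivative p') (at w)"
  shows "((\<lambda>z. d1 z (p z)) has_derivative (\<lambda>u. d2 w u (p w) + d1 w (p' u))) (at w)"
proof -
  have der: "((\<lambda>z. \<Sum>b\<in>Basis. (p z \<bullet> b) *\<^sub>R d1 z b) has_derivative
      (\<lambda>u. \<Sum>b\<in>Basis. (p w \<bullet> b) *\<^sub>R d2 w u b + (p' u \<bullet> b) *\<^sub>R d1 w b)) (at w)"
    by (intro has_derivative_sum has_derivative_scaleR has_derivative_inner_left p d1_der w)
  have lin: "(\<Sum>b\<in>Basis. (y \<bullet> b) *\<^sub>R L b) = L y" if "linear L" for L :: "complex^'k \<Rightarrow> real^'m^'m" and y
  proof -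
    have "L y = L (\<Sum>b\<in>Basis. (y \<bullet> b) *\<^sub>R b)" by (simp add: euclidean_representation)
    then show ?thesis using that by (simp add: linear_sum linear_cmul)
  qed
  have "((\<lambda>z. \<Sum>b\<in>Basis. (p z \<bullet> b) *\<^sub>R d1 z b) has_derivative
      (\<lambda>u. d2 w u (p w) + d1 w (p' u))) (at w)"
    using der unfolding sum.distrib lin[OF linear_d1[OF w]] lin[OF linear_d2(2)[OF w]] .
  then show ?thesis
    by (rule has_derivative_transform_within_open[OF _ open_W w]) (simp add: lin linear_d1)
qed

text \<open>The second fundamental form of \<open>Y\<close>; \<open>NN\<close> below is its part anticommuting with \<open>C\<close>.\<close>

definition II where "II w u v = d2 w u v - d1 w (\<Gamma> w u v)"

lemma II_normal: "w \<in> W \<Longrightarrow> trace_form (II w u v) (d1 w x) = 0"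
  using g_\<Gamma>[of w u v x] \<kappa>_pos by (simp add: II_def g_def bb_def)

definition d3 where "d3 w u v x = frechet_derivative (\<lambda>z. d2 z v x) (at w) u"

lemma d3_sym: "w \<in> W \<Longrightarrow> d3 w u v x = d3 w v u x"
  unfolding d3_def d2_def by (rule symmetric_second_derivative[OF smooth_d1])

lemma d2_der: "w \<in> W \<Longrightarrow> ((\<lambda>z. d2 z v x) has_derivative (\<lambda>u. d3 w u v x)) (at w)"
  using smooth_on_has_derivative(1)[OF smooth_d2] by (simp add: d3_def)

text \<open>The equation defining \<Gamma>(v,x), paired with y, is differentiated along u.
  Tangential parts drop out by \<open>II_normal\<close>; the third derivative stays, to be cancelled
  in the Gauss equation.\<close>

lemma connection_derivative:
  assumes w: "w \<in> W"
  shows "g w (frechet_derivative (\<lambda>z. christoffel g z v x) (at w) u + christoffel g w u (christoffel g w v x)) y =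
     \<kappa> * (trace_form (d3 w u v x) (d1 w y) + trace_form (II w v x) (II w u y))"
proof -
  let ?\<Gamma>' = "frechet_derivative (\<lambda>z. \<Gamma> z v x) (at w)"
  have 1: "frechet_derivative (\<lambda>z. christoffel g z v x) (at w) = ?\<Gamma>'"
    by (rule frechet_derivative_cong_open[OF open_W w]) (simp add: christoffel_eq)
  have \<Gamma>': "((\<lambda>z. \<Gamma> z v x) has_derivative ?\<Gamma>') (at w)"
    using smooth_on_has_derivative(1)[OF smooth_\<Gamma> w] .
  have D1: "((\<lambda>z. trace_form (d1 z (\<Gamma> z v x)) (d1 z y)) has_derivative
     (\<lambda>u. trace_form (d1 w (\<Gamma> w v x)) (d2 w u y) + trace_form (d2 w u (\<Gamma> w v x) + d1 w (?\<Gamma>' u)) (d1 w y))) (at w)"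
    by (intro bounded_bilinear.FDERIV[OF bounded_bilinear_trace_form] d1_comp_der d1_der w \<Gamma>')
  have eq: "trace_form (d1 z (\<Gamma> z v x)) (d1 z y) = trace_form (d2 z v x) (d1 z y)" if "z \<in> W" for z
    using g_\<Gamma>[OF that, of v x y] \<kappa>_pos by (simp add: g_def bb_def)
  have "((\<lambda>z. trace_form (d2 z v x) (d1 z y)) has_derivative
     (\<lambda>u. trace_form (d2 w v x) (d2 w u y) + trace_form (d3 w u v x) (d1 w y))) (at w)"
    by (intro bounded_bilinear.FDERIV[OF bounded_bilinear_trace_form] d2_der d1_der w)
  then have "((\<lambda>z. trace_form (d1 z (\<Gamma> z v x)) (d1 z y)) has_derivative
     (\<lambda>u. trace_form (d2 w v x) (d2 w u y) + trace_form (d3 w u v x) (d1 w y))) (at w)"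
    by (rule has_derivative_transform_within_open[OF _ open_W w]) (rule eq[symmetric])
  from fun_cong[OF has_derivative_unique[OF D1 this], of u]
  have 2: "trace_form (d1 w (\<Gamma> w v x)) (d2 w u y) + trace_form (d2 w u (\<Gamma> w v x) + d1 w (?\<Gamma>' u)) (d1 w y)
     = trace_form (d2 w v x) (d2 w u y) + trace_form (d3 w u v x) (d1 w y)"
    .
  have 3: "trace_form (II w v x) (d2 w u y) = trace_form (II w v x) (II w u y)"
    using II_normal[OF w, of v x] by (simp add: II_def[of w u y])
  have 4: "trace_form (d2 w u (\<Gamma> w v x)) (d1 w y) = trace_form (d1 w (\<Gamma> w u (\<Gamma> w v x))) (d1 w y)"
    using II_normal[OF w, of u "\<Gamma> w v x" y] by (simp add: II_def)
  have "trace_form (d1 w (?\<Gamma>' u)) (d1 w y) + trace_form (d1 w (\<Gamma> w u (\<Gamma> w v x))) (d1 w y)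
     = trace_form (d3 w u v x) (d1 w y) + trace_form (II w v x) (d2 w u y)"
    using 2 4 by (simp add: II_def)
  then show ?thesis unfolding 1 christoffel_eq[OF w]
    by (simp add: g_def d1_simps[OF w] 3 distrib_left)
qed

text \<open>Antisymmetrizing \<open>connection_derivative\<close> in u and v removes the third
  derivatives, which are symmetric in their first two arguments.\<close>

theorem gauss_equation:
  assumes w: "w \<in> W"
  shows "g w (curvature g w u v x) y =
    \<kappa> * (trace_form (II w v x) (II w u y) - trace_form (II w u x) (II w v y))"
proof -
  have "curvature g w u v x = (frechet_derivative (\<lambda>z. christoffel g z v x) (at w) u + christoffel g w u (christoffel g w v x))
     - (frechet_derivative (\<lambda>z. christoffel g z u x) (at w) v + christoffel g w v (christoffel g w u x))"
    by (simp add: curvature_def)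
  then show ?thesis
    by (simp only: g_simps(7)[OF w] connection_derivative[OF w] d3_sym[OF w, of u v]) (simp add: algebra_simps)
qed

end

text \<open>For a projection P onto S the trace of f on S is the trace of f after P on the whole
  space: expand P e in B and f b in the standard basis, and exchange the sums. In particular the
  choice of B does not matter.\<close>

lemma trace_basis:
  fixes f P :: "'a::euclidean_space \<Rightarrow> 'a"
  assumes B: "independent B" "span B = S" and f: "linear f" "\<And>x. x \<in> S \<Longrightarrow> f x \<in> S"
    and P: "linear P" "\<And>x. P x \<in> S" "\<And>x. x \<in> S \<Longrightarrow> P x = x"
  shows "(\<Sum>b\<in>B. representation B (f b) b) = (\<Sum>e\<in>Basis. f (P e) \<bullet> e)"
proof -
  have fin: "finite B" using B independent_imp_finite by blast
  have "f (P e) = (\<Sum>b\<in>B. representation B (P e) b *\<^sub>R f b)" for e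
  proof -
    have "P e = (\<Sum>b\<in>B. representation B (P e) b *\<^sub>R b)"
      using sum_representation_eq[OF B(1) _ fin order_refl, of "P e"] P B(2) by simp
    then have "f (P e) = f (\<Sum>b\<in>B. representation B (P e) b *\<^sub>R b)" by simp
    then show ?thesis by (simp add: linear_sum[OF f(1)] linear_cmul[OF f(1)])
  qed
  then have "(\<Sum>e\<in>Basis. f (P e) \<bullet> e) = (\<Sum>e\<in>Basis. \<Sum>b\<in>B. representation B (P e) b * (f b \<bullet> e))"
    by (simp add: inner_sum_left)
  also have "\<dots> = (\<Sum>b\<in>B. \<Sum>e\<in>Basis. (f b \<bullet> e) * representation B (P e) b)"
    by (subst sum.swap) (simp add: mult.commute)
  also have "\<dots> = (\<Sum>b\<in>B. representation B (\<Sum>e\<in>Basis. (f b \<bullet> e) *\<^sub>R P e) b)"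
  proof (rule sum.cong)
    fix b assume "b \<in> B"
    have "representation B (\<Sum>e\<in>Basis. (f b \<bullet> e) *\<^sub>R P e) = (\<lambda>b'. \<Sum>e\<in>Basis. representation B ((f b \<bullet> e) *\<^sub>R P e) b')"
      by (rule representation_sum[OF B(1)]) (use P B(2) in \<open>auto intro: span_scale\<close>)
    moreover have "representation B ((f b \<bullet> e) *\<^sub>R P e) b' = (f b \<bullet> e) * representation B (P e) b'" for e b'
      using representation_scale[OF B(1), of "P e"] P B(2) by simp
    ultimately show "(\<Sum>e\<in>Basis. (f b \<bullet> e) * representation B (P e) b) = representation B (\<Sum>e\<in>Basis. (f b \<bullet> e) *\<^sub>R P e) b"
      by simp
  qed simp
  also have "\<dots> = (\<Sum>b\<in>B. representation B (f b) b)"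
  proof (rule sum.cong)
    fix b assume "b \<in> B"
    then have "f b \<in> S" using f(2) B(2) span_base by blast
    have "(\<Sum>e\<in>Basis. (f b \<bullet> e) *\<^sub>R P e) = P (\<Sum>e\<in>Basis. (f b \<bullet> e) *\<^sub>R e)"
      by (simp add: linear_sum[OF P(1)] linear_cmul[OF P(1)])
    then show "representation B (\<Sum>e\<in>Basis. (f b \<bullet> e) *\<^sub>R P e) b = representation B (f b) b"
      using P(3)[OF \<open>f b \<in> S\<close>] by (simp add: euclidean_representation)
  qed simp
  finally show ?thesis by simp
qed

lemma trace_on_eq:
  fixes f P :: "'a::euclidean_space \<Rightarrow> 'a"
  assumes S: "subspace S" and f: "linear f" "\<And>x. x \<in> S \<Longrightarrow> f x \<in> S"
    and P: "linear P" "\<And>x. P x \<in> S" "\<And>x. x \<in> S \<Longrightarrow> P x = x"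
  shows "trace_on S f = (\<Sum>e\<in>Basis. f (P e) \<bullet> e)"
proof -
  define B where "B = (SOME B. independent B \<and> span B = S)"
  have "\<exists>B. independent B \<and> span B = S"
    using maximal_independent_subset[of S] S by (metis span_minimal subset_antisym)
  then have "independent B \<and> span B = S" unfolding B_def by (rule someI_ex)
  then show ?thesis using trace_basis[OF _ _ f P, of B] unfolding trace_on_def B_def[symmetric] by (simp add: Let_def)
qed

section \<open>Orthonormal bases of an inner product\<close>

locale inner_form =
  fixes b :: "'a::euclidean_space \<Rightarrow> 'a \<Rightarrow> real"
  assumes bilinear: "bilinear b" and sym: "b x y = b y x" and pos: "x \<noteq> 0 \<Longrightarrow> 0 < b x x"
begin

lemma simps:
  "b (x + x') y = b x y + b x' y" "b (x - x') y = b x y - b x' y" "b (r *\<^sub>R x) y = r * b x y" "b 0 y = 0"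
  "b y (x + x') = b y x + b y x'" "b y (x - x') = b y x - b y x'" "b y (r *\<^sub>R x) = r * b y x" "b y 0 = 0"
  using bilinear
  by (simp_all add: bilinear_ladd bilinear_radd bilinear_lsub bilinear_rsub bilinear_lmul bilinear_rmul bilinear_lzero bilinear_rzero)

lemma sum_left: "b (\<Sum>i\<in>I. f i) y = (\<Sum>i\<in>I. b (f i) y)"
  by (induction I rule: infinite_finite_induct) (simp_all add: simps)

definition orthonormal where
  "orthonormal B \<longleftrightarrow> finite B \<and> (\<forall>x\<in>B. \<forall>y\<in>B. b x y = (if x = y then 1 else 0))"

lemma orthonormal_coeff:
  assumes "orthonormal B" "y \<in> B"
  shows "b (\<Sum>x\<in>B. c x *\<^sub>R x) y = c y"
proof -
  have "b (\<Sum>x\<in>B. c x *\<^sub>R x) y = (\<Sum>x\<in>B. c x * (if x = y then 1 else 0))"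
    using assms unfolding orthonormal_def by (simp add: sum_left simps)
  also have "\<dots> = c y" using assms by (simp add: orthonormal_def if_distrib cong: if_cong)
  finally show ?thesis .
qed

lemma orthonormal_independent: "orthonormal B \<Longrightarrow> independent B"
proof
  assume B: "orthonormal B" and "dependent B"
  then obtain c v where "v \<in> B" "c v \<noteq> 0" "(\<Sum>v\<in>B. c v *\<^sub>R v) = 0"
    using dependent_finite[of B] by (auto simp: orthonormal_def)
  then show False using orthonormal_coeff[OF B, of v c] by (simp add: simps)
qed

text \<open>An orthonormal set containing u of maximal size spans, since otherwise a Gram-Schmidt
  step would enlarge it. Prescribing u lets later estimates keep a chosen term of a sum over the
  basis.\<close>

lemma orthonormal_basis:
  assumes "b u u = 1"
  obtains B where "orthonormal B" "u \<in> B" "span B = UNIV"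
proof -
  let ?P = "\<lambda>B. orthonormal B \<and> u \<in> B"
  have "?P {u}" using assms by (simp add: orthonormal_def)
  moreover have "\<forall>B. ?P B \<longrightarrow> card B < DIM('a) + 1"
    using orthonormal_independent independent_bound by fastforce
  ultimately obtain B where B: "orthonormal B" "u \<in> B" and max: "\<And>B'. ?P B' \<Longrightarrow> card B' \<le> card B"
    using ex_has_greatest_nat[of ?P "{u}" card] by blast
  have fin: "finite B" using B by (simp add: orthonormal_def)
  have "span B = UNIV"
  proof (rule ccontr)
    assume "span B \<noteq> UNIV"
    then obtain v where v: "v \<notin> span B" by blast
    define v' where "v' = v - (\<Sum>e\<in>B. b v e *\<^sub>R e)"
    have "(\<Sum>e\<in>B. b v e *\<^sub>R e) \<in> span B" by (intro span_sum span_scale span_base)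
    then have v': "v' \<notin> span B" using v unfolding v'_def by (metis span_add diff_add_cancel)
    then have "v' \<noteq> 0" by (auto simp: span_zero)
    then have p: "0 < b v' v'" by (rule pos)
    have orth: "b v' e = 0" if "e \<in> B" for e
      using orthonormal_coeff[OF B(1) that, of "b v"] by (simp add: v'_def simps)
    define e' where "e' = (1 / sqrt (b v' v')) *\<^sub>R v'"
    have "v' = sqrt (b v' v') *\<^sub>R e'" using p by (simp add: e'_def)
    then have "e' \<notin> B" using v' span_scale[of e' B "sqrt (b v' v')"] span_base[of e' B] by metis
    have "b e' e' = 1" using p by (simp add: e'_def simps)
    moreover have "b e' e = 0" "b e e' = 0" if "e \<in> B" for e
      using orth[OF that] sym[of e e'] by (simp_all add: e'_def simps)
    ultimately have "?P (insert e' B)" using B \<open>e' \<notin> B\<close> by (auto simp: orthonormal_def)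
    then have "card (insert e' B) \<le> card B" by (rule max)
    then show False using \<open>e' \<notin> B\<close> fin by simp
  qed
  then show ?thesis using that B by blast
qed

text \<open>The coordinates of x in B are \<open>b x e\<close>, so the left side is the trace
  computed in B; \<open>trace_basis\<close> with the identity as projection compares it with the
  standard basis.\<close>

lemma trace_orthonormal:
  assumes B: "orthonormal B" "span B = UNIV" and "linear f"
  shows "(\<Sum>e\<in>B. b (f e) e) = (\<Sum>e\<in>Basis. f e \<bullet> e)"
proof -
  have ind: "independent B" using orthonormal_independent B by blast
  have fin: "finite B" using B by (simp add: orthonormal_def)
  have rep: "representation B x e = b x e" if "e \<in> B" for x e
  proof -
    have "x = (\<Sum>e\<in>B. representation B x e *\<^sub>R e)"
      using sum_representation_eq[OF ind _ fin order_refl, of x] B(2) by simp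
    then have "b x e = b (\<Sum>e\<in>B. representation B x e *\<^sub>R e) e" by simp
    then show ?thesis using orthonormal_coeff[OF B(1) that] by simp
  qed
  have "(\<Sum>e\<in>B. b (f e) e) = (\<Sum>e\<in>B. representation B (f e) e)"
    by (rule sum.cong) (simp_all add: rep)
  also have "\<dots> = (\<Sum>e\<in>Basis. f (id e) \<bullet> e)"
    by (rule trace_basis[OF ind B(2) \<open>linear f\<close> _ linear_id]) auto
  finally show ?thesis by simp
qed

end

section \<open>Signs of the curvature terms\<close>

context period_chart begin

text \<open>Conjugation by C preserves the trace but negates X ** Z.\<close>

lemma even_odd_trace:
  assumes w: "w \<in> W" and X: "C w ** X = X ** C w" and Z: "C w ** Z = - (Z ** C w)"
  shows "trace_form X Z = 0"
proof -
  have "C w ** (X ** Z) = (X ** C w) ** Z" unfolding matrix_mul_assoc X ..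
  also have "\<dots> = X ** (- (Z ** C w))" unfolding matrix_mul_assoc[symmetric] Z ..
  finally have "C w ** (X ** Z) = - ((X ** Z) ** C w)" by (simp add: matrix_ring_simps)
  then have "trace ((C w ** (X ** Z)) ** matrix_inv (C w)) = - trace ((X ** Z) ** (C w ** matrix_inv (C w)))"
    by (simp add: matrix_ring_simps trace_minus)
  moreover have "trace ((C w ** (X ** Z)) ** matrix_inv (C w)) = trace (X ** Z)"
    using trace_mul_sym[of "C w ** (X ** Z)" "matrix_inv (C w)"]
    by (simp add: matrix_mul_assoc matrix_inv_left C_inv w)
  ultimately show ?thesis by (simp add: trace_form_def matrix_inv_right C_inv w)
qed

lemma even_odd_odd:
  assumes X: "C w ** X = - (X ** C w)" and Z: "C w ** Z = - (Z ** C w)"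
  shows "C w ** comm X Z = comm X Z ** C w"
proof -
  have *: "C w ** (X ** Z) = (X ** Z) ** C w"
    if X: "C w ** X = - (X ** C w)" and Z: "C w ** Z = - (Z ** C w)" for X Z
  proof -
    have "C w ** (X ** Z) = - (X ** (C w ** Z))"
      unfolding matrix_mul_assoc X by (simp add: matrix_ring_simps)
    then show ?thesis unfolding Z by (simp add: matrix_ring_simps)
  qed
  show ?thesis unfolding comm_def using *[OF X Z] *[OF Z X] by (simp add: matrix_mult_diff_left matrix_mult_diff_right)
qed

lemma comm_d1_odd: "w \<in> W \<Longrightarrow> C w ** comm (Y w) (d1 w u) = - (comm (Y w) (d1 w u) ** C w)"
  by (rule odd_C) (simp_all add: comm_comm_d1)

lemma cc_even: "w \<in> W \<Longrightarrow> C w ** cc w u v = cc w u v ** C w"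
  unfolding cc_def by (intro even_odd_odd comm_d1_odd d1_odd)

lemma cc_\<gg>: "w \<in> W \<Longrightarrow> cc w u v \<in> \<gg>"
  unfolding cc_def by (intro comm_\<gg> Y_\<gg> d1_\<gg>)

lemma comm_d1_even: "w \<in> W \<Longrightarrow> C w ** comm (d1 w u) (d1 w v) = comm (d1 w u) (d1 w v) ** C w"
  by (intro even_odd_odd d1_odd)

definition NN where "NN w u v = LL w u v - d1 w (\<Gamma> w u v)"

lemma II_eq: "II w u v = cc w u v + NN w u v"
  by (simp add: II_def NN_def LL_def)

lemma comm_comm_NN: "w \<in> W \<Longrightarrow> comm (Y w) (comm (Y w) (NN w u v)) = - NN w u v"
  by (simp add: NN_def comm_comm_LL comm_comm_d1)

lemma NN_odd: "w \<in> W \<Longrightarrow> C w ** NN w u v = - (NN w u v ** C w)"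
  by (rule odd_C[OF _ comm_comm_NN])

lemma comm_NN_odd: "w \<in> W \<Longrightarrow> C w ** comm (Y w) (NN w u v) = - (comm (Y w) (NN w u v) ** C w)"
  by (rule odd_C) (simp_all add: comm_comm_NN)

lemma NN_\<gg>: "w \<in> W \<Longrightarrow> NN w u v \<in> \<gg>"
  using linear_T d2_\<gg>[of w u v] cc_\<gg>[of w u v] d1_\<gg>[of w]
  by (simp add: NN_def LL_def \<gg>_def linear_diff)

lemma \<Gamma>_sym: "w \<in> W \<Longrightarrow> \<Gamma> w u v = \<Gamma> w v u"
  by (rule g_eqI[of w]) (simp_all add: g_\<Gamma> bb_def d2_sym[of w u v])

lemma NN_sym: "w \<in> W \<Longrightarrow> NN w u v = NN w v u"
  unfolding NN_def using LL_sym \<Gamma>_sym by metis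

lemma bb_LL: "w \<in> W \<Longrightarrow> bb w u v x = \<kappa> * trace_form (LL w u v) (d1 w x)"
  by (simp add: bb_def LL_def trace_form_LL_d1 comm_comm_d1)

text \<open>Only \<open>LL\<close> contributes to \<open>bb\<close>, and J acts on \<open>LL\<close>
  and on \<open>d1\<close> by the same operator \<open>- comm Y\<close>. So J is parallel, as for
  any Kaehler metric.\<close>

lemma \<Gamma>_J: "w \<in> W \<Longrightarrow> \<Gamma> w (J u) v = J (\<Gamma> w u v)"
  by (rule g_eqI[of w]) (simp_all add: g_\<Gamma> g_J_left bb_LL LL_J d1_J trace_form_comm)

lemma NN_J: "w \<in> W \<Longrightarrow> NN w (J u) v = - comm (Y w) (NN w u v)"
  by (simp add: NN_def LL_J \<Gamma>_J d1_J)

lemma II_J: "w \<in> W \<Longrightarrow> II w (J u) v = comm (d1 w u) (d1 w v) - comm (Y w) (NN w u v)"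
  by (simp add: II_eq cc_J NN_J)

text \<open>Each J becomes \<open>- comm Y\<close> on \<open>d1\<close>, which merely exchanges the
  roles of u and v. So \<open>cc\<close> has type (1,1) while \<open>NN\<close> is complex bilinear
  and changes sign; hence their squares enter the curvature with opposite signs.\<close>

lemma cc_JJ:
  assumes w: "w \<in> W"
  shows "cc w (J u) (J v) = cc w u v"
proof -
  have "cc w (J u) (J v) = - comm (d1 w u) (comm (Y w) (d1 w v))"
    by (simp add: cc_J[OF w] d1_J[OF w])
  also have "\<dots> = cc w v u" by (simp add: cc_def comm_commute[of "d1 w u"])
  finally show ?thesis using cc_sym[OF w] by metis
qed

lemma NN_JJ: "w \<in> W \<Longrightarrow> NN w (J u) (J v) = - NN w u v"
  by (simp add: NN_J NN_sym[of w u "J v"] comm_comm_NN NN_sym[of w v u])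

lemma trace_comm_NN: "w \<in> W \<Longrightarrow> trace_form (comm (Y w) (NN w u v)) (comm (Y w) (NN w u v)) = trace_form (NN w u v) (NN w u v)"
  by (simp add: trace_form_comm comm_comm_NN)

definition bisect where
  "bisect w u v = \<kappa> * (trace_form (cc w u v) (cc w u v)
     + trace_form (comm (d1 w u) (d1 w v)) (comm (d1 w u) (d1 w v)) - 2 * trace_form (NN w u v) (NN w u v))"

lemma trace_cc_NN:
  assumes "w \<in> W"
  shows "trace_form (cc w u v) (NN w x y) = 0" "trace_form (NN w x y) (cc w u v) = 0"
  using even_odd_trace[OF assms cc_even[OF assms] NN_odd[OF assms]] trace_form_commute by metis+

lemma trace_comm_comm_NN:
  assumes "w \<in> W"
  shows "trace_form (comm (d1 w u) (d1 w v)) (comm (Y w) (NN w x y)) = 0"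
     "trace_form (comm (Y w) (NN w x y)) (comm (d1 w u) (d1 w v)) = 0"
  using even_odd_trace[OF assms comm_d1_even[OF assms] comm_NN_odd[OF assms]] trace_form_commute by metis+

text \<open>The Gauss equation with J inserted. Mixed terms vanish as traces of even times odd
  matrices; one of the two terms - tr NN^2 arises as - tr [Y, NN]^2.\<close>

lemma bisectional:
  assumes w: "w \<in> W"
  shows "g w (curvature g w u (J u) (J v)) v = bisect w u v"
proof -
  have 1: "II w (J u) (J v) = cc w u v - NN w u v"
    by (simp add: II_eq cc_JJ[OF w] NN_JJ[OF w])
  have 2: "II w u (J v) = - comm (d1 w u) (d1 w v) - comm (Y w) (NN w u v)"
    using II_J[OF w, of v u] cc_sym[OF w] NN_sym[OF w] comm_commute[of "d1 w v" "d1 w u"]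
    by (simp add: II_eq)
  show ?thesis
    unfolding gauss_equation[OF w] 1 2 II_J[OF w, of u v] bisect_def II_eq[of w u v]
    by (simp add: trace_cc_NN[OF w] trace_comm_comm_NN[OF w] trace_comm_NN[OF w])
qed

lemma bisect_nonpos: "w \<in> W \<Longrightarrow> bisect w u v \<le> \<kappa> * trace_form (cc w u v) (cc w u v)"
  and bisect_nonpos': "w \<in> W \<Longrightarrow> bisect w u v \<le> 0"
proof -
  assume w: "w \<in> W"
  have "trace_form (cc w u v) (cc w u v) \<le> 0" by (rule trace_even[OF w cc_\<gg>[OF w] cc_even[OF w]])
  moreover have 1: "trace_form (comm (d1 w u) (d1 w v)) (comm (d1 w u) (d1 w v)) \<le> 0"
    by (rule trace_even[OF w _ comm_d1_even[OF w]]) (intro comm_\<gg> d1_\<gg> w)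
  moreover have 2: "0 \<le> trace_form (NN w u v) (NN w u v)"
    using trace_odd[OF w NN_\<gg>[OF w] NN_odd[OF w], of u v] by (cases "NN w u v = 0") auto
  ultimately show "bisect w u v \<le> 0"
    unfolding bisect_def using \<kappa>_pos by (intro mult_nonneg_nonpos) auto
  show "bisect w u v \<le> \<kappa> * trace_form (cc w u v) (cc w u v)"
    unfolding bisect_def using \<kappa>_pos 1 2 by (intro mult_left_mono) auto
qed

text \<open>Cauchy-Schwarz in the form: the trace form is nonpositive on cc(u,u) + s Y, which
  commutes with C; then choose s.\<close>

lemma trace_cc_le:
  assumes w: "w \<in> W" and M: "- trace_form (Y w) (Y w) \<le> M" "0 < M"
  shows "trace_form (cc w u u) (cc w u u) \<le> - (trace_form (d1 w u) (d1 w u))\<^sup>2 / M"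
proof -
  define t where "t = trace_form (d1 w u) (d1 w u)"
  \<comment> \<open>The minimizer of the bound 2 s t + s^2 M.\<close>
  define s where "s = - t / M"
  have "trace_form (cc w u u) (Y w) = - trace_form (d1 w u) (comm (comm (Y w) (d1 w u)) (Y w))"
    unfolding cc_def by (rule trace_form_comm)
  also have "\<dots> = - t"
    unfolding comm_commute[of "comm (Y w) (d1 w u)" "Y w"] comm_comm_d1[OF w] t_def by simp
  finally have c: "trace_form (cc w u u) (Y w) = - t" "trace_form (Y w) (cc w u u) = - t"
    using trace_form_commute by metis+
  let ?X = "cc w u u + s *\<^sub>R Y w"
  have "trace_form ?X ?X \<le> 0"
  proof (rule trace_even[OF w])
    show "?X \<in> \<gg>" using cc_\<gg>[OF w, of u u] Y_\<gg>[OF w] linear_T by (simp add: \<gg>_def linear_add linear_cmul)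
    show "C w ** ?X = ?X ** C w" by (simp add: matrix_ring_simps cc_even[OF w] C_Y[OF w])
  qed
  then have "trace_form (cc w u u) (cc w u u) \<le> 2 * s * t - s\<^sup>2 * trace_form (Y w) (Y w)"
    by (simp add: c power2_eq_square algebra_simps)
  also have "\<dots> \<le> 2 * s * t + s\<^sup>2 * M"
    using mult_left_mono[OF M(1), of "s\<^sup>2"] by simp
  also have "\<dots> = - t\<^sup>2 / M" using M(2) by (simp add: s_def power2_eq_square field_simps)
  finally show ?thesis by (simp add: t_def)
qed

lemma bisect_diag:
  assumes w: "w \<in> W" and M: "- trace_form (Y w) (Y w) \<le> M" "0 < M" and "u \<noteq> 0"
  shows "bisect w u u / (g w u u)\<^sup>2 \<le> - 1 / (\<kappa> * M)"
proof -
  let ?t = "trace_form (d1 w u) (d1 w u)"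
  have t: "0 < ?t" using trace_form_d1_pos[OF w \<open>u \<noteq> 0\<close>] .
  have "bisect w u u \<le> \<kappa> * (- ?t\<^sup>2 / M)"
    using bisect_nonpos[OF w, of u u] mult_left_mono[OF trace_cc_le[OF w M, of u], of \<kappa>] \<kappa>_pos by simp
  then have "bisect w u u / (g w u u)\<^sup>2 \<le> \<kappa> * (- ?t\<^sup>2 / M) / (g w u u)\<^sup>2"
    by (intro divide_right_mono) auto
  also have "\<dots> = - 1 / (\<kappa> * M)"
    using t \<kappa>_pos M(2) by (simp add: g_def power2_eq_square field_simps)
  finally show ?thesis .
qed

lemma bisectional_curvature_nonpos:
  assumes w: "w \<in> W"
  shows "bisectional_curvature g w u v \<le> 0"
proof (cases "u = 0 \<or> v = 0")
  case True
  then show ?thesis by (auto simp: bisectional_curvature_def g_def d1_simps[OF w])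
next
  case False
  then show ?thesis
    unfolding bisectional_curvature_def bisectional[OF w]
    using bisect_nonpos'[OF w, of u v] g_pos[OF w, of u] g_pos[OF w, of v]
    by (intro divide_nonpos_pos) auto
qed

lemma holomorphic_sectional_curvature_bound:
  assumes "w \<in> W" and "- trace_form (Y w) (Y w) \<le> M" "0 < M" and "u \<noteq> 0"
  shows "holomorphic_sectional_curvature g w u \<le> - 1 / (\<kappa> * M)"
  unfolding holomorphic_sectional_curvature_def bisectional[OF assms(1)] by (rule bisect_diag[OF assms])

text \<open>
  The first Bianchi identity for the plane spanned by \<open>e\<close> and \<open>J e\<close>, checked directly from the Gauss
  equation.
\<close>

lemma sectional_sum:
  assumes w: "w \<in> W"
  shows "g w (curvature g w e u u) e + g w (curvature g w (J e) u u) (J e) = bisect w u e"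
proof -
  let ?p = "d1 w u" and ?q = "d1 w e"
  let ?P = "comm (Y w) ?p" and ?Q = "comm (Y w) ?q"
  have "comm (Y w) (cc w u e) = comm ?P ?Q - comm ?p ?q"
    unfolding cc_def comm_jacobi[of "Y w" "?P"] comm_comm_d1[OF w] by simp
  \<comment> \<open>\<open>cc\<close> has degree 0, which here says that applying J to both vectors
    does not change their commutator.\<close>
  then have PQ: "comm ?P ?Q = comm ?p ?q" using comm_cc[OF w] by simp
  \<comment> \<open>The product of cc(u,u) and cc(e,e) occurs in the Gauss equation but not in
    \<open>bisect\<close>; invariance of the trace form and Jacobi convert it into mixed
    terms.\<close>
  have "trace_form (cc w u u) (cc w e e) = - trace_form ?p (comm ?P (comm ?Q ?q))"
    by (simp add: cc_def trace_form_comm)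
  also have "\<dots> = - trace_form ?p (comm (comm ?p ?q) ?q) - trace_form ?p (comm ?Q (cc w u e))"
    unfolding comm_jacobi[of ?P ?Q] PQ cc_def by simp
  also have "trace_form ?p (comm (comm ?p ?q) ?q) = - trace_form (comm ?p ?q) (comm ?p ?q)"
    unfolding comm_commute[of "comm ?p ?q" ?q] using trace_form_comm[of ?q ?p "comm ?p ?q"]
    by (simp add: comm_commute[of ?q ?p])
  also have "trace_form ?p (comm ?Q (cc w u e)) = - trace_form (cc w u e) (cc w u e)"
    using trace_form_comm[of ?Q ?p "cc w u e"] cc_sym[OF w, of u e] by (simp add: cc_def)
  finally have cc: "trace_form (cc w u u) (cc w e e) =
      trace_form (comm ?p ?q) (comm ?p ?q) + trace_form (cc w u e) (cc w u e)" by simp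
  have EE: "trace_form (comm ?q ?p) (comm ?q ?p) = trace_form (comm ?p ?q) (comm ?p ?q)"
    by (simp add: comm_commute[of ?q ?p])
  have 1: "II w (J e) (J e) = cc w e e - NN w e e"
    by (simp add: II_eq cc_JJ[OF w] NN_JJ[OF w])
  have 2: "II w u (J e) = II w (J e) u" using cc_sym[OF w] NN_sym[OF w] by (simp add: II_eq)
  have 3: "II w u e = II w e u" using cc_sym[OF w] NN_sym[OF w] by (simp add: II_eq)
  show ?thesis
    unfolding gauss_equation[OF w] 1 2 3 II_J[OF w, of e u] bisect_def II_eq[of w u u] II_eq[of w e u] II_eq[of w e e]
      cc_sym[OF w, of e u] NN_sym[OF w, of e u]
    by (simp add: trace_cc_NN[OF w] trace_comm_comm_NN[OF w] trace_comm_NN[OF w] EE cc algebra_simps)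
qed

text \<open>After pairing with a vector, the Gauss equation leaves only \<open>II\<close>, which is
  linear. Trace computations for the Ricci tensor rest on this.\<close>

lemma linear_curvature:
  assumes w: "w \<in> W"
  shows "linear (\<lambda>x. curvature g w x u u)"
proof -
  have D: "d2 w (x + y) v = d2 w x v + d2 w y v" "d2 w (r *\<^sub>R x) v = r *\<^sub>R d2 w x v" for x y v r
    using linear_add[OF linear_d2(1)[OF w]] linear_cmul[OF linear_d2(1)[OF w]] by auto
  have G: "\<Gamma> w (x + y) v = \<Gamma> w x v + \<Gamma> w y v" "\<Gamma> w (r *\<^sub>R x) v = r *\<^sub>R \<Gamma> w x v" for x y v r
    by (rule g_eqI[OF w]; simp add: g_simps[OF w] g_\<Gamma>[OF w] bb_def D algebra_simps)+
  have I: "II w (x + y) v = II w x v + II w y v" "II w (r *\<^sub>R x) v = r *\<^sub>R II w x v" for x y v r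
    by (simp_all add: II_def G D d1_simps[OF w] scaleR_diff_right)
  show ?thesis
    by (rule linearI; rule g_eqI[OF w]) (simp_all add: g_simps[OF w] gauss_equation[OF w] I algebra_simps)
qed

lemma inner_form_g: "w \<in> W \<Longrightarrow> inner_form (g w)"
  by unfold_locales (auto simp: bilinear_def linear_g g_sym intro: g_pos)

text \<open>Averaging the trace over an orthonormal basis B and over its image under J produces the
  pairs of \<open>sectional_sum\<close>. All summands are nonpositive, and B contains the normalized
  u, whose summand is controlled by \<open>bisect_diag\<close>; the average costs the factor
  2.\<close>

lemma ricci_curvature_bound:
  assumes w: "w \<in> W" and M: "- trace_form (Y w) (Y w) \<le> M" "0 < M" and "u \<noteq> 0"
  shows "ricci_curvature g w u \<le> - 1 / (2 * \<kappa> * M)"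
proof -
  interpret inner_form "g w" by (rule inner_form_g[OF w])
  define L where "L x = curvature g w x u u" for x
  have L: "linear L" unfolding L_def by (rule linear_curvature[OF w])
  have gu: "0 < g w u u" using g_pos[OF w \<open>u \<noteq> 0\<close>] .
  define e0 where "e0 = (1 / sqrt (g w u u)) *\<^sub>R u"
  have "g w e0 e0 = 1" using gu by (simp add: e0_def g_simps[OF w])
  then obtain B where B: "orthonormal B" "e0 \<in> B" "span B = UNIV" by (rule orthonormal_basis)
  have fin: "finite B" using B by (simp add: orthonormal_def)
  have injJ: "inj J" using linear_injective_0[OF linear_J] by simp
  have "orthonormal (J ` B)"
    using B(1) by (auto simp: orthonormal_def g_J[OF w] dest: injD[OF injJ])
  moreover have "span (J ` B) = UNIV"
  proof -
    have "range J = UNIV" by (metis J_simps(1) J_simps(4) minus_minus surj_def)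
    then show ?thesis using linear_span_image[OF linear_J, of B] B(3) by simp
  qed
  ultimately have 1: "(\<Sum>e\<in>J ` B. g w (L e) e) = (\<Sum>e\<in>Basis. L e \<bullet> e)"
    using trace_orthonormal L by blast
  have "(\<Sum>e\<in>J ` B. g w (L e) e) = (\<Sum>e\<in>B. g w (L (J e)) (J e))"
    by (subst sum.reindex[OF inj_on_subset[OF injJ subset_UNIV]]) (simp add: o_def)
  moreover have "(\<Sum>e\<in>B. g w (L e) e) = (\<Sum>e\<in>Basis. L e \<bullet> e)"
    using trace_orthonormal[OF B(1,3) L] .
  moreover have "ricci_tensor g w u u = (\<Sum>e\<in>Basis. L e \<bullet> e)"
    unfolding ricci_tensor_def L_def[symmetric]
    using trace_on_eq[OF subspace_UNIV L _ linear_id] by simp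
  ultimately have "2 * ricci_tensor g w u u = (\<Sum>e\<in>B. g w (L e) e + g w (L (J e)) (J e))"
    using 1 by (simp add: sum.distrib)
  also have "\<dots> = (\<Sum>e\<in>B. bisect w u e)"
    unfolding L_def sectional_sum[OF w] ..
  also have "\<dots> = bisect w u e0 + (\<Sum>e\<in>B - {e0}. bisect w u e)"
    using B(2) fin by (simp add: sum.remove)
  also have "\<dots> \<le> bisect w u e0"
    using sum_nonpos[of "B - {e0}" "bisect w u"] bisect_nonpos'[OF w] by simp
  \<comment> \<open>Homogeneity of \<open>bisect\<close> in its second vector is read off from the
    curvature, which is linear, through \<open>sectional_sum\<close>.\<close>
  also have "bisect w u e0 = bisect w u u / g w u u"
  proof -
    have "g w (curvature g w u (J u) (J e0)) e0 = g w (curvature g w e0 u u) e0 + g w (curvature g w (J e0) u u) (J e0)"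
      unfolding sectional_sum[OF w] bisectional[OF w] ..
    also have "\<dots> = (1 / sqrt (g w u u)) * (1 / sqrt (g w u u)) * bisect w u u"
      unfolding sectional_sum[OF w, of u u, symmetric] L_def[symmetric] e0_def
      by (simp add: linear_cmul[OF L] g_simps[OF w] algebra_simps)
    also have "\<dots> = bisect w u u / g w u u" using gu by simp
    finally show ?thesis unfolding bisectional[OF w] .
  qed
  finally have "2 * ricci_tensor g w u u / g w u u \<le> bisect w u u / g w u u / g w u u"
    using gu by (intro divide_right_mono) auto
  also have "\<dots> = bisect w u u / (g w u u)\<^sup>2" by (simp add: power2_eq_square)
  also have "\<dots> \<le> - 1 / (\<kappa> * M)" using bisect_diag[OF w M \<open>u \<noteq> 0\<close>] .
  finally show ?thesis using \<kappa>_pos M(2) by (simp add: ricci_curvature_def field_simps)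
qed

lemma kaehler_metric_g: "kaehler_metric W g"
  unfolding kaehler_metric_def riemannian_metric_def
proof (intro conjI ballI allI impI)
  fix w u v x assume w: "w \<in> W"
  show "bilinear (g w)" by (simp add: bilinear_def linear_g w)
  show "g w u v = g w v u" by (rule g_sym)
  show "0 < g w u u" if "u \<noteq> 0" using g_pos w that by blast
  show "g w (J u) (J v) = g w u v" using g_J w by blast
  \<comment> \<open>The trace of an even times an odd matrix: this removes the terms in which Y
    itself was differentiated.\<close>
  have triple: "trace_form (comm (d1 w u) (d1 w v)) (d1 w x) = 0" for u v x
    by (rule even_odd_trace[OF w comm_d1_even[OF w] d1_odd[OF w]])
  have triple': "trace_form (d1 w v) (comm (d1 w u) (d1 w x)) = 0" for u v x
    using triple[of u v x] by (simp add: trace_form_comm)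
  \<comment> \<open>In this form the cyclic sum cancels in pairs by the symmetry of
    \<open>d2\<close>.\<close>
  have *: "dirD (\<lambda>z. kaehler_form g z v x) w u
      = \<kappa> * (trace_form (d2 w u v) (comm (Y w) (d1 w x)) - trace_form (d2 w u x) (comm (Y w) (d1 w v)))" for u v x
    unfolding kaehler_form_def g_der[OF w] bb_def
    by (simp add: d2_J[OF w] d1_J[OF w] triple triple' trace_form_comm right_diff_distrib)
  show "dirD (\<lambda>z. kaehler_form g z v x) w u + dirD (\<lambda>z. kaehler_form g z x u) w v
        + dirD (\<lambda>z. kaehler_form g z u v) w x = 0"
    unfolding * by (simp add: d2_sym[OF w, of v u] d2_sym[OF w, of x u] d2_sym[OF w, of x v] algebra_simps)
next
  show "Ck_on k W (\<lambda>w. g w u v)" for u v k by (rule smooth_on_Ck_on[OF smooth_g])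
qed

end

section \<open>Hodge structures as matrices\<close>

lemma qform_simps:
  fixes x :: "'a::comm_ring_1^'m"
  shows "qform Q (x + x') y = qform Q x y + qform Q x' y"
    "qform Q x (y + y') = qform Q x y + qform Q x y'"
    "qform Q (x - x') y = qform Q x y - qform Q x' y"
    "qform Q x (y - y') = qform Q x y - qform Q x y'"
    "qform Q (c *s x) y = c * qform Q x y" "qform Q x (c *s y) = c * qform Q x y"
    "qform Q (- x) y = - qform Q x y" "qform Q x (- y) = - qform Q x y"
    "qform Q 0 y = 0" "qform Q x 0 = 0"
  by (simp_all add: qform_def algebra_simps sum.distrib sum_subtractf sum_distrib_left sum_negf)

lemma qform_sum:
  fixes f :: "'i \<Rightarrow> 'a::comm_ring_1^'m"
  shows "qform Q (\<Sum>i\<in>I. f i) y = (\<Sum>i\<in>I. qform Q (f i) y)" "qform Q y (\<Sum>i\<in>I. f i) = (\<Sum>i\<in>I. qform Q y (f i))"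
  by (induction I rule: infinite_finite_induct) (simp_all add: qform_simps)

lemma qform_axis: "qform Q (axis i 1) (axis j (1::'a::comm_ring_1)) = of_int (Q $ i $ j)"
proof -
  have "of_int (Q $ i' $ j') * axis i 1 $ i' * axis j (1::'a) $ j' =
      (if i' = i then (if j' = j then of_int (Q $ i' $ j') else 0) else 0)" for i' j'
    by (simp add: axis_def)
  moreover have "(\<Sum>j'\<in>UNIV. if i' = i then f j' else 0) = (if i' = i then \<Sum>j'\<in>UNIV. f j' else 0)"
    for i' and f :: "'b \<Rightarrow> 'a" by simp
  ultimately show ?thesis by (simp add: qform_def)
qed

lemma polarization_form_sym:
  assumes "polarization_form n Q"
  shows "Q $ i $ j = (-1) ^ n * Q $ j $ i"
proof -
  have *: "if even n then \<forall>x y::int^'a. qform Q x y = qform Q y x else \<forall>x y::int^'a. qform Q x y = - qform Q y x"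
    using assms unfolding polarization_form_def by (rule conjunct2)
  have "qform Q (axis i (1::int)) (axis j 1) = (-1) ^ n * qform Q (axis j 1) (axis i 1)"
  proof (cases "even n")
    case True
    with *[unfolded if_P[OF True], rule_format, of "axis i 1" "axis j 1"] show ?thesis by simp
  next
    case False
    with *[unfolded if_not_P[OF False], rule_format, of "axis i 1" "axis j 1"] show ?thesis by simp
  qed
  then show ?thesis by (simp add: qform_axis)
qed

lemma qform_sym:
  fixes x y :: "'a::comm_ring_1^'m"
  assumes "polarization_form n Q"
  shows "qform Q x y = (-1) ^ n * qform Q y x"
proof -
  have "of_int (Q $ i $ j) = (-1) ^ n * (of_int (Q $ j $ i) :: 'a)" for i j
    using arg_cong[OF polarization_form_sym[OF assms, of i j], of "of_int :: int \<Rightarrow> 'a"] by simp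
  then have "qform Q x y = (\<Sum>i\<in>UNIV. \<Sum>j\<in>UNIV. (-1) ^ n * of_int (Q $ j $ i) * x $ i * y $ j)"
    unfolding qform_def by (intro sum.cong refl) metis
  also have "\<dots> = (\<Sum>j\<in>UNIV. \<Sum>i\<in>UNIV. (-1) ^ n * of_int (Q $ j $ i) * x $ i * y $ j)" by (rule sum.swap)
  also have "\<dots> = (-1) ^ n * qform Q y x"
    unfolding qform_def by (simp add: sum_distrib_left algebra_simps)
  finally show ?thesis .
qed

lemma matrix_vector_mult_minus_left: "(- A) *v x = - (A *v (x :: 'a::ring_1^'n))"
  by (simp add: matrix_vector_mult_def vec_eq_iff sum_negf)

lemma vcnj_simps [simp]: "vcnj (x + y) = vcnj x + vcnj y" "vcnj (c *s x) = cnj c *s vcnj x" "vcnj (vcnj x) = x"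
  "vcnj (- x) = - vcnj x" "vcnj (x - y) = vcnj x - vcnj y" "vcnj 0 = 0" "vcnj x = 0 \<longleftrightarrow> x = 0"
  by (simp_all add: vcnj_def vec_eq_iff)

lemma vcnj_sum: "vcnj (\<Sum>i\<in>I. f i) = (\<Sum>i\<in>I. vcnj (f i))"
  by (induction I rule: infinite_finite_induct) simp_all

lemma cnj_qform: "cnj (qform Q x y) = qform Q (vcnj x) (vcnj y)"
  by (simp add: qform_def vcnj_def)

definition mcnj :: "complex^'n^'m \<Rightarrow> complex^'n^'m" where
  "mcnj A = (\<chi> i j. cnj (A $ i $ j))"

lemma vcnj_mult: "vcnj (A *v x) = mcnj A *v vcnj x"
  by (simp add: vcnj_def mcnj_def matrix_vector_mult_def vec_eq_iff)

definition cmat :: "real^'n^'m \<Rightarrow> complex^'n^'m" where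
  "cmat a = (\<chi> i j. complex_of_real (a $ i $ j))"

definition rmat :: "complex^'n^'m \<Rightarrow> real^'n^'m" where
  "rmat a = (\<chi> i j. Re (a $ i $ j))"

lemma cmul_eq: "cmul a v = cmat a *v v"
  by (simp add: cmul_def cmat_def matrix_vector_mult_def)

lemma cmat_simps [simp]: "cmat (a + b) = cmat a + cmat b" "cmat (a - b) = cmat a - cmat b" "cmat (- a) = - cmat a"
  "cmat (r *\<^sub>R a) = r *\<^sub>R cmat a" "cmat 0 = 0" "cmat a = cmat b \<longleftrightarrow> a = b" "cmat a = 0 \<longleftrightarrow> a = 0"
  by (simp_all add: cmat_def vec_eq_iff) (simp_all add: scaleR_conv_of_real)

lemma cmat_mat [simp]: "cmat (mat 1) = mat 1"
  by (simp add: cmat_def mat_def vec_eq_iff)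

lemma cmat_mult: "cmat (a ** b) = cmat a ** cmat b"
  by (simp add: cmat_def matrix_matrix_mult_def vec_eq_iff)

lemma cmat_comm: "cmat (comm a b) = cmat a ** cmat b - cmat b ** cmat a"
  by (simp add: comm_def cmat_mult)

lemma mcnj_cmat [simp]: "mcnj (cmat a) = cmat a"
  by (simp add: mcnj_def cmat_def)

lemma cmat_rmat: "mcnj A = A \<Longrightarrow> cmat (rmat A) = A"
  unfolding cmat_def rmat_def mcnj_def vec_eq_iff by (auto simp: complex_eq_iff)

definition cvec :: "real^'m \<Rightarrow> complex^'m" where
  "cvec x = (\<chi> i. complex_of_real (x $ i))"

lemma qform_cvec: "qform Q (cvec x) (cvec y) = complex_of_real (qform Q x y)"
  by (simp add: qform_def cvec_def)

lemma cmat_cvec: "cmat a *v cvec x = cvec (a *v x)"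
  by (simp add: cmat_def cvec_def matrix_vector_mult_def)

lemma cvec_eq_0 [simp]: "cvec x = 0 \<longleftrightarrow> x = 0" and vcnj_cvec [simp]: "vcnj (cvec x) = cvec x"
  by (simp_all add: cvec_def vcnj_def vec_eq_iff)

lemma cvec_decompose: "\<exists>x y. v = cvec x + \<i> *s cvec y"
proof -
  have "v = cvec (\<chi> i. Re (v $ i)) + \<i> *s cvec (\<chi> i. Im (v $ i))"
    by (simp add: cvec_def vec_eq_iff complex_eq_iff)
  then show ?thesis by blast
qed

text \<open>The shift by n/2 makes the weights at r and n - r both opposite and conjugate, so that Y
  is an infinitesimal isometry of Q and a real operator.\<close>

definition hodge_weight :: "nat \<Rightarrow> nat \<Rightarrow> complex" where
  "hodge_weight n r = \<i> * (of_nat r - of_nat n / 2)"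

definition weil_weight :: "nat \<Rightarrow> nat \<Rightarrow> complex" where
  "weil_weight n r = \<i> powi (int r - int (n - r))"

lemma weil_weight_simps:
  assumes "r \<le> n"
  shows "weil_weight n r * weil_weight n (n - r) = 1" "cnj (weil_weight n (n - r)) = weil_weight n r"
    "weil_weight n r * weil_weight n r = (-1) ^ n" "r < n \<Longrightarrow> weil_weight n (Suc r) = - weil_weight n r"
    "weil_weight n r \<noteq> 0"
proof -
  show "weil_weight n r \<noteq> 0" by (simp add: weil_weight_def)
  have m: "\<i> powi a * \<i> powi b = \<i> powi (a + b)" for a b
    by (simp add: power_int_add)
  show 1: "weil_weight n r * weil_weight n (n - r) = 1"
    unfolding weil_weight_def m using assms by (simp add: of_nat_diff)
  have "cnj (\<i> powi a) = \<i> powi (- a)" for a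
    by (simp add: power_int_minus flip: power_int_inverse)
  then show "cnj (weil_weight n (n - r)) = weil_weight n r"
    unfolding weil_weight_def using assms by (simp add: of_nat_diff)
  have sq: "\<i> powi (2 * a) = (-1) powi a" for a
    by (simp add: power_int_mult)
  have "(int r - int (n - r)) + (int r - int (n - r)) = 2 * (2 * int r - int n)"
    using assms by (simp add: of_nat_diff)
  then have "weil_weight n r * weil_weight n r = (-1) powi (2 * int r - int n)"
    unfolding weil_weight_def m sq[symmetric] by simp
  also have "\<dots> = (-1) ^ n"
    by (cases "even n") (simp_all add: power_int_diff power_int_mult)
  finally show "weil_weight n r * weil_weight n r = (-1) ^ n" .
  assume "r < n"
  then have "int (Suc r) - int (n - Suc r) = (int r - int (n - r)) + 2" by simp
  then have "weil_weight n (Suc r) = weil_weight n r * \<i> powi 2"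
    unfolding weil_weight_def m by (simp only:)
  then show "weil_weight n (Suc r) = - weil_weight n r" by simp
qed

section \<open>Operators that are diagonal on a Hodge decomposition\<close>

locale hodge_structure =
  fixes n :: nat and Q :: "int^'m^'m" and h :: "nat \<Rightarrow> nat" and H :: "'m decomp"
  assumes pol: "polarization_form n Q" and H: "H \<in> classifying_space n Q h"
begin

lemmas H_conditions = H[unfolded classifying_space_def mem_Collect_eq, folded weil_weight_def]

lemma H_subspace: "vec.subspace (H r)"
  using conjunct1[OF H_conditions] by blast

lemma H_0: "r > n \<Longrightarrow> H r = {0}"
  using conjunct1[OF conjunct2[OF H_conditions]] by blast

lemma H_dec: "\<exists>!x. (\<forall>r. x r \<in> H r) \<and> v = (\<Sum>r\<le>n. x r)"
  by (rule conjunct1[OF conjunct2[OF conjunct2[OF H_conditions]], rule_format])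

lemma H_cnj: "r \<le> n \<Longrightarrow> H r = vcnj ` H (n - r)"
  by (rule conjunct1[OF conjunct2[OF conjunct2[OF conjunct2[OF H_conditions]]], rule_format])

lemma H_dim: "r \<le> n \<Longrightarrow> vec.dim (H r) = h r"
  by (rule conjunct1[OF conjunct2[OF conjunct2[OF conjunct2[OF conjunct2[OF H_conditions]]]], rule_format])

lemma H_orth: "r \<le> n \<Longrightarrow> r' \<le> n \<Longrightarrow> r' \<noteq> n - r \<Longrightarrow> x \<in> H r \<Longrightarrow> y \<in> H r' \<Longrightarrow> qform Q x y = 0"
  by (rule conjunct1[OF conjunct2[OF conjunct2[OF conjunct2[OF conjunct2[OF conjunct2[OF H_conditions]]]]], rule_format])

lemma H_pos: "r \<le> n \<Longrightarrow> x \<in> H r \<Longrightarrow> x \<noteq> 0 \<Longrightarrow>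
     \<exists>t>0. weil_weight n r * qform Q x (vcnj x) = complex_of_real t"
  by (rule conjunct2[OF conjunct2[OF conjunct2[OF conjunct2[OF conjunct2[OF conjunct2[OF H_conditions]]]]], rule_format])

lemmas H_simps = vec.subspace_0[OF H_subspace] vec.subspace_add[OF H_subspace] vec.subspace_diff[OF H_subspace]
  vec.subspace_scale[OF H_subspace] vec.subspace_neg[OF H_subspace]

lemma vcnj_H: "r \<le> n \<Longrightarrow> x \<in> H r \<Longrightarrow> vcnj x \<in> H (n - r)"
  using H_cnj[of "n - r"] by auto

definition comp :: "complex^'m \<Rightarrow> nat \<Rightarrow> complex^'m" where
  "comp v = (THE x. (\<forall>r. x r \<in> H r) \<and> v = (\<Sum>r\<le>n. x r))"

lemma comp_H: "comp v r \<in> H r" and comp_sum: "(\<Sum>r\<le>n. comp v r) = v"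
  using theI'[OF H_dec[of v]] unfolding comp_def by auto

lemma comp_eqI: "(\<And>r. x r \<in> H r) \<Longrightarrow> v = (\<Sum>r\<le>n. x r) \<Longrightarrow> comp v = x"
  unfolding comp_def using H_dec[of v] by (intro the1_equality) auto

lemma comp_simps: "comp (u + v) r = comp u r + comp v r" "comp (c *s v) r = c *s comp v r"
proof -
  have "comp (u + v) = (\<lambda>r. comp u r + comp v r)"
    by (rule comp_eqI) (simp_all add: comp_H comp_sum H_simps sum.distrib)
  then show "comp (u + v) r = comp u r + comp v r" by simp
  have "comp (c *s v) = (\<lambda>r. c *s comp v r)"
    by (rule comp_eqI) (simp_all add: comp_H comp_sum H_simps flip: vec.scale_sum_right)
  then show "comp (c *s v) r = c *s comp v r" by simp
qed

lemma comp_self: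
  assumes x: "x \<in> H a"
  shows "comp x r = (if r = a then x else 0)"
proof (cases "a \<le> n")
  case True
  have "comp x = (\<lambda>r. if r = a then x else 0)"
    by (rule comp_eqI) (use x True in \<open>auto simp: H_simps\<close>)
  then show ?thesis by simp
next
  case False
  then have "x = 0" using H_0[of a] x by simp
  then show ?thesis using comp_simps(2)[of 0 0 r] by simp
qed

text \<open>Scalar multiplication by \<mu> r on each \<open>H r\<close>. Y, C and the projectors
  onto \<open>H_plus\<close> and onto the filtration all have this form, so identities between them
  reduce to their eigenvalues.\<close>

definition cop :: "(nat \<Rightarrow> complex) \<Rightarrow> complex^'m^'m" where
  "cop \<mu> = matrix (\<lambda>v. \<Sum>r\<le>n. \<mu> r *s comp v r)"

lemma cop_mult: "cop \<mu> *v v = (\<Sum>r\<le>n. \<mu> r *s comp v r)"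
  unfolding cop_def
  by (rule matrix_works, unfold_locales)
     (simp_all add: comp_simps vec.scale_right_distrib sum.distrib vec.scale_sum_right mult.commute)

lemma comp_cop: "r \<le> n \<Longrightarrow> comp (cop \<mu> *v v) r = \<mu> r *s comp v r"
proof -
  assume r: "r \<le> n"
  have "comp (cop \<mu> *v v) = (\<lambda>r. if r \<le> n then \<mu> r *s comp v r else 0)"
    unfolding cop_mult by (rule comp_eqI) (auto simp: H_simps comp_H intro!: sum.cong)
  then show ?thesis using r by simp
qed

lemma cop_H: "a \<le> n \<Longrightarrow> x \<in> H a \<Longrightarrow> cop \<mu> *v x = \<mu> a *s x"
  unfolding cop_mult by (simp add: comp_self if_distrib sum.delta cong: if_cong)

lemma matrix_eqI:
  fixes A B :: "complex^'m^'m"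
  assumes "\<And>a x. a \<le> n \<Longrightarrow> x \<in> H a \<Longrightarrow> A *v x = B *v x"
  shows "A = B"
proof -
  have "A *v v = B *v v" for v
  proof -
    have "A *v (\<Sum>r\<le>n. comp v r) = B *v (\<Sum>r\<le>n. comp v r)"
      unfolding vec.linear_sum[OF matrix_vector_mul_linear_gen] by (intro sum.cong refl assms) (auto simp: comp_H)
    then show ?thesis by (simp add: comp_sum)
  qed
  then show ?thesis by (simp add: matrix_eq)
qed

lemma cop_cong: "(\<And>r. r \<le> n \<Longrightarrow> \<mu> r = \<nu> r) \<Longrightarrow> cop \<mu> = cop \<nu>"
  by (rule matrix_eqI) (simp add: cop_H)

lemma cop_cop: "cop \<mu> ** cop \<nu> = cop (\<lambda>r. \<mu> r * \<nu> r)"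
  by (rule matrix_eqI) (simp add: cop_H H_simps vector_scalar_commute flip: matrix_vector_mul_assoc)

lemma cop_const: "cop (\<lambda>r. 1) = mat 1"
  by (rule matrix_eqI) (simp add: cop_H)

lemma cop_diff: "cop \<mu> - cop \<nu> = cop (\<lambda>r. \<mu> r - \<nu> r)"
  by (rule matrix_eqI) (simp add: cop_H matrix_vector_mult_diff_rdistrib vec.scale_left_diff_distrib)

text \<open>Conjugation exchanges \<open>H r\<close> and \<open>H (n - r)\<close>. This gives the
  reality of Y and C, so that taking real parts in \<open>Yop\<close> and \<open>Cop\<close> loses
  nothing.\<close>

lemma mcnj_cop: "mcnj (cop \<mu>) = cop (\<lambda>r. cnj (\<mu> (n - r)))"
proof (rule matrix_eqI)
  fix a x assume a: "a \<le> n" and x: "x \<in> H a"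
  have "mcnj (cop \<mu>) *v x = vcnj (cop \<mu> *v vcnj x)" by (simp add: vcnj_mult)
  then show "mcnj (cop \<mu>) *v x = cop (\<lambda>r. cnj (\<mu> (n - r))) *v x"
    using cop_H[OF _ vcnj_H[OF a x], of \<mu>] by (simp add: cop_H[OF a x])
qed

definition Yop :: "real^'m^'m" where "Yop = rmat (cop (hodge_weight n))"
definition Cop :: "real^'m^'m" where "Cop = rmat (cop (weil_weight n))"

lemma cmat_Yop: "cmat Yop = cop (hodge_weight n)"
  unfolding Yop_def
  by (rule cmat_rmat, unfold mcnj_cop, rule cop_cong) (simp add: hodge_weight_def of_nat_diff algebra_simps)

lemma cmat_Cop: "cmat Cop = cop (weil_weight n)"
  unfolding Cop_def
  by (rule cmat_rmat, unfold mcnj_cop, rule cop_cong) (simp add: weil_weight_simps)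

lemma Cop_Yop: "Cop ** Yop = Yop ** Cop"
proof -
  have "cmat (Cop ** Yop) = cmat (Yop ** Cop)"
    unfolding cmat_mult cmat_Yop cmat_Cop cop_cop by (simp add: mult.commute)
  then show ?thesis by simp
qed

lemma Cop_Cop: "Cop ** Cop = (-1) ^ n *\<^sub>R mat 1"
proof -
  have "cop (\<lambda>r. weil_weight n r * weil_weight n r) = cop (\<lambda>r. (-1) ^ n)"
    by (rule cop_cong) (simp add: weil_weight_simps)
  also have "\<dots> = cmat ((-1) ^ n *\<^sub>R mat 1)"
    by (cases "even n") (simp_all add: cop_const cop_diff[of "\<lambda>_. 0" "\<lambda>_. 1", simplified, symmetric] cop_diff[of "\<lambda>_. 1" "\<lambda>_. 1", simplified, symmetric])
  finally have "cmat (Cop ** Cop) = cmat ((-1) ^ n *\<^sub>R mat 1)"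
    unfolding cmat_mult cmat_Cop cop_cop .
  then show ?thesis by (rule cmat_simps(6)[THEN iffD1])
qed

lemma Cop_invertible: "invertible Cop"
  unfolding invertible_def
  by (rule exI[of _ "(-1) ^ n *\<^sub>R Cop"]) (simp add: matrix_ring_simps Cop_Cop flip: power_mult_distrib)

lemma qform_comp: "qform Q x y = (\<Sum>r\<le>n. qform Q (comp x r) (comp y (n - r)))"
proof -
  have "qform Q x y = (\<Sum>r\<le>n. \<Sum>s\<le>n. qform Q (comp x r) (comp y s))"
    unfolding qform_sum[symmetric] comp_sum ..
  also have "\<dots> = (\<Sum>r\<le>n. \<Sum>s\<le>n. if s = n - r then qform Q (comp x r) (comp y s) else 0)"
    by (intro sum.cong refl) (auto intro: H_orth comp_H)
  also have "\<dots> = (\<Sum>r\<le>n. qform Q (comp x r) (comp y (n - r)))"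
    by (intro sum.cong refl) (simp add: sum.delta)
  finally show ?thesis .
qed

lemma qform_Cop: "qform Q (cmat Cop *v x) (cmat Cop *v y) = qform Q x y"
  unfolding cmat_Cop qform_comp[of x] qform_comp[of "cop (weil_weight n) *v x"]
proof (rule sum.cong)
  fix r assume "r \<in> {..n}"
  then have r: "r \<le> n" by simp
  then have "qform Q (weil_weight n r *s comp x r) (weil_weight n (n - r) *s comp y (n - r))
      = (weil_weight n r * weil_weight n (n - r)) * qform Q (comp x r) (comp y (n - r))"
    by (simp only: qform_simps mult.assoc mult.left_commute)
  then show "qform Q (comp (cop (weil_weight n) *v x) r) (comp (cop (weil_weight n) *v y) (n - r)) = qform Q (comp x r) (comp y (n - r))"
    using r by (simp add: comp_cop weil_weight_simps)
qed simp

lemma qform_Cop_real: "qform Q (Cop *v x) (Cop *v y) = qform Q x y"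
  using qform_Cop[of "cvec x" "cvec y"] by (simp add: cmat_cvec qform_cvec)

lemma qform_Yop: "qform Q (cmat Yop *v x) y + qform Q x (cmat Yop *v y) = 0"
proof -
  have "qform Q (comp (cmat Yop *v x) r) (comp y (n - r)) + qform Q (comp x r) (comp (cmat Yop *v y) (n - r)) = 0"
    if "r \<le> n" for r
    using that by (simp add: cmat_Yop comp_cop qform_simps hodge_weight_def of_nat_diff algebra_simps flip: distrib_right)
  then show ?thesis
    unfolding qform_comp[of x] qform_comp[of "cmat Yop *v x"] sum.distrib[symmetric] by simp
qed

lemma qform_Yop_real: "qform Q (Yop *v x) y + qform Q x (Yop *v y) = 0"
proof -
  have "complex_of_real (qform Q (Yop *v x) y + qform Q x (Yop *v y)) = 0"
    using qform_Yop[of "cvec x" "cvec y"] by (simp add: cmat_cvec qform_cvec)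
  then show ?thesis by (simp only: of_real_eq_0_iff)
qed

lemma comp_vcnj: "r \<le> n \<Longrightarrow> comp (vcnj x) r = vcnj (comp x (n - r))"
proof -
  assume r: "r \<le> n"
  have "comp (vcnj x) = (\<lambda>r. if r \<le> n then vcnj (comp x (n - r)) else 0)"
  proof (rule comp_eqI)
    show "(if r \<le> n then vcnj (comp x (n - r)) else 0) \<in> H r" for r
      using vcnj_H[of "n - r" "comp x (n - r)"] by (auto simp: H_simps comp_H)
    have "vcnj x = (\<Sum>r\<le>n. vcnj (comp x r))" unfolding vcnj_sum[symmetric] comp_sum ..
    also have "\<dots> = (\<Sum>r\<le>n. vcnj (comp x (n - r)))"
      by (rule sum.reindex_bij_witness[of _ "\<lambda>r. n - r" "\<lambda>r. n - r"]) auto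
    finally show "vcnj x = (\<Sum>r\<le>n. if r \<le> n then vcnj (comp x (n - r)) else 0)" by simp
  qed
  then show ?thesis using r by simp
qed

text \<open>The Hodge inner product on real vectors.\<close>

definition bform :: "real^'m \<Rightarrow> real^'m \<Rightarrow> real" where "bform x y = qform Q (Cop *v x) y"

text \<open>The components of a real vector in degrees r and n - r are conjugate, so
  \<open>bform x x\<close> is the sum of the polarization expressions of the components, none
  negative and at least one positive.\<close>

lemma bform_pos:
  assumes "x \<noteq> 0"
  shows "0 < bform x x"
proof -
  let ?x = "cvec x"
  have "complex_of_real (bform x x) = qform Q (cmat Cop *v ?x) (vcnj ?x)"
    by (simp add: bform_def cmat_cvec qform_cvec)
  also have "\<dots> = (\<Sum>r\<le>n. weil_weight n r * qform Q (comp ?x r) (vcnj (comp ?x r)))"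
    unfolding qform_comp[of "cmat Cop *v ?x"]
  proof (rule sum.cong)
    fix r assume "r \<in> {..n}"
    then have r: "r \<le> n" by simp
    show "qform Q (comp (cmat Cop *v ?x) r) (comp (vcnj ?x) (n - r)) = weil_weight n r * qform Q (comp ?x r) (vcnj (comp ?x r))"
      using r comp_vcnj[of "n - r" ?x] by (simp add: cmat_Cop comp_cop qform_simps)
  qed simp
  finally have sum: "bform x x = (\<Sum>r\<le>n. Re (weil_weight n r * qform Q (comp ?x r) (vcnj (comp ?x r))))"
    by (metis Re_complex_of_real Re_sum)
  have pos: "0 < Re (weil_weight n r * qform Q (comp ?x r) (vcnj (comp ?x r)))"
    if "r \<le> n" "comp ?x r \<noteq> 0" for r
    using H_pos[OF that(1) comp_H that(2)] by (metis Re_complex_of_real)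
  have nn: "0 \<le> Re (weil_weight n r * qform Q (comp ?x r) (vcnj (comp ?x r)))" if "r \<le> n" for r
    using pos[OF that] by (cases "comp ?x r = 0") (simp_all add: qform_simps)
  have "\<exists>r\<le>n. comp ?x r \<noteq> 0"
  proof (rule ccontr)
    assume "\<not> ?thesis"
    then have "?x = 0" using comp_sum[of ?x] by simp
    then show False using assms by simp
  qed
  then obtain r where "r \<le> n" "comp ?x r \<noteq> 0" by blast
  then show ?thesis unfolding sum using nn pos by (intro sum_pos2[of _ r]) auto
qed

lemma inner_form_bform: "inner_form bform"
proof
  have s: "qform Q (r *\<^sub>R x) y = r * qform Q x y" "qform Q x (r *\<^sub>R y) = r * qform Q x y" for r and x y :: "real^'m"
    by (simp_all add: qform_def sum_distrib_left algebra_simps)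
  show "bilinear bform"
    by (simp add: bilinear_def linear_iff bform_def qform_simps s matrix_vector_right_distrib matrix_vector_mult_scaleR)
  show "bform x y = bform y x" for x y
  proof -
    have "bform x y = qform Q (Cop *v (Cop *v x)) (Cop *v y)" by (simp add: bform_def qform_Cop_real)
    also have "\<dots> = (-1) ^ n * qform Q x (Cop *v y)"
      unfolding matrix_vector_mul_assoc Cop_Cop
      by (metis s(1) matrix_vector_mul_lid scaleR_matrix_vector_assoc)
    also have "\<dots> = qform Q (Cop *v y) x"
      by (subst qform_sym[OF pol]) (simp add: mult.assoc[symmetric] flip: power_mult_distrib)
    finally show ?thesis by (simp add: bform_def)
  qed
qed (rule bform_pos)

lemma nondegenerate: "(\<And>y. qform Q x y = 0) \<Longrightarrow> x = (0::real^'m)"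
proof -
  assume *: "\<And>y. qform Q x y = 0"
  have "bform x x = (-1) ^ n * qform Q x (Cop *v x)"
    unfolding bform_def by (rule qform_sym[OF pol])
  then show ?thesis using bform_pos[of x] * by auto
qed

lemma trace_form_orthonormal:
  assumes "inner_form.orthonormal bform B" "span B = UNIV"
  shows "trace_form X Z = (\<Sum>e\<in>B. bform (X *v (Z *v e)) e)"
proof -
  interpret inner_form bform by (rule inner_form_bform)
  have "(\<Sum>e\<in>B. bform ((X ** Z) *v e) e) = (\<Sum>e\<in>Basis. ((X ** Z) *v e) \<bullet> e)"
    by (rule trace_orthonormal[OF assms]) simp
  also have "\<dots> = (\<Sum>e\<in>(\<lambda>i. axis i 1) ` UNIV. ((X ** Z) *v e) \<bullet> e)"
    by (rule arg_cong2[of _ _ _ _ sum]) (auto simp: Basis_vec_def)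
  also have "\<dots> = (\<Sum>i\<in>UNIV. ((X ** Z) *v axis i 1) \<bullet> axis i 1)"
    by (subst sum.reindex) (auto simp: inj_on_def axis_eq_axis)
  also have "\<dots> = trace (X ** Z)"
    unfolding trace_def by (intro sum.cong refl) (simp add: inner_axis matrix_vector_mult_basis column_def)
  finally show ?thesis by (simp add: trace_form_def matrix_vector_mul_assoc)
qed

text \<open>Skew for Q and commuting with C means skew for \<open>bform\<close>; in an orthonormal
  basis tr X^2 is minus the sum of the squared lengths of X e.\<close>

lemma trace_form_even:
  assumes X: "\<And>x y. qform Q (X *v x) y + qform Q x (X *v y) = 0" and "Cop ** X = X ** Cop"
  shows "trace_form X X \<le> 0"
proof -
  interpret inner_form bform by (rule inner_form_bform)
  have sk: "bform (X *v x) y = - bform x (X *v y)" for x y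
    using X[of "Cop *v x" y] arg_cong[OF assms(2), of "\<lambda>A. A *v x"]
    by (simp add: bform_def add_eq_0_iff matrix_vector_mul_assoc)
  obtain u :: "real^'m" where "u \<noteq> 0" using zero_neq_one by blast
  define u0 where "u0 = (1 / sqrt (bform u u)) *\<^sub>R u"
  have "bform u0 u0 = 1" using pos[OF \<open>u \<noteq> 0\<close>] by (simp add: u0_def simps)
  then obtain B where B: "orthonormal B" "span B = UNIV" using orthonormal_basis by blast
  have "trace_form X X = - (\<Sum>e\<in>B. bform (X *v e) (X *v e))"
    unfolding trace_form_orthonormal[OF B] sk by (simp add: sum_negf)
  moreover have "0 \<le> bform z z" for z using pos[of z] by (cases "z = 0") (auto simp: simps)
  ultimately show ?thesis by (simp add: sum_nonneg)
qed

text \<open>Anticommuting with C turns skewness for Q into self-adjointness for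
  \<open>bform\<close>, so tr X^2 is a sum of squared lengths.\<close>

lemma trace_form_odd:
  assumes X: "\<And>x y. qform Q (X *v x) y + qform Q x (X *v y) = 0" and "Cop ** X = - (X ** Cop)" and "X \<noteq> 0"
  shows "0 < trace_form X X"
proof -
  interpret inner_form bform by (rule inner_form_bform)
  have sk: "bform (X *v x) y = bform x (X *v y)" for x y
    using X[of "Cop *v x" y] arg_cong[OF assms(2), of "\<lambda>A. A *v x"]
    by (simp add: bform_def add_eq_0_iff matrix_vector_mul_assoc matrix_vector_mult_minus_left qform_simps)
  obtain u :: "real^'m" where "u \<noteq> 0" using zero_neq_one by blast
  define u0 where "u0 = (1 / sqrt (bform u u)) *\<^sub>R u"
  have "bform u0 u0 = 1" using pos[OF \<open>u \<noteq> 0\<close>] by (simp add: u0_def simps)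
  then obtain B where B: "orthonormal B" "span B = UNIV" using orthonormal_basis by blast
  have tr: "trace_form X X = (\<Sum>e\<in>B. bform (X *v e) (X *v e))"
    unfolding trace_form_orthonormal[OF B] sk by simp
  have "\<exists>e\<in>B. X *v e \<noteq> 0"
  proof (rule ccontr)
    assume "\<not> ?thesis"
    then have "(\<lambda>x. X *v x) x = (\<lambda>x. 0) x" for x
      using linear_eq_on_span[of "\<lambda>x. X *v x" "\<lambda>x. 0" B x] B by (simp add: linear_iff matrix_vector_right_distrib matrix_vector_mult_scaleR)
    then have "X = 0" by (simp add: matrix_eq)
    then show False using \<open>X \<noteq> 0\<close> by simp
  qed
  then obtain e where "e \<in> B" "X *v e \<noteq> 0" by blast
  moreover have "0 \<le> bform z z" for z using pos[of z] by (cases "z = 0") (auto simp: simps)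
  ultimately show ?thesis unfolding tr
    using pos[of "X *v e"] B(1) by (intro sum_pos2[of _ e]) (auto simp: orthonormal_def)
qed

text \<open>On the part of X mapping \<open>H a\<close> to \<open>H s\<close>, bracket with Y is
  multiplication by i (s - a); the hypothesis leaves s = a \<plusminus> 1, and the Weil weight
  changes sign between neighbours.\<close>

lemma odd_if_grade_one:
  assumes "comm Yop (comm Yop X) = - X"
  shows "Cop ** X = - (X ** Cop)"
proof -
  have "cmat Cop ** cmat X = - (cmat X ** cmat Cop)"
  proof (rule matrix_eqI)
    fix a x assume a: "a \<le> n" and x: "x \<in> H a"
    let ?M = "cmat Yop" and ?z = "cmat X *v x" and ?\<mu> = "hodge_weight n"
    have Mx: "?M *v x = ?\<mu> a *s x" using a x by (simp add: cmat_Yop cop_H)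
    have "cmat (comm Yop (comm Yop X)) *v x = - ?z" unfolding assms by (simp add: matrix_vector_mult_minus_left)
    then have "?M *v (?M *v ?z) - ?\<mu> a *s (?M *v ?z) - (?\<mu> a *s (?M *v ?z) - (?\<mu> a * ?\<mu> a) *s ?z) = - ?z"
      by (simp add: cmat_comm matrix_mult_diff_left matrix_mult_diff_right matrix_vector_mult_diff_rdistrib
         Mx vector_scalar_commute vec.scale_right_diff_distrib flip: matrix_vector_mul_assoc)
    then have eq: "comp (?M *v (?M *v ?z) - ?\<mu> a *s (?M *v ?z) - (?\<mu> a *s (?M *v ?z) - (?\<mu> a * ?\<mu> a) *s ?z)) s = comp (- ?z) s" for s
      by simp
    have z: "comp ?z s = 0 \<or> s = Suc a \<or> a = Suc s" if "s \<le> n" for s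
    proof -
      have m: "comp (u - v) s = comp u s - comp v s" "comp (- u) s = - comp u s" for u v
        using comp_simps(1)[of u "(-1) *s v" s] comp_simps(2)[of "-1" v s] comp_simps(2)[of "-1" u s] by simp_all
      have e: "(?\<mu> s * ?\<mu> s) *s comp ?z s - (?\<mu> a * ?\<mu> s) *s comp ?z s
          - ((?\<mu> a * ?\<mu> s) *s comp ?z s - (?\<mu> a * ?\<mu> a) *s comp ?z s) = - comp ?z s"
        using eq[of s] that by (simp only: m comp_simps cmat_Yop comp_cop vector_smult_assoc)
      have "((?\<mu> s - ?\<mu> a) * (?\<mu> s - ?\<mu> a) + 1) * comp ?z s $ i = 0" for i
        using arg_cong[OF e, of "\<lambda>v. v $ i"] by (simp add: algebra_simps)
      then have "((?\<mu> s - ?\<mu> a) * (?\<mu> s - ?\<mu> a) + 1) *s comp ?z s = 0"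
        unfolding vec_eq_iff vector_smult_component zero_index by blast
      moreover have "(?\<mu> s - ?\<mu> a) * (?\<mu> s - ?\<mu> a) + 1 = 1 - of_int ((int s - int a) * (int s - int a))"
        by (simp add: hodge_weight_def algebra_simps)
      ultimately have "comp ?z s = 0 \<or> (int s - int a) * (int s - int a) = 1"
        by (metis eq_iff_diff_eq_0 of_int_1 of_int_eq_iff vector_mul_eq_0)
      then show ?thesis using zmult_eq_1_iff[of "int s - int a" "int s - int a"] by auto
    qed
    have "weil_weight n s *s comp ?z s = - (weil_weight n a *s comp ?z s)" if "s \<le> n" for s
      using z[OF that] weil_weight_simps(4)[of s n] weil_weight_simps(4)[of a n] a that by auto
    then have "cmat Cop *v ?z = - (weil_weight n a *s ?z)"
      unfolding cmat_Cop cop_mult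
      by (subst (2) comp_sum[of ?z, symmetric]) (simp add: vec.scale_sum_right sum_negf)
    moreover have "cmat X *v (cmat Cop *v x) = weil_weight n a *s ?z"
      using a x by (simp add: cmat_Cop cop_H vector_scalar_commute)
    ultimately show "(cmat Cop ** cmat X) *v x = (- (cmat X ** cmat Cop)) *v x"
      by (simp add: matrix_vector_mult_minus_left flip: matrix_vector_mul_assoc)
  qed
  then have "cmat (Cop ** X) = cmat (- (X ** Cop))" by (simp add: cmat_mult)
  then show ?thesis by (rule cmat_simps(6)[THEN iffD1])
qed

end

section \<open>Transitivity of the group\<close>

text \<open>
  With \<open>k\<close> the real or the complex numbers, this covers the middle piece \<open>2r = n\<close>, where isometries
  must commute with conjugation, and the pieces \<open>2r \<noteq> n\<close> at the same time.
\<close>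

locale partial_hermitian =
  fixes f :: "complex^'m \<Rightarrow> complex^'m \<Rightarrow> complex" and R :: "(complex^'m) set" and k :: "complex set"
  assumes add: "f (x + y) z = f x z + f y z" and scale: "f (c *s x) z = c * f x z"
    and herm: "f y x = cnj (f x y)"
    and pos: "x \<in> vec.span R \<Longrightarrow> x \<noteq> 0 \<Longrightarrow> \<exists>t>0. f x x = complex_of_real t"
    and R0: "0 \<in> R" and R_add: "x \<in> R \<Longrightarrow> y \<in> R \<Longrightarrow> x + y \<in> R" and R_scale: "c \<in> k \<Longrightarrow> x \<in> R \<Longrightarrow> c *s x \<in> R"
    and f_k: "x \<in> R \<Longrightarrow> y \<in> R \<Longrightarrow> - f x y \<in> k" and real_k: "complex_of_real r \<in> k"
begin

definition orthonormal where
  "orthonormal B \<longleftrightarrow> finite B \<and> B \<subseteq> R \<and> (\<forall>x\<in>B. \<forall>y\<in>B. f x y = (if x = y then 1 else 0))"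

lemma zero: "f 0 z = 0" using scale[of 0 0 z] by simp

lemma zero_right: "f z 0 = 0" using herm[of z 0] by (simp add: zero)

lemma sum: "f (\<Sum>i\<in>I. g i) z = (\<Sum>i\<in>I. f (g i) z)"
  by (induction I rule: infinite_finite_induct) (simp_all add: add zero)

lemma right: "f z (x + y) = f z x + f z y" "f z (c *s x) = cnj c * f z x"
  using herm[of z "x + y"] herm[of z x] herm[of z y] herm[of z "c *s x"] by (simp_all add: add scale)

lemma orthonormal_coeff:
  assumes "orthonormal B" "y \<in> B"
  shows "f (\<Sum>x\<in>B. c x *s x) y = c y"
proof -
  have "f (\<Sum>x\<in>B. c x *s x) y = (\<Sum>x\<in>B. c x * (if x = y then 1 else 0))"
    using assms unfolding orthonormal_def by (simp add: sum scale)
  also have "\<dots> = c y" using assms by (simp add: orthonormal_def if_distrib cong: if_cong)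
  finally show ?thesis .
qed

lemma orthonormal_independent: "orthonormal B \<Longrightarrow> vec.independent B"
proof
  assume B: "orthonormal B" and "vec.dependent B"
  then obtain c v where "v \<in> B" "c v \<noteq> 0" "(\<Sum>v\<in>B. c v *s v) = 0"
    using vec.dependent_finite[of B] by (auto simp: orthonormal_def)
  then show False using orthonormal_coeff[OF B, of v c] by (simp add: zero)
qed

lemma R_sum: "(\<And>i. i \<in> I \<Longrightarrow> g i \<in> R) \<Longrightarrow> (\<Sum>i\<in>I. g i) \<in> R"
  by (induction I rule: infinite_finite_induct) (simp_all add: R0 R_add)

text \<open>Gram-Schmidt inside R: a maximal orthonormal subset of R spans. The coefficients lie in
  k, so an added vector stays in R.\<close>

lemma orthonormal_basis:
  obtains B where "orthonormal B" "vec.span B = vec.span R"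
proof -
  have "orthonormal {}" by (simp add: orthonormal_def)
  moreover have "\<forall>B. orthonormal B \<longrightarrow> card B < vec.dim R + 1"
    using orthonormal_independent vec.independent_card_le_dim[of _ R] unfolding orthonormal_def
    by (metis less_add_one order_le_less_trans orthonormal_def orthonormal_independent)
  ultimately obtain B where B: "orthonormal B" and max: "\<And>B'. orthonormal B' \<Longrightarrow> card B' \<le> card B"
    using ex_has_greatest_nat[of orthonormal "{}" card] by blast
  have fin: "finite B" and BR: "B \<subseteq> R" using B by (auto simp: orthonormal_def)
  have "R \<subseteq> vec.span B"
  proof (rule ccontr)
    assume "\<not> ?thesis"
    then obtain v where v: "v \<in> R" "v \<notin> vec.span B" by blast
    define v' where "v' = v + (\<Sum>e\<in>B. (- f v e) *s e)"
    have sp: "(\<Sum>e\<in>B. (- f v e) *s e) \<in> vec.span B" by (intro vec.span_sum vec.span_scale vec.span_base)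
    have v': "v' \<notin> vec.span B"
    proof
      assume "v' \<in> vec.span B"
      then have "v' - (\<Sum>e\<in>B. (- f v e) *s e) \<in> vec.span B" using sp by (rule vec.span_diff)
      then show False using v by (simp add: v'_def)
    qed
    have v'R: "v' \<in> R" unfolding v'_def
      using v BR by (intro R_add R_sum R_scale f_k) auto
    have "v' \<noteq> 0" using v' by (auto simp: vec.span_zero)
    then obtain t where t: "0 < t" "f v' v' = complex_of_real t"
      using pos[OF vec.span_base[OF v'R]] by blast
    have orth: "f v' e = 0" "f e v' = 0" if "e \<in> B" for e
    proof -
      show "f v' e = 0" using orthonormal_coeff[OF B that, of "\<lambda>e. - f v e"] by (simp add: v'_def add)
      then show "f e v' = 0" using herm[of e v'] by simp
    qed
    \<comment> \<open>A real normalizing factor does not lead out of R, by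
      \<open>real_k\<close>.\<close>
    define c where "c = complex_of_real (1 / sqrt t)"
    define e' where "e' = c *s v'"
    have c: "c \<noteq> 0" "c * (c * complex_of_real t) = 1"
    proof -
      show "c \<noteq> 0" using t by (simp add: c_def)
      have "(1 / sqrt t) * ((1 / sqrt t) * t) = 1" using t(1) by (simp add: field_simps)
      then show "c * (c * complex_of_real t) = 1" unfolding c_def of_real_mult[symmetric] by simp
    qed
    have "e' \<notin> B"
    proof
      assume "e' \<in> B"
      then have "inverse c *s e' \<in> vec.span B" by (intro vec.span_scale vec.span_base)
      then show False using v' c by (simp add: e'_def vector_smult_assoc)
    qed
    have "f e' e' = 1" unfolding e'_def scale right t(2) using c by (simp add: c_def)
    moreover have "f e' e = 0" "f e e' = 0" if "e \<in> B" for e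
      using orth[OF that] by (simp_all add: e'_def scale right)
    moreover have "e' \<in> R" unfolding e'_def c_def by (rule R_scale[OF real_k v'R])
    ultimately have "orthonormal (insert e' B)" using B \<open>e' \<notin> B\<close> by (auto simp: orthonormal_def)
    then have "card (insert e' B) \<le> card B" by (rule max)
    then show False using \<open>e' \<notin> B\<close> fin by simp
  qed
  then have "vec.span B = vec.span R" using BR by (metis vec.span_eq subset_trans vec.span_superset)
  then show ?thesis using that B by blast
qed

lemma orthonormal_expansion:
  assumes B: "orthonormal B" "vec.span B = vec.span R" and x: "x \<in> vec.span R"
  shows "x = (\<Sum>e\<in>B. f x e *s e)"
proof -
  have "x \<in> range (\<lambda>u. \<Sum>v\<in>B. u v *s v)"
    using x B vec.span_finite[of B] by (simp add: orthonormal_def)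
  then obtain c where c: "x = (\<Sum>e\<in>B. c e *s e)" by blast
  then have "f x e = c e" if "e \<in> B" for e using orthonormal_coeff[OF B(1) that] by simp
  then show ?thesis using c by simp
qed

end

text \<open>A bijection of orthonormal bases, extended linearly. The conclusion records that basis
  and image lie in R and R', since this yields compatibility with conjugation in the middle
  degree.\<close>

lemma unitary_map:
  assumes 1: "partial_hermitian f R k" and 2: "partial_hermitian f R' k" and dim: "vec.dim R = vec.dim R'"
  obtains \<phi> B \<tau> where "\<And>x. \<phi> x = (\<Sum>e\<in>B. f x e *s \<tau> e)" "B \<subseteq> R" "\<tau> ` B \<subseteq> R'"
    "\<And>x y. x \<in> vec.span R \<Longrightarrow> y \<in> vec.span R \<Longrightarrow> f (\<phi> x) (\<phi> y) = f x y"
proof -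
  interpret R1: partial_hermitian f R k by (rule 1)
  interpret R2: partial_hermitian f R' k by (rule 2)
  obtain B where B: "R1.orthonormal B" "vec.span B = vec.span R" by (rule R1.orthonormal_basis)
  obtain B' where B': "R2.orthonormal B'" "vec.span B' = vec.span R'" by (rule R2.orthonormal_basis)
  have "card B = card B'"
    using vec.dim_eq_card[OF B(2) R1.orthonormal_independent[OF B(1)]]
      vec.dim_eq_card[OF B'(2) R2.orthonormal_independent[OF B'(1)]] dim by simp
  moreover have "finite B" "finite B'" using B B' by (auto simp: R1.orthonormal_def R2.orthonormal_def)
  ultimately obtain \<tau> where \<tau>: "bij_betw \<tau> B B'" using finite_same_card_bij by blast
  define \<phi> where "\<phi> x = (\<Sum>e\<in>B. f x e *s \<tau> e)" for x
  have \<tau>f: "f (\<tau> x) (\<tau> y) = (if x = y then 1 else 0)" if "x \<in> B" "y \<in> B" for x y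
    using B'(1) \<tau> that unfolding R2.orthonormal_def bij_betw_def inj_on_def by auto
  have \<phi>\<tau>: "f (\<phi> x) (\<tau> e) = f x e" if "e \<in> B" for x e
  proof -
    have "f (\<phi> x) (\<tau> e) = (\<Sum>e'\<in>B. f x e' * (if e' = e then 1 else 0))"
      unfolding \<phi>_def R1.sum R1.scale using that by (intro sum.cong) (auto simp: \<tau>f)
    then show ?thesis using that \<open>finite B\<close> by (simp add: if_distrib cong: if_cong)
  qed
  have r: "f z (\<Sum>e\<in>I. c e *s g e) = (\<Sum>e\<in>I. cnj (c e) * f z (g e))" for z c g and I :: "(complex^'a) set"
    by (induction I rule: infinite_finite_induct) (simp_all add: R1.zero_right R1.right)
  show ?thesis
  proof (rule that[of \<phi> \<tau> B])
    show "B \<subseteq> R" "\<tau> ` B \<subseteq> R'" using B(1) B'(1) \<tau> by (auto simp: R1.orthonormal_def R2.orthonormal_def bij_betw_def)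
    fix x y assume x: "x \<in> vec.span R" and y: "y \<in> vec.span R"
    have "f (\<phi> x) (\<phi> y) = (\<Sum>e\<in>B. cnj (f y e) * f x e)"
      unfolding \<phi>_def[of y] r by (intro sum.cong refl) (simp add: \<phi>\<tau>)
    also have "\<dots> = f x (\<Sum>e\<in>B. f y e *s e)" unfolding r ..
    also have "\<dots> = f x y" using R1.orthonormal_expansion[OF B y] by simp
    finally show "f (\<phi> x) (\<phi> y) = f x y" .
  qed (simp add: \<phi>_def)
qed

section \<open>Isometries between the pieces of two Hodge structures\<close>

context hodge_structure begin

definition hform :: "nat \<Rightarrow> complex^'m \<Rightarrow> complex^'m \<Rightarrow> complex" where
  "hform r x y = weil_weight n r * qform Q x (vcnj y)"

text \<open>Conjugation multiplies the weight by (-1)^n, which cancels the sign from exchanging the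
  arguments of Q.\<close>

lemma hform_herm:
  assumes "r \<le> n"
  shows "hform r y x = cnj (hform r x y)"
proof -
  have "cnj (weil_weight n r) * (-1) ^ n = weil_weight n r"
    using weil_weight_simps(1,2)[of "n - r" n] weil_weight_simps(3)[of r n] weil_weight_simps(1)[of r n] assms
    by (simp add: mult.assoc[symmetric] mult.commute) (metis (no_types, lifting) mult.assoc mult.commute mult.right_neutral)
  moreover have "cnj (hform r x y) = cnj (weil_weight n r) * (-1) ^ n * qform Q y (vcnj x)"
    unfolding hform_def complex_cnj_mult cnj_qform using qform_sym[OF pol, of "vcnj x" y] by simp
  ultimately show ?thesis by (simp add: hform_def)
qed

definition real_part :: "nat \<Rightarrow> (complex^'m) set" where
  "real_part r = (if 2 * r = n then {x \<in> H r. vcnj x = x} else H r)"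

definition real_field :: "nat \<Rightarrow> complex set" where
  "real_field r = (if 2 * r = n then \<real> else UNIV)"

lemma span_real_part: "r \<le> n \<Longrightarrow> vec.span (real_part r) = H r"
proof (cases "2 * r = n")
  case True
  have "H r \<subseteq> vec.span {x \<in> H r. vcnj x = x}"
  proof
    fix x assume x: "x \<in> H r"
    have x': "vcnj x \<in> H r" using vcnj_H[of r x] x True by (metis diff_add_inverse le_add1 mult_2)
    let ?a = "(1/2) *s (x + vcnj x)" and ?b = "(-\<i>/2) *s (x - vcnj x)"
    have "?a \<in> {x \<in> H r. vcnj x = x}" "?b \<in> {x \<in> H r. vcnj x = x}"
      using x x' by (auto simp: H_simps vec_eq_iff algebra_simps)
    then have "?a + \<i> *s ?b \<in> vec.span {x \<in> H r. vcnj x = x}"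
      by (intro vec.span_add[OF vec.span_base vec.span_scale[OF vec.span_base]])
    moreover have "?a + \<i> *s ?b = x" by (simp add: vec_eq_iff field_simps)
    ultimately show "x \<in> vec.span {x \<in> H r. vcnj x = x}" by simp
  qed
  moreover have "vec.span {x \<in> H r. vcnj x = x} \<subseteq> H r"
    by (rule vec.span_minimal) (auto simp: H_subspace)
  ultimately show ?thesis using True by (simp add: real_part_def)
qed (simp add: real_part_def vec.span_eq_iff H_subspace)

lemma partial_hermitian_hform:
  assumes r: "r \<le> n"
  shows "partial_hermitian (hform r) (real_part r) (real_field r)"
proof
  fix x y assume xy: "x \<in> real_part r" "y \<in> real_part r"
  show "- hform r x y \<in> real_field r"
  proof (cases "2 * r = n")
    case True
    then have "weil_weight n r = 1" "vcnj x = x" "vcnj y = y" using xy by (auto simp: weil_weight_def real_part_def)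
    then have "cnj (- hform r x y) = - hform r x y" by (simp add: hform_def cnj_qform)
    then show ?thesis using True by (simp add: real_field_def Reals_cnj_iff)
  qed (simp add: real_field_def)
  show "x + y \<in> real_part r" using xy by (auto simp: real_part_def H_simps split: if_splits)
next
  fix x c assume "c \<in> real_field r" "x \<in> real_part r"
  then show "c *s x \<in> real_part r"
    by (auto simp: real_part_def real_field_def H_simps Reals_cnj_iff split: if_splits)
next
  fix x assume "x \<in> vec.span (real_part r)" "x \<noteq> 0"
  then show "\<exists>t>0. hform r x x = complex_of_real t"
    unfolding span_real_part[OF r] hform_def using H_pos[OF r] by blast
next
  show "hform r y x = cnj (hform r x y)" for x y by (rule hform_herm[OF r])
qed (auto simp: hform_def qform_simps algebra_simps real_part_def real_field_def H_simps)

end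

locale two_hodge_structures = hodge_structure n Q h H + H': hodge_structure n Q h H'
  for n and Q :: "int^'m^'m" and h H H'
begin

lemma graded_isometry:
  assumes "r \<le> n"
  shows "\<exists>\<phi>. (\<forall>x y. \<phi> (x + y) = \<phi> x + \<phi> y) \<and> (\<forall>c x. \<phi> (c *s x) = c *s \<phi> x) \<and> (\<forall>x. \<phi> x \<in> H' r) \<and>
     (\<forall>x\<in>H r. \<forall>y\<in>H r. hform r (\<phi> x) (\<phi> y) = hform r x y) \<and>
     (2 * r = n \<longrightarrow> (\<forall>x. \<phi> (vcnj x) = vcnj (\<phi> x)))"
proof -
  have "vec.dim (real_part r) = vec.dim (H'.real_part r)"
    using H_dim[OF assms] H'.H_dim[OF assms] span_real_part[OF assms] H'.span_real_part[OF assms]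
    by (metis vec.dim_span)
  then obtain \<phi> B \<tau> where \<phi>: "\<And>x. \<phi> x = (\<Sum>e\<in>B. hform r x e *s \<tau> e)" and B: "B \<subseteq> real_part r" "\<tau> ` B \<subseteq> H'.real_part r"
    and iso: "\<And>x y. x \<in> vec.span (real_part r) \<Longrightarrow> y \<in> vec.span (real_part r) \<Longrightarrow> hform r (\<phi> x) (\<phi> y) = hform r x y"
    by (rule unitary_map[OF partial_hermitian_hform[OF assms] H'.partial_hermitian_hform[OF assms]]) blast
  have "\<phi> (vcnj x) = vcnj (\<phi> x)" if "2 * r = n" for x
    unfolding \<phi> vcnj_sum
  proof (rule sum.cong)
    fix e assume "e \<in> B"
    then have e: "vcnj e = e" "vcnj (\<tau> e) = \<tau> e" using B that by (auto simp: real_part_def H'.real_part_def)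
    have "weil_weight n r = 1" using that by (auto simp: weil_weight_def)
    then show "hform r (vcnj x) e *s \<tau> e = vcnj (hform r x e *s \<tau> e)"
      using cnj_qform[of Q x e] by (simp add: e hform_def)
  qed simp
  moreover have "\<phi> x \<in> H' r" for x
  proof -
    have "\<tau> e \<in> H' r" if "e \<in> B" for e using B(2) that by (auto simp: H'.real_part_def split: if_splits)
    then show ?thesis unfolding \<phi> by (intro vec.subspace_sum[OF H'.H_subspace]) (simp add: H'.H_simps)
  qed
  moreover have "\<phi> (x + y) = \<phi> x + \<phi> y" "\<phi> (c *s x) = c *s \<phi> x" for c x y
    by (simp_all add: \<phi> hform_def qform_simps algebra_simps vec.scale_left_distrib sum.distrib vec.scale_sum_right vector_smult_assoc)
  ultimately show ?thesis using iso span_real_part[OF assms] by (intro exI[of _ \<phi>]) simp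
qed

text \<open>For 2 r \<ge> n use \<open>graded_isometry\<close>; below the middle conjugate the map
  of degree n - r. Then the family respects conjugation, and preserving \<open>hform r\<close>
  becomes preserving Q between degrees r and n - r.\<close>

lemma graded_isometries:
  "\<exists>\<phi>. \<forall>r\<le>n. (\<forall>x y. \<phi> r (x + y) = \<phi> r x + \<phi> r y) \<and> (\<forall>c x. \<phi> r (c *s x) = c *s \<phi> r x) \<and>
     (\<forall>x. \<phi> r x \<in> H' r) \<and> (\<forall>x\<in>H r. \<forall>y\<in>H (n - r). qform Q (\<phi> r x) (\<phi> (n - r) y) = qform Q x y) \<and>
     (\<forall>x. \<phi> (n - r) (vcnj x) = vcnj (\<phi> r x))"
proof -
  have "\<forall>r. \<exists>\<phi>. r \<le> n \<longrightarrow> (\<forall>x y. \<phi> (x + y) = \<phi> x + \<phi> y) \<and> (\<forall>c x. \<phi> (c *s x) = c *s \<phi> x) \<and> (\<forall>x. \<phi> x \<in> H' r) \<and>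
     (\<forall>x\<in>H r. \<forall>y\<in>H r. hform r (\<phi> x) (\<phi> y) = hform r x y) \<and>
     (2 * r = n \<longrightarrow> (\<forall>x. \<phi> (vcnj x) = vcnj (\<phi> x)))"
    using graded_isometry by blast
  from choice[OF this] obtain \<psi> where \<psi>': "\<forall>r. r \<le> n \<longrightarrow> (\<forall>x y. \<psi> r (x + y) = \<psi> r x + \<psi> r y) \<and>
     (\<forall>c x. \<psi> r (c *s x) = c *s \<psi> r x) \<and> (\<forall>x. \<psi> r x \<in> H' r) \<and>
     (\<forall>x\<in>H r. \<forall>y\<in>H r. hform r (\<psi> r x) (\<psi> r y) = hform r x y) \<and>
     (2 * r = n \<longrightarrow> (\<forall>x. \<psi> r (vcnj x) = vcnj (\<psi> r x)))"
    by blast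
  have \<psi>: "\<psi> r (x + y) = \<psi> r x + \<psi> r y" "\<psi> r (c *s x) = c *s \<psi> r x" "\<psi> r x \<in> H' r"
    "x \<in> H r \<Longrightarrow> y \<in> H r \<Longrightarrow> hform r (\<psi> r x) (\<psi> r y) = hform r x y"
    "2 * r = n \<Longrightarrow> \<psi> r (vcnj x) = vcnj (\<psi> r x)" if "r \<le> n" for r x y c
    using \<psi>'[rule_format, OF that] by blast+
  define \<phi> where "\<phi> r = (if 2 * r \<ge> n then \<psi> r else (\<lambda>x. vcnj (\<psi> (n - r) (vcnj x))))" for r
  have conj: "\<phi> (n - r) (vcnj x) = vcnj (\<phi> r x)" if "r \<le> n" for r x
  proof -
    consider "2 * r > n" | "2 * r < n" | "2 * r = n" by linarith
    then show ?thesis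
    proof cases
      case 3
      then have "n - r = r" by simp
      then show ?thesis using \<psi>(5)[OF that 3] 3 by (simp add: \<phi>_def)
    next
      case 1
      then have "\<not> 2 * (n - r) \<ge> n" "n - (n - r) = r" using that by auto
      then show ?thesis using 1 by (simp add: \<phi>_def)
    next
      case 2
      then have "2 * (n - r) \<ge> n" using that by auto
      then show ?thesis using 2 by (simp add: \<phi>_def)
    qed
  qed
  have upper: "qform Q (\<phi> r x) (\<phi> (n - r) y) = qform Q x y"
    if r: "r \<le> n" "n \<le> 2 * r" and x: "x \<in> H r" and y: "y \<in> H (n - r)" for r x y
  proof -
    have y': "vcnj y \<in> H r" using vcnj_H[OF _ y] r by simp
    have e: "\<phi> (n - r) y = vcnj (\<psi> r (vcnj y))" using conj[OF r(1), of "vcnj y"] r by (simp add: \<phi>_def)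
    have "weil_weight n r * qform Q (\<phi> r x) (\<phi> (n - r) y) = weil_weight n r * qform Q x y"
      using \<psi>(4)[OF r(1) x y'] r(2) unfolding e hform_def by (simp add: \<phi>_def)
    then show ?thesis using weil_weight_simps(5)[OF r(1)] by simp
  qed
  show ?thesis
  proof (intro exI[of _ \<phi>] allI impI conjI ballI)
    fix r assume r: "r \<le> n"
    show "\<phi> r (x + y) = \<phi> r x + \<phi> r y" "\<phi> r (c *s x) = c *s \<phi> r x" for x y c
      using r by (simp_all add: \<phi>_def \<psi>)
    show "\<phi> r x \<in> H' r" for x
      using \<psi>(3)[OF r] H'.vcnj_H[OF _ \<psi>(3), of "n - r" "vcnj x"] r by (simp add: \<phi>_def)
    show "\<phi> (n - r) (vcnj x) = vcnj (\<phi> r x)" for x by (rule conj[OF r])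
    show "qform Q (\<phi> r x) (\<phi> (n - r) y) = qform Q x y" if x: "x \<in> H r" and y: "y \<in> H (n - r)" for x y
    proof (cases "n \<le> 2 * r")
      case True
      then show ?thesis using upper r x y by blast
    next
      case False
      then have "qform Q (\<phi> (n - r) y) (\<phi> r x) = qform Q y x"
        using upper[of "n - r" y x] r x y by simp
      then show ?thesis using qform_sym[OF pol, of "\<phi> r x"] qform_sym[OF pol, of x y] by simp
    qed
  qed
qed

text \<open>The isometries of the pieces add up to one of H that commutes with conjugation, hence
  comes from a real matrix. Because of this, \<open>proj\<close> describes a coset at every point of
  the classifying space.\<close>

theorem transitive: "\<exists>a\<in>Aut Q. H' = act a H"
proof -
  obtain \<phi> where \<phi>': "\<forall>r\<le>n. (\<forall>x y. \<phi> r (x + y) = \<phi> r x + \<phi> r y) \<and> (\<forall>c x. \<phi> r (c *s x) = c *s \<phi> r x) \<and>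
     (\<forall>x. \<phi> r x \<in> H' r) \<and> (\<forall>x\<in>H r. \<forall>y\<in>H (n - r). qform Q (\<phi> r x) (\<phi> (n - r) y) = qform Q x y) \<and>
     (\<forall>x. \<phi> (n - r) (vcnj x) = vcnj (\<phi> r x))"
    using graded_isometries by blast
  have \<phi>: "\<phi> r (x + y) = \<phi> r x + \<phi> r y" "\<phi> r (c *s x) = c *s \<phi> r x" "\<phi> r x \<in> H' r"
    "x \<in> H r \<Longrightarrow> y \<in> H (n - r) \<Longrightarrow> qform Q (\<phi> r x) (\<phi> (n - r) y) = qform Q x y"
    "\<phi> (n - r) (vcnj x) = vcnj (\<phi> r x)" if "r \<le> n" for r x y c
    using \<phi>'[rule_format, OF that] by blast+
  have \<phi>0: "\<phi> r 0 = 0" if "r \<le> n" for r using \<phi>(2)[OF that, of 0 0] by simp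
  define A where "A = matrix (\<lambda>v. \<Sum>r\<le>n. \<phi> r (comp v r))"
  have A: "A *v v = (\<Sum>r\<le>n. \<phi> r (comp v r))" for v
    unfolding A_def
    by (rule matrix_works, unfold_locales) (simp_all add: comp_simps \<phi> sum.distrib vec.scale_sum_right)
  have comp_A: "H'.comp (A *v v) r = \<phi> r (comp v r)" if "r \<le> n" for v r
  proof -
    have "H'.comp (A *v v) = (\<lambda>r. if r \<le> n then \<phi> r (comp v r) else 0)"
      unfolding A by (rule H'.comp_eqI) (auto simp: \<phi> H'.H_simps)
    then show ?thesis using that by simp
  qed
  have "mcnj A *v v = A *v v" for v
  proof -
    have "mcnj A *v v = vcnj (A *v vcnj v)" by (simp add: vcnj_mult)
    also have "\<dots> = (\<Sum>r\<le>n. vcnj (\<phi> r (vcnj (comp v (n - r)))))"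
      unfolding A vcnj_sum by (intro sum.cong refl) (simp add: comp_vcnj)
    also have "\<dots> = (\<Sum>r\<le>n. \<phi> (n - r) (comp v (n - r)))"
      by (intro sum.cong refl) (simp add: \<phi>(5)[symmetric])
    also have "\<dots> = (\<Sum>r\<le>n. \<phi> r (comp v r))"
      by (rule sum.reindex_bij_witness[of _ "\<lambda>r. n - r" "\<lambda>r. n - r"]) auto
    finally show ?thesis by (simp add: A)
  qed
  then have "mcnj A = A" by (simp add: matrix_eq)
  then have a: "cmat (rmat A) = A" by (rule cmat_rmat)
  have QA: "qform Q (A *v x) (A *v y) = qform Q x y" for x y
    unfolding H'.qform_comp[of "A *v x"] qform_comp[of x]
    by (intro sum.cong refl) (simp add: comp_A \<phi>(4) comp_H)
  have Qa: "qform Q (rmat A *v x) (rmat A *v y) = qform Q x y" for x y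
  proof -
    have "qform Q (cmat (rmat A) *v cvec x) (cmat (rmat A) *v cvec y) = qform Q (cvec x) (cvec y)"
      unfolding a by (rule QA)
    then show ?thesis unfolding cmat_cvec qform_cvec by simp
  qed
  have "x = 0" if "rmat A *v x = 0" for x
  proof (rule nondegenerate)
    show "qform Q x y = 0" for y using Qa[of x y] that by (simp add: qform_simps)
  qed
  then have inv: "invertible (rmat A)"
    unfolding invertible_left_inverse matrix_left_invertible_ker by blast
  have "act (rmat A) H r = H' r" for r
  proof (cases "r \<le> n")
    case True
    have Ax: "A *v x = \<phi> r x" if "x \<in> H r" for x
    proof -
      have "A *v x = (\<Sum>s\<le>n. if s = r then \<phi> r x else 0)"
        unfolding A by (intro sum.cong refl) (simp add: comp_self[OF that] \<phi>0)
      then show ?thesis using True by simp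
    qed
    have "y \<in> (\<lambda>x. A *v x) ` H r" if "y \<in> H' r" for y
    proof -
      define z where "z = cmat (matrix_inv (rmat A)) *v y"
      have "A *v z = (cmat (rmat A ** matrix_inv (rmat A))) *v y"
        unfolding z_def cmat_mult a by (simp add: matrix_vector_mul_assoc)
      then have "A *v z = y" using matrix_inv_right[OF inv] by simp
      then have "\<phi> r (comp z r) = y" using comp_A[OF True, of z] H'.comp_self[OF that, of r] by simp
      then show ?thesis using Ax[OF comp_H] comp_H by (metis image_eqI)
    qed
    then show ?thesis using Ax \<phi>(3)[OF True] by (auto simp: act_def cmul_eq a)
  next
    case False
    then show ?thesis by (simp add: act_def cmul_eq H_0 H'.H_0)
  qed
  then have "H' = act (rmat A) H" by (simp add: fun_eq_iff)
  moreover have "rmat A \<in> Aut Q" using inv Qa by (simp add: Aut_def)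
  ultimately show ?thesis by blast
qed

end

section \<open>The Lie algebra and its Killing form\<close>

definition gram :: "int^'m^'m \<Rightarrow> real^'m^'m" where
  "gram Q = (\<chi> i j. of_int (Q $ i $ j))"

lemma qform_gram: "qform Q x y = x \<bullet> (gram Q *v y)"
  by (simp add: qform_def gram_def inner_vec_def matrix_vector_mult_def sum_distrib_left algebra_simps)

lemma inner_eq_0_matrix: "(\<And>x y. x \<bullet> (A *v y) = 0) \<Longrightarrow> A = (0 :: real^'m^'m)"
proof -
  assume *: "\<And>x y. x \<bullet> (A *v y) = 0"
  have "A *v y = 0" for y using *[of "A *v y" y] by simp
  then show ?thesis by (simp add: matrix_eq)
qed

text \<open>Presents \<open>so Q\<close> as the kernel of a linear map, the form in which
  \<open>period_chart\<close> takes its Lie algebra.\<close>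

definition skew_op :: "int^'m^'m \<Rightarrow> real^'m^'m \<Rightarrow> real^'m^'m" where
  "skew_op Q X = transpose X ** gram Q + gram Q ** X"

definition so :: "int^'m^'m \<Rightarrow> (real^'m^'m) set" where
  "so Q = {X. skew_op Q X = 0}"

lemma transpose_simps: "transpose (A + B) = transpose A + transpose (B :: real^'n^'m)" "transpose (r *\<^sub>R A) = r *\<^sub>R transpose A"
  "transpose (- A) = - transpose A" "transpose (A - B) = transpose A - transpose B"
  by (simp_all add: transpose_def vec_eq_iff)

lemma linear_skew_op: "linear (skew_op Q)"
  by (rule linearI) (simp_all add: skew_op_def transpose_simps matrix_ring_simps scaleR_add_right)

lemma qform_skew_op: "qform Q (X *v x) y + qform Q x (X *v y) = x \<bullet> (skew_op Q X *v y)"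
proof -
  have "(X *v x) \<bullet> (gram Q *v y) = x \<bullet> (transpose X *v (gram Q *v y))"
    using dot_lmul_matrix[of "gram Q *v y" X x] by (simp add: inner_commute)
  then show ?thesis
    by (simp add: qform_gram skew_op_def matrix_vector_mult_add_rdistrib inner_add_right matrix_vector_mul_assoc)
qed

lemma so_iff: "X \<in> so Q \<longleftrightarrow> (\<forall>x y. qform Q (X *v x) y + qform Q x (X *v y) = 0)"
  unfolding so_def qform_skew_op using inner_eq_0_matrix[of "skew_op Q X"] by auto

lemma comm_so: "X \<in> so Q \<Longrightarrow> Z \<in> so Q \<Longrightarrow> comm X Z \<in> so Q"
proof -
  assume X: "X \<in> so Q" and Z: "Z \<in> so Q"
  have "qform Q (comm X Z *v x) y + qform Q x (comm X Z *v y) = 0" for x y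
    using X[unfolded so_iff, rule_format, of "Z *v x" y] X[unfolded so_iff, rule_format, of x "Z *v y"]
      Z[unfolded so_iff, rule_format, of "X *v x" y] Z[unfolded so_iff, rule_format, of x "X *v y"]
    by (simp add: comm_def matrix_vector_mult_diff_rdistrib qform_simps flip: matrix_vector_mul_assoc)
  then show ?thesis by (simp add: so_iff)
qed

lemma so_simps: "X \<in> so Q \<Longrightarrow> Z \<in> so Q \<Longrightarrow> X + Z \<in> so Q" "X \<in> so Q \<Longrightarrow> Z \<in> so Q \<Longrightarrow> X - Z \<in> so Q"
  "X \<in> so Q \<Longrightarrow> r *\<^sub>R X \<in> so Q"
  using linear_skew_op[of Q] by (simp_all add: so_def linear_add linear_diff linear_cmul)

lemma bounded_bilinear_matrix_mult: "bounded_bilinear ((**) :: real^'m^'m \<Rightarrow> real^'m^'m \<Rightarrow> real^'m^'m)"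
  unfolding bilinear_conv_bounded_bilinear[symmetric]
  by (auto simp: bilinear_def linear_iff matrix_ring_simps)

lemma has_derivative_skew:
  fixes a :: "'z::real_normed_vector \<Rightarrow> real^'m^'m"
  assumes A: "(a has_derivative a') (at w)" and iso: "\<forall>\<^sub>F z in nhds w. \<forall>x y. qform Q (a z *v x) (a z *v y) = qform Q x y"
  shows "qform Q (a' u *v x) (a w *v y) + qform Q (a w *v x) (a' u *v y) = 0"
proof -
  have bl: "bounded_bilinear (\<lambda>x y. qform Q x (y :: real^'m))"
    unfolding bilinear_conv_bounded_bilinear[symmetric]
    by (auto simp: bilinear_def linear_iff qform_gram inner_add_left inner_add_right matrix_vector_right_distrib matrix_vector_mult_scaleR)
  have mv: "((\<lambda>z. a z *v x) has_derivative (\<lambda>u. a' u *v x)) (at w)" for x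
    by (rule bounded_linear.has_derivative[OF _ A])
       (simp add: linear_conv_bounded_linear[symmetric] linear_iff matrix_vector_mult_add_rdistrib scaleR_matrix_vector_assoc)
  have "((\<lambda>z. qform Q (a z *v x) (a z *v y)) has_derivative
      (\<lambda>u. qform Q (a w *v x) (a' u *v y) + qform Q (a' u *v x) (a w *v y))) (at w)"
    by (rule bounded_bilinear.FDERIV[OF bl mv mv])
  moreover have "((\<lambda>z. qform Q (a z *v x) (a z *v y)) has_derivative (\<lambda>u. 0)) (at w)"
  proof (rule has_derivative_transform_eventually[OF has_derivative_const])
    show "\<forall>\<^sub>F z in at w. qform Q x y = qform Q (a z *v x) (a z *v y)"
      using iso unfolding eventually_nhds_conv_at by (auto elim: eventually_mono)
    show "qform Q x y = qform Q (a w *v x) (a w *v y)"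
      using eventually_nhds_x_imp_x[OF iso] by simp
  qed simp
  ultimately have "(\<lambda>u. qform Q (a w *v x) (a' u *v y) + qform Q (a' u *v x) (a w *v y)) = (\<lambda>u. 0)"
    by (rule has_derivative_unique)
  from fun_cong[OF this, of u] show ?thesis by (simp add: add.commute)
qed

text \<open>For D = \<gamma> t - 1 the equation reads D - t X = (t/2) X D. For small t the right
  side is at most half of D in norm, so D = O(t); inserting this again leaves an error
  O(t^2).\<close>

lemma cayley_derivative:
  fixes X :: "real^'m^'m"
  assumes \<gamma>0: "\<gamma> 0 = mat 1" and "0 < d"
    and \<gamma>: "\<And>t. \<bar>t\<bar> < d \<Longrightarrow> (mat 1 - (t / 2) *\<^sub>R X) ** \<gamma> t = mat 1 + (t / 2) *\<^sub>R X"
  shows "(\<gamma> has_vector_derivative X) (at (0::real))"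
proof -
  have "\<exists>K>0. \<forall>A B. norm ((A :: real^'m^'m) ** (B :: real^'m^'m)) \<le> norm A * norm B * K"
    by (rule bounded_bilinear.pos_bounded[OF bounded_bilinear_matrix_mult])
  then obtain K where K: "0 < K" "\<forall>A B. norm ((A :: real^'m^'m) ** (B :: real^'m^'m)) \<le> norm A * norm B * K" by blast
  \<comment> \<open>Below this bound the norm of (t/2) X D is at most half that of D; the + 1 covers
    X = 0.\<close>
  let ?b = "1 / (K * norm X + 1)"
  have b: "0 < K * norm X + 1" using K by (simp add: add_nonneg_pos)
  have bound: "norm (\<gamma> t - mat 1 - t *\<^sub>R X) \<le> (K * norm X * norm X * \<bar>t\<bar>) * \<bar>t\<bar>" if t: "\<bar>t\<bar> < d" "\<bar>t\<bar> < ?b" for t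
  proof -
    define D where "D = \<gamma> t - mat 1"
    have \<gamma>D: "\<gamma> t = mat 1 + D" by (simp add: D_def)
    have eq: "D - t *\<^sub>R X = (t / 2) *\<^sub>R (X ** D)"
    proof -
      have "mat 1 + D - (t / 2) *\<^sub>R X - (t / 2) *\<^sub>R (X ** D) = mat 1 + (t / 2) *\<^sub>R X"
        using \<gamma>[OF t(1)] by (simp add: \<gamma>D matrix_ring_simps algebra_simps)
      moreover have "t *\<^sub>R X = (t / 2) *\<^sub>R X + (t / 2) *\<^sub>R X" by (simp flip: scaleR_left_distrib)
      ultimately show ?thesis by (simp add: algebra_simps)
    qed
    have n: "norm ((t / 2) *\<^sub>R (X ** D)) \<le> (\<bar>t\<bar> / 2) * (norm X * norm D * K)"
      using K(2)[rule_format, of X D] by (simp add: mult_left_mono)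
    have "\<bar>t\<bar> * (K * norm X) \<le> 1"
    proof -
      have "\<bar>t\<bar> * (K * norm X + 1) < 1" using t(2) b by (simp add: pos_less_divide_eq)
      then show ?thesis by (simp add: algebra_simps)
    qed
    then have "(\<bar>t\<bar> * (K * norm X)) * norm D \<le> 1 * norm D" by (rule mult_right_mono) simp
    then have "norm ((t / 2) *\<^sub>R (X ** D)) \<le> norm D / 2" using n by (simp add: algebra_simps)
    moreover have "norm D \<le> norm (t *\<^sub>R X) + norm ((t / 2) *\<^sub>R (X ** D))"
      unfolding eq[symmetric] by (metis add.commute diff_add_cancel norm_triangle_ineq)
    ultimately have "norm D \<le> 2 * (\<bar>t\<bar> * norm X)" by simp
    then have "(\<bar>t\<bar> / 2) * (norm X * norm D * K) \<le> (\<bar>t\<bar> / 2) * (norm X * (2 * (\<bar>t\<bar> * norm X)) * K)"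
      using K(1) by (intro mult_left_mono mult_right_mono) auto
    then have "norm (D - t *\<^sub>R X) \<le> (\<bar>t\<bar> / 2) * (norm X * (2 * (\<bar>t\<bar> * norm X)) * K)"
      unfolding eq using n by linarith
    then show ?thesis unfolding D_def by (simp add: algebra_simps)
  qed
  show ?thesis
    unfolding has_vector_derivative_def
  proof (rule has_derivativeI_sandwich[where e = "min d ?b" and H = "\<lambda>t. K * norm X * norm X * \<bar>t\<bar>"])
    show "0 < min d ?b" using b \<open>0 < d\<close> by simp
    fix t :: real assume t: "t \<noteq> 0" "dist t 0 < min d ?b"
    then have "norm (\<gamma> t - mat 1 - t *\<^sub>R X) \<le> (K * norm X * norm X * \<bar>t\<bar>) * \<bar>t\<bar>" by (intro bound) auto
    then show "norm (\<gamma> t - \<gamma> 0 - (t - 0) *\<^sub>R X) / norm (t - 0) \<le> K * norm X * norm X * \<bar>t\<bar>"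
      using t(1) by (simp add: \<gamma>0 divide_le_eq)
  next
    have "((\<lambda>t. K * norm X * norm X * \<bar>t\<bar>) \<longlongrightarrow> K * norm X * norm X * \<bar>0\<bar>) (at (0::real))"
      by (intro tendsto_intros)
    then show "((\<lambda>t. K * norm X * norm X * \<bar>t\<bar>) \<longlongrightarrow> 0) (at (0::real))" by simp
  qed (simp add: bounded_linear_scaleR_left)
qed

lemma invertible_perturbation: "\<exists>d>0. \<forall>t. \<bar>t\<bar> < d \<longrightarrow> invertible (mat 1 - (t / 2) *\<^sub>R (X :: real^'m^'m))"
proof -
  have "isCont (\<lambda>t. det (mat 1 - (t / 2) *\<^sub>R X)) 0"
    unfolding det_def by (intro continuous_intros) simp
  then have "((\<lambda>t. det (mat 1 - (t / 2) *\<^sub>R X)) \<longlongrightarrow> 1) (at 0)"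
    by (simp add: isCont_def)
  then have "\<forall>\<^sub>F t in at 0. det (mat 1 - (t / 2) *\<^sub>R X) \<noteq> 0"
    by (rule tendsto_imp_eventually_ne) simp
  then obtain d where \<open>0 < d\<close> and d: "\<And>t. t \<noteq> 0 \<Longrightarrow> dist t 0 < d \<Longrightarrow> det (mat 1 - (t / 2) *\<^sub>R X) \<noteq> 0"
    unfolding eventually_at by auto
  then show ?thesis
    unfolding invertible_det_nz
  proof (intro exI[of _ d] conjI allI impI)
    show "0 < d" by (rule \<open>0 < d\<close>)
    fix t assume "\<bar>t\<bar> < d"
    then show "det (mat 1 - (t / 2) *\<^sub>R X) \<noteq> 0"
      using d[of t] \<open>0 < d\<close> by (cases "t = 0") simp_all
  qed
qed

lemma matrix_inv_commute:
  assumes "invertible M" "M ** B = B ** M"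
  shows "matrix_inv M ** B = B ** matrix_inv (M :: real^'m^'m)"
proof -
  have "matrix_inv M ** B = matrix_inv M ** (B ** (M ** matrix_inv M))"
    using matrix_inv_right[OF assms(1)] by simp
  also have "\<dots> = matrix_inv M ** (M ** B) ** matrix_inv M" unfolding assms(2) by (simp add: matrix_mul_assoc)
  also have "\<dots> = B ** matrix_inv M"
    unfolding matrix_mul_assoc matrix_inv_left[OF assms(1)] by simp
  finally show ?thesis .
qed

section \<open>The Lie algebras of the isometry group and of the stabilizer K\<close>

context hodge_structure begin

lemma isometry_invertible: "(\<And>x y. qform Q (a *v x) (a *v y) = qform Q x y) \<Longrightarrow> invertible (a :: real^'m^'m)"
proof -
  assume a: "\<And>x y. qform Q (a *v x) (a *v y) = qform Q x y"
  have "x = 0" if "a *v x = 0" for x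
    by (rule nondegenerate) (use a[of x] that in \<open>simp add: qform_simps\<close>)
  then show ?thesis unfolding invertible_left_inverse matrix_left_invertible_ker by blast
qed

lemma Aut_iff: "a \<in> Aut Q \<longleftrightarrow> (\<forall>x y. qform Q (a *v x) (a *v y) = qform Q x y)"
  using isometry_invertible unfolding Aut_def by blast

text \<open>The Cayley transform (1 - tX/2)^(-1) (1 + tX/2) preserves Q by pure algebra. It commutes
  with whatever X commutes with, so the same curve serves for the Lie algebra of the
  stabilizer.\<close>

lemma cayley_curve:
  assumes X: "X \<in> so Q"
  obtains \<gamma> :: "real \<Rightarrow> real^'m^'m" where "\<gamma> 0 = mat 1" "\<And>t. \<gamma> t \<in> Aut Q" "(\<gamma> has_vector_derivative X) (at 0)"
    "\<And>B t. X ** B = B ** X \<Longrightarrow> \<gamma> t ** B = B ** \<gamma> t"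
proof -
  let ?M = "\<lambda>t. mat 1 - (t / 2) *\<^sub>R X" and ?N = "\<lambda>t. mat 1 + (t / 2) *\<^sub>R X"
  \<comment> \<open>\<open>lie_algebra\<close> asks for a curve in the group at all real times;
    where the transform is undefined it is set to 1, which does not affect times near 0.\<close>
  define \<gamma> where "\<gamma> t = (if invertible (?M t) then matrix_inv (?M t) ** ?N t else mat 1)" for t
  have MN: "?M t ** ?N t = ?N t ** ?M t" for t
    by (simp add: matrix_ring_simps scaleR_add_right scaleR_diff_right)
  have s: "qform Q (r *\<^sub>R x) y = r * qform Q x y" "qform Q x (r *\<^sub>R y) = r * qform Q x y" for r and x y :: "real^'m"
    by (simp_all add: qform_gram matrix_vector_mult_scaleR)
  obtain d where d: "0 < d" "\<And>t. \<bar>t\<bar> < d \<Longrightarrow> invertible (?M t)" using invertible_perturbation[of X] by blast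
  show ?thesis
  proof (rule that[of \<gamma>])
    show "\<gamma> 0 = mat 1"
      using matrix_inv_left[of "mat 1 :: real^'m^'m"] by (simp add: \<gamma>_def)
    show "\<gamma> t \<in> Aut Q" for t
    proof (cases "invertible (?M t)")
      case True
      have g: "\<gamma> t *v (?M t *v x) = ?N t *v x" for x
      proof -
        have "\<gamma> t ** ?M t = matrix_inv (?M t) ** (?M t ** ?N t)" using True unfolding MN by (simp add: \<gamma>_def matrix_mul_assoc)
        also have "\<dots> = ?N t" unfolding matrix_mul_assoc matrix_inv_left[OF True] by simp
        finally show ?thesis by (simp add: matrix_vector_mul_assoc)
      qed
      have "qform Q (?N t *v x) (?N t *v y) = qform Q (?M t *v x) (?M t *v y)" for x y
      proof -
        have NM: "?N t *v x = x + (t / 2) *\<^sub>R (X *v x)" "?M t *v x = x - (t / 2) *\<^sub>R (X *v x)" for x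
          by (simp_all add: matrix_vector_mult_add_rdistrib matrix_vector_mult_diff_rdistrib scaleR_matrix_vector_assoc)
        have "qform Q (X *v x) y = - qform Q x (X *v y)"
          using X[unfolded so_iff, rule_format, of x y] by simp
        then show ?thesis unfolding NM by (simp add: qform_simps s)
      qed
      then have iso: "qform Q (\<gamma> t *v (?M t *v x)) (\<gamma> t *v (?M t *v y)) = qform Q (?M t *v x) (?M t *v y)" for x y
        unfolding g .
      have inv: "?M t *v (matrix_inv (?M t) *v x) = x" for x
        unfolding matrix_vector_mul_assoc matrix_inv_right[OF True] by simp
      have "qform Q (\<gamma> t *v x) (\<gamma> t *v y) = qform Q x y" for x y
        using iso[of "matrix_inv (?M t) *v x" "matrix_inv (?M t) *v y"] unfolding inv .
      then show ?thesis by (simp add: Aut_iff)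
    next
      case False
      then show ?thesis by (simp add: \<gamma>_def Aut_iff)
    qed
    show "(\<gamma> has_vector_derivative X) (at 0)"
    proof (rule cayley_derivative[OF _ d(1)])
      show "\<gamma> 0 = mat 1" by fact
      show "?M t ** \<gamma> t = ?N t" if "\<bar>t\<bar> < d" for t
        using d(2)[OF that] matrix_inv_right[of "?M t"] by (simp add: \<gamma>_def matrix_mul_assoc)
    qed
    show "\<gamma> t ** B = B ** \<gamma> t" if B: "X ** B = B ** X" for B t
    proof (cases "invertible (?M t)")
      case True
      have M: "?M t ** B = B ** ?M t" and N: "?N t ** B = B ** ?N t" using B by (simp_all add: matrix_ring_simps)
      have "matrix_inv (?M t) ** ?N t ** B = matrix_inv (?M t) ** B ** ?N t"
        unfolding matrix_mul_assoc[symmetric] N ..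
      also have "\<dots> = B ** (matrix_inv (?M t) ** ?N t)"
        unfolding matrix_inv_commute[OF True M] by (simp add: matrix_mul_assoc)
      finally show ?thesis using True by (simp add: \<gamma>_def)
    qed (simp add: \<gamma>_def)
  qed
qed

lemma lie_algebra_Aut: "lie_algebra (Aut Q) = so Q"
proof (intro equalityI subsetI)
  fix X assume "X \<in> lie_algebra (Aut Q)"
  then obtain \<gamma> where \<gamma>: "\<gamma> 0 = mat 1" "\<And>t::real. \<gamma> t \<in> Aut Q" "(\<gamma> has_vector_derivative X) (at 0)"
    by (auto simp: lie_algebra_def)
  have "qform Q (X *v x) y + qform Q x (X *v y) = 0" for x y
    using has_derivative_skew[OF \<gamma>(3)[unfolded has_vector_derivative_def], of Q 1 x y] \<gamma>(1,2) by (simp add: Aut_iff)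
  then show "X \<in> so Q" by (simp add: so_iff)
next
  fix X assume "X \<in> so Q"
  then obtain \<gamma> :: "real \<Rightarrow> real^'m^'m" where "\<gamma> 0 = mat 1" "\<And>t. \<gamma> t \<in> Aut Q" "(\<gamma> has_vector_derivative X) (at 0)"
    by (rule cayley_curve) blast
  then show "X \<in> lie_algebra (Aut Q)" unfolding lie_algebra_def by (intro CollectI exI[of _ \<gamma>]) simp
qed

definition Pplus :: "complex^'m^'m" where "Pplus = cop (\<lambda>r. if even (n - r) then 1 else 0)"

lemma comp_Pplus: "r \<le> n \<Longrightarrow> comp (Pplus *v v) r = (if even (n - r) then comp v r else 0)"
  by (simp add: Pplus_def comp_cop)

lemma H_plus_eq: "H_plus n H = {v. Pplus *v v = v}"
proof (intro equalityI subsetI)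
  fix v assume "v \<in> {v. Pplus *v v = v}"
  then have "v = (\<Sum>r\<le>n. (if even (n - r) then 1 else 0) *s comp v r)" by (simp add: Pplus_def cop_mult)
  also have "\<dots> \<in> H_plus n H"
    unfolding H_plus_def
  proof (intro vec.span_sum)
    fix r assume "r \<in> {..n}"
    then show "(if even (n - r) then 1 else 0) *s comp v r \<in> vec.span (\<Union>r\<in>{r. r \<le> n \<and> even (n - r)}. H r)"
      by (cases "even (n - r)") (auto intro!: vec.span_base vec.span_zero simp: comp_H)
  qed
  finally show "v \<in> H_plus n H" .
next
  fix v assume "v \<in> H_plus n H"
  moreover have "H_plus n H \<subseteq> {v. Pplus *v v = v}"
    unfolding H_plus_def
  proof (rule vec.span_minimal)
    show "vec.subspace {v. Pplus *v v = v}"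
      by (auto simp: vec.subspace_def matrix_vector_right_distrib vector_scalar_commute)
  qed (auto simp: Pplus_def cop_H)
  ultimately show "v \<in> {v. Pplus *v v = v}" by blast
qed

lemma Pplus_Pplus: "Pplus *v (Pplus *v v) = Pplus *v v"
proof -
  have "Pplus ** Pplus = Pplus" unfolding Pplus_def cop_cop by (rule cop_cong) simp
  then show ?thesis by (simp add: matrix_vector_mul_assoc)
qed

lemma weil_weight_parity: "r \<le> n \<Longrightarrow> weil_weight n r = \<i> ^ n * (if even (n - r) then 1 else - 1)"
proof (induction "n - r" arbitrary: r)
  case 0
  then have "r = n" by simp
  then show ?case by (simp add: weil_weight_def)
next
  case (Suc k)
  then have r: "r < n" "k = n - Suc r" by auto
  then have "weil_weight n (Suc r) = \<i> ^ n * (if even (n - Suc r) then 1 else - 1)" using Suc(1) by simp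
  moreover have "n - r = Suc (n - Suc r)" using r by simp
  moreover have "weil_weight n r = - weil_weight n (Suc r)" using weil_weight_simps(4)[of r n] r by simp
  ultimately show ?case by simp
qed

text \<open>C is i^n times the reflection 2 P - 1 for P = \<open>Pplus\<close>, so C and P have the
  same centralizer.\<close>

lemma cmat_Cop_mult: "cmat Cop *v v = \<i> ^ n *s (2 *s (Pplus *v v) - v)"
proof -
  have "cmat Cop = matrix (\<lambda>v. \<i> ^ n *s (2 *s (Pplus *v v) - v))"
  proof (rule matrix_eqI)
    fix a x assume a: "a \<le> n" and x: "x \<in> H a"
    have "matrix (\<lambda>v. \<i> ^ n *s (2 *s (Pplus *v v) - v)) *v x = \<i> ^ n *s (2 *s (Pplus *v x) - x)"
      by (rule matrix_works, unfold_locales)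
         (simp_all add: matrix_vector_right_distrib vector_scalar_commute vec.scale_right_distrib vec.scale_right_diff_distrib vector_smult_assoc algebra_simps)
    then show "cmat Cop *v x = matrix (\<lambda>v. \<i> ^ n *s (2 *s (Pplus *v v) - v)) *v x"
      using a x by (simp add: cmat_Cop Pplus_def cop_H weil_weight_parity vec_eq_iff)
  qed
  moreover have "matrix (\<lambda>v. \<i> ^ n *s (2 *s (Pplus *v v) - v)) *v v = \<i> ^ n *s (2 *s (Pplus *v v) - v)"
    by (rule matrix_works, unfold_locales)
       (simp_all add: matrix_vector_right_distrib vector_scalar_commute vec.scale_right_distrib vec.scale_right_diff_distrib vector_smult_assoc algebra_simps)
  ultimately show ?thesis by simp
qed

text \<open>The pairing of v with the conjugate of u is preserved by real isometries; so an isometry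
  that stabilizes \<open>H_plus\<close> preserves the kernel of \<open>Pplus\<close> too. For the
  backward direction v is tested against its own components.\<close>

lemma H_minus_iff: "Pplus *v v = 0 \<longleftrightarrow> (\<forall>u\<in>H_plus n H. qform Q v (vcnj u) = 0)"
proof
  assume v: "Pplus *v v = 0"
  show "\<forall>u\<in>H_plus n H. qform Q v (vcnj u) = 0"
  proof
    fix u assume "u \<in> H_plus n H"
    then have u: "Pplus *v u = u" by (simp add: H_plus_eq)
    have "qform Q (comp v r) (comp (vcnj u) (n - r)) = 0" if "r \<le> n" for r
    proof (cases "even (n - r)")
      case True
      then have "comp v r = 0" using comp_Pplus[OF that, of v] v comp_simps(2)[of 0 0 r] by simp
      then show ?thesis by (simp add: qform_simps)
    next
      case False
      then have "comp u r = 0" using comp_Pplus[OF that, of u] u by simp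
      then have "comp (vcnj u) (n - r) = 0" using comp_vcnj[of "n - r" u] that by simp
      then show ?thesis by (simp add: qform_simps)
    qed
    then show "qform Q v (vcnj u) = 0" unfolding qform_comp[of v] by simp
  qed
next
  assume *: "\<forall>u\<in>H_plus n H. qform Q v (vcnj u) = 0"
  have "comp v r = 0" if r: "r \<le> n" "even (n - r)" for r
  proof (rule ccontr)
    assume "comp v r \<noteq> 0"
    then obtain t where t: "t > 0" "weil_weight n r * qform Q (comp v r) (vcnj (comp v r)) = complex_of_real t"
      using H_pos[OF r(1) comp_H] by blast
    have "Pplus *v comp v r = comp v r" unfolding Pplus_def using r by (simp add: cop_H comp_H)
    then have "comp v r \<in> H_plus n H" by (simp add: H_plus_eq)
    then have "qform Q v (vcnj (comp v r)) = 0" using * by blast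
    moreover have "qform Q v (vcnj (comp v r)) = (\<Sum>s\<le>n. if s = r then qform Q (comp v r) (vcnj (comp v r)) else 0)"
      unfolding qform_comp[of v]
    proof (intro sum.cong refl)
      fix s assume "s \<in> {..n}"
      then show "qform Q (comp v s) (comp (vcnj (comp v r)) (n - s)) = (if s = r then qform Q (comp v r) (vcnj (comp v r)) else 0)"
        using comp_vcnj[of "n - s" "comp v r"] by (simp add: comp_self[OF comp_H] qform_simps)
    qed
    ultimately show False using t r by simp
  qed
  then show "Pplus *v v = 0"
    unfolding Pplus_def cop_mult by (intro sum.neutral) auto
qed

text \<open>\<open>Cop\<close> and \<open>Pplus\<close> have the same centralizer. An isometry
  stabilizing the image of \<open>Pplus\<close> also stabilizes its kernel by
  \<open>H_minus_iff\<close>, hence commutes with it.\<close>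

lemma stab_K_eq: "stab_K n (Aut Q) H = {a \<in> Aut Q. a ** Cop = Cop ** a}"
proof -
  have "cmul a ` H_plus n H = H_plus n H \<longleftrightarrow> a ** Cop = Cop ** a" if a: "a \<in> Aut Q" for a
  proof
    have inv: "invertible a" using a by (simp add: Aut_def)
    have ai: "cmat a *v (cmat (matrix_inv a) *v v) = v" "cmat (matrix_inv a) *v (cmat a *v v) = v" for v
      by (simp_all add: matrix_vector_mul_assoc matrix_inv_left[OF inv] matrix_inv_right[OF inv] flip: cmat_mult)
    {
      assume C: "a ** Cop = Cop ** a"
      have P: "Pplus *v (cmat b *v v) = cmat b *v (Pplus *v v)" if b: "b ** Cop = Cop ** b" for b v
      proof -
        have "cmat b *v (cmat Cop *v v) = cmat Cop *v (cmat b *v v)"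
          using arg_cong[OF b, of "\<lambda>A. cmat A *v v"] by (simp add: cmat_mult matrix_vector_mul_assoc)
        then have "\<i> ^ n *s (2 *s (cmat b *v (Pplus *v v)) - cmat b *v v) = \<i> ^ n *s (2 *s (Pplus *v (cmat b *v v)) - cmat b *v v)"
          by (simp only: cmat_Cop_mult vector_scalar_commute matrix_vector_mult_diff_distrib)
        then show ?thesis by (simp add: vec_eq_iff)
      qed
      have C': "matrix_inv a ** Cop = Cop ** matrix_inv a" by (rule matrix_inv_commute[OF inv C])
      show "cmul a ` H_plus n H = H_plus n H"
      proof (intro equalityI subsetI)
        fix v assume "v \<in> cmul a ` H_plus n H"
        then show "v \<in> H_plus n H" using P[OF C] by (auto simp: cmul_eq H_plus_eq)
      next
        fix v assume "v \<in> H_plus n H"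
        then have "cmat (matrix_inv a) *v v \<in> H_plus n H" using P[OF C'] by (simp add: H_plus_eq)
        then show "v \<in> cmul a ` H_plus n H" using ai(1)[of v] unfolding cmul_eq by (metis image_eqI)
      qed
    }
    {
      assume HP: "cmul a ` H_plus n H = H_plus n H"
      have Q: "qform Q (cmat a *v x) (cmat a *v y) = qform Q x y" for x y
      proof -
        obtain x1 x2 y1 y2 where xy: "x = cvec x1 + \<i> *s cvec x2" "y = cvec y1 + \<i> *s cvec y2"
          using cvec_decompose by metis
        have "qform Q (a *v x) (a *v y) = qform Q x y" for x y :: "real^'m" using a by (simp add: Aut_iff)
        then show ?thesis
          by (simp add: xy matrix_vector_right_distrib vector_scalar_commute cmat_cvec qform_simps qform_cvec)
      qed
      have minus: "Pplus *v (cmat a *v v) = 0" if "Pplus *v v = 0" for v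
        unfolding H_minus_iff
      proof
        fix u assume "u \<in> H_plus n H"
        then obtain u' where u': "u' \<in> H_plus n H" "u = cmat a *v u'" using HP by (auto simp: cmul_eq)
        have "qform Q (cmat a *v v) (vcnj u) = qform Q v (vcnj u')" by (simp add: u' vcnj_mult Q)
        then show "qform Q (cmat a *v v) (vcnj u) = 0" using that u'(1) by (simp add: H_minus_iff)
      qed
      have P: "Pplus *v (cmat a *v v) = cmat a *v (Pplus *v v)" for v
      proof -
        have "Pplus *v v \<in> H_plus n H" by (simp add: H_plus_eq Pplus_Pplus)
        then have "cmat a *v (Pplus *v v) \<in> H_plus n H" using HP unfolding cmul_eq by blast
        then have "Pplus *v (cmat a *v (Pplus *v v)) = cmat a *v (Pplus *v v)" by (simp add: H_plus_eq)
        moreover have "Pplus *v (cmat a *v (v - Pplus *v v)) = 0"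
          by (rule minus) (simp add: matrix_vector_mult_diff_distrib Pplus_Pplus)
        ultimately show ?thesis by (simp add: matrix_vector_mult_diff_distrib)
      qed
      have "cmat a *v (cmat Cop *v v) = cmat Cop *v (cmat a *v v)" for v
        by (simp add: cmat_Cop_mult vector_scalar_commute matrix_vector_mult_diff_distrib P)
      then have "cmat (a ** Cop) = cmat (Cop ** a)"
        unfolding cmat_mult by (simp add: matrix_eq flip: matrix_vector_mul_assoc)
      then show "a ** Cop = Cop ** a" by (rule cmat_simps(6)[THEN iffD1])
    }
  qed
  then show ?thesis unfolding stab_K_def by blast
qed

lemma f_part_eq: "f_part n Q H = {X \<in> so Q. X ** Cop = Cop ** X}"
  unfolding f_part_def stab_K_eq
proof (intro equalityI subsetI)
  fix X assume "X \<in> lie_algebra {a \<in> Aut Q. a ** Cop = Cop ** a}"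
  then obtain \<gamma> where \<gamma>: "\<gamma> 0 = mat 1" "\<And>t::real. \<gamma> t \<in> Aut Q" "\<And>t. \<gamma> t ** Cop = Cop ** \<gamma> t"
      "(\<gamma> has_vector_derivative X) (at 0)"
    by (auto simp: lie_algebra_def)
  then have X: "X \<in> so Q" unfolding lie_algebra_Aut[symmetric] lie_algebra_def by blast
  note d = bounded_bilinear.FDERIV[OF bounded_bilinear_matrix_mult]
  have "((\<lambda>t. \<gamma> t ** Cop) has_derivative (\<lambda>h. \<gamma> 0 ** 0 + (h *\<^sub>R X) ** Cop)) (at 0)"
    by (rule d[OF \<gamma>(4)[unfolded has_vector_derivative_def] has_derivative_const])
  moreover have "((\<lambda>t. Cop ** \<gamma> t) has_derivative (\<lambda>h. Cop ** (h *\<^sub>R X) + 0 ** \<gamma> 0)) (at 0)"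
    by (rule d[OF has_derivative_const \<gamma>(4)[unfolded has_vector_derivative_def]])
  ultimately have "(\<lambda>h. \<gamma> 0 ** 0 + (h *\<^sub>R X) ** Cop) = (\<lambda>h. Cop ** (h *\<^sub>R X) + 0 ** \<gamma> 0)"
    unfolding \<gamma>(3) by (rule has_derivative_unique)
  from fun_cong[OF this, of 1] X show "X \<in> {X \<in> so Q. X ** Cop = Cop ** X}"
    by (simp add: matrix_mult_zero_left matrix_mult_zero_right)
next
  fix X assume X: "X \<in> {X \<in> so Q. X ** Cop = Cop ** X}"
  then have "X \<in> so Q" by simp
  then obtain \<gamma> :: "real \<Rightarrow> real^'m^'m" where \<gamma>: "\<gamma> 0 = mat 1" "\<And>t. \<gamma> t \<in> Aut Q" "(\<gamma> has_vector_derivative X) (at 0)"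
    "\<And>B t. X ** B = B ** X \<Longrightarrow> \<gamma> t ** B = B ** \<gamma> t"
    by (rule cayley_curve) blast
  show "X \<in> lie_algebra {a \<in> Aut Q. a ** Cop = Cop ** a}"
    unfolding lie_algebra_def using \<gamma>(1-3) \<gamma>(4)[of Cop] X by (intro CollectI exI[of _ \<gamma>]) simp
qed

end

section \<open>The Killing form as a multiple of the trace form, and the Cartan
  decomposition\<close>

lemma sum_Basis_matrix:
  fixes f :: "real^'m^'n \<Rightarrow> real"
  shows "(\<Sum>e\<in>Basis. f e) = (\<Sum>i\<in>UNIV. \<Sum>j\<in>UNIV. f (axis i (axis j 1)))"
proof -
  have B: "(Basis :: (real^'m^'n) set) = (\<lambda>(i, j). axis i (axis j 1)) ` (UNIV \<times> UNIV)"
    by (auto simp: Basis_vec_def image_iff)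
  have inj: "inj (\<lambda>(i, j). axis i (axis j (1::real)) :: real^'m^'n)"
    by (auto simp: inj_on_def axis_eq_axis)
  show ?thesis
    unfolding B by (subst sum.reindex[OF inj_on_subset[OF inj]]) (auto simp: sum.cartesian_product case_prod_unfold)
qed

lemma unit_matrix_mult: "(A ** axis i (axis j (1::real)) ** B) $ k $ l = A $ k $ i * B $ j $ l"
proof -
  have "(A ** axis i (axis j (1::real))) $ k $ c = (if c = j then A $ k $ i else 0)" for c
  proof -
    have "A $ k $ k' * axis i (axis j (1::real)) $ k' $ c = (if k' = i then if c = j then A $ k $ i else 0 else 0)" for k'
      by (simp add: axis_def)
    then show ?thesis by (simp add: matrix_matrix_mult_def)
  qed
  then have "(A ** axis i (axis j (1::real))) $ k $ c * B $ c $ l = (if c = j then A $ k $ i * B $ j $ l else 0)" for c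
    by simp
  then show ?thesis unfolding matrix_matrix_mult_def[of "A ** _" B] by simp
qed

lemma trace_left_right:
  fixes A B :: "real^'m^'m"
  shows "(\<Sum>e\<in>Basis. (A ** e ** B) \<bullet> e) = trace A * trace B"
proof -
  have "(\<Sum>e\<in>Basis. (A ** e ** B) \<bullet> e) = (\<Sum>i\<in>UNIV. \<Sum>j\<in>UNIV. A $ i $ i * B $ j $ j)"
    unfolding sum_Basis_matrix by (intro sum.cong refl) (simp add: inner_axis unit_matrix_mult)
  also have "\<dots> = trace A * trace B"
    by (simp add: trace_def sum_product)
  finally show ?thesis .
qed

lemma trace_left_right_transpose:
  fixes A B :: "real^'m^'m"
  shows "(\<Sum>e\<in>Basis. (A ** transpose e ** B) \<bullet> e) = trace (transpose A ** B)"
proof -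
  have "transpose (axis i (axis j (1::real)) :: real^'m^'m) = axis j (axis i 1)" for i j
    by (simp add: transpose_def axis_def vec_eq_iff)
  then have "(\<Sum>e\<in>Basis. (A ** transpose e ** B) \<bullet> e) = (\<Sum>i\<in>UNIV. \<Sum>j\<in>UNIV. A $ i $ j * B $ i $ j)"
    unfolding sum_Basis_matrix by (intro sum.cong refl) (simp add: inner_axis unit_matrix_mult)
  also have "\<dots> = (\<Sum>j\<in>UNIV. \<Sum>i\<in>UNIV. A $ i $ j * B $ i $ j)" by (rule sum.swap)
  also have "\<dots> = trace (transpose A ** B)"
    by (simp add: trace_def matrix_matrix_mult_def transpose_def)
  finally show ?thesis .
qed

lemma trace_transpose: "trace (transpose A) = trace (A :: 'a::comm_semiring_1^'m^'m)"
  by (simp add: trace_def transpose_def)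

context hodge_structure begin

abbreviation q :: "real^'m^'m" where "q \<equiv> gram Q"
abbreviation qi :: "real^'m^'m" where "qi \<equiv> matrix_inv (gram Q)"

lemma transpose_q: "transpose q = (-1) ^ n *\<^sub>R q"
proof -
  have "transpose q $ i $ j = ((-1) ^ n *\<^sub>R q) $ i $ j" for i j
    using arg_cong[OF polarization_form_sym[OF pol, of j i], of real_of_int] by (simp add: transpose_def gram_def)
  then show ?thesis by (simp add: vec_eq_iff)
qed

lemma q_invertible: "invertible q"
proof -
  have "x = 0" if "q *v x = 0" for x
  proof (rule nondegenerate)
    show "qform Q x y = 0" for y
      using qform_sym[OF pol, of x y] that by (simp add: qform_gram)
  qed
  then show ?thesis unfolding invertible_left_inverse matrix_left_invertible_ker by blast
qed

lemma q_inv: "q ** qi = mat 1" "qi ** q = mat 1"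
  using matrix_inv_left matrix_inv_right q_invertible by auto

lemma transpose_qi: "transpose qi = (-1) ^ n *\<^sub>R qi"
proof -
  have "transpose q ** transpose qi = mat 1" by (simp add: matrix_transpose_mul[symmetric] q_inv transpose_mat)
  then have "qi ** ((-1) ^ n *\<^sub>R q ** transpose qi) = qi ** mat 1" unfolding transpose_q by simp
  then have "(-1) ^ n *\<^sub>R (qi ** q ** transpose qi) = qi" by (simp add: matrix_ring_simps)
  then have "(-1) ^ n *\<^sub>R transpose qi = qi" by (simp add: q_inv)
  then have "(-1) ^ n *\<^sub>R ((-1) ^ n *\<^sub>R transpose qi) = (-1) ^ n *\<^sub>R qi" by simp
  then show ?thesis by (simp flip: power_mult_distrib)
qed

text \<open>The adjoint with respect to Q: an involution with \<open>so Q\<close> as its eigenspace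
  for -1, and with \<open>adj a ** a = mat 1\<close> exactly for isometries.\<close>

definition adj :: "real^'m^'m \<Rightarrow> real^'m^'m" where "adj Z = qi ** transpose Z ** q"

lemma transpose_so: "X \<in> so Q \<Longrightarrow> transpose X ** q = - (q ** X)"
  by (simp add: so_def skew_op_def eq_neg_iff_add_eq_0)

lemma so_adj: "X \<in> so Q \<longleftrightarrow> adj X = - X"
proof
  assume "X \<in> so Q"
  then show "adj X = - X"
    unfolding adj_def matrix_mul_assoc[symmetric] transpose_so[OF \<open>X \<in> so Q\<close>]
    by (simp add: matrix_mult_minus_right) (simp add: matrix_mul_assoc q_inv)
next
  assume "adj X = - X"
  then have "q ** adj X = - (q ** X)" by (simp add: matrix_mult_minus_right)
  then have "transpose X ** q = - (q ** X)"
    by (simp add: adj_def) (simp add: matrix_mul_assoc q_inv)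
  then show "X \<in> so Q" by (simp add: so_def skew_op_def)
qed

lemma linear_adj: "linear adj"
  by (rule linearI) (simp_all add: adj_def transpose_simps matrix_ring_simps)

lemma adj_adj: "adj (adj Z) = Z"
proof -
  have "adj (adj Z) = qi ** (transpose q ** Z ** transpose qi) ** q"
    by (simp add: adj_def matrix_transpose_mul matrix_mul_assoc)
  also have "\<dots> = ((-1) ^ n * (-1) ^ n) *\<^sub>R (qi ** q ** Z ** (qi ** q))"
    unfolding transpose_q transpose_qi by (simp add: matrix_ring_simps)
  finally show ?thesis by (simp add: q_inv flip: power_mult_distrib)
qed

lemma trace_so: "X \<in> so Q \<Longrightarrow> trace X = 0"
proof -
  assume X: "X \<in> so Q"
  have "trace (adj X) = trace (transpose X ** q ** qi)"
    unfolding adj_def using trace_mul_sym[of qi "transpose X ** q"] by (simp add: matrix_mul_assoc)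
  also have "\<dots> = trace X" by (simp add: q_inv trace_transpose flip: matrix_mul_assoc)
  finally show ?thesis using X by (simp add: so_adj trace_minus)
qed

lemma trace_adj:
  "(\<Sum>e\<in>Basis. (A ** adj e ** B) \<bullet> e) = (-1) ^ n * trace (qi ** transpose A ** q ** B)"
proof -
  have "(\<Sum>e\<in>Basis. (A ** adj e ** B) \<bullet> e) = (\<Sum>e\<in>Basis. ((A ** qi) ** transpose e ** (q ** B)) \<bullet> e)"
    by (simp add: adj_def matrix_mul_assoc)
  also have "\<dots> = trace (transpose qi ** transpose A ** (q ** B))"
    unfolding trace_left_right_transpose by (simp add: matrix_transpose_mul)
  finally show ?thesis unfolding transpose_qi by (simp add: matrix_ring_simps trace_scaleR)
qed

text \<open>
  The projection of all matrices onto \<open>so Q\<close> is \<open>Z \<mapsto> (Z - adj Z)/2\<close>; the two halves contribute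
  \<open>CARD('m)\<close> and \<open>- 2 (-1)\<^sup>n\<close>.  The factor can vanish or be negative only for \<open>n\<close> even and
  \<open>CARD('m) \<le> 2\<close>, when \<open>so Q\<close> is abelian and horizontal slices of positive dimension do not exist.
\<close>

definition killing_factor :: real where "killing_factor = real CARD('m) - 2 * (-1) ^ n"

lemma killing_so:
  assumes X: "X \<in> so Q" and Y: "Y \<in> so Q"
  shows "killing (so Q) X Y = killing_factor * trace_form X Y"
proof -
  let ?f = "\<lambda>Z. comm X (comm Y Z)" and ?P = "\<lambda>Z. (1/2) *\<^sub>R (Z - adj Z)"
  note aX = X[unfolded so_adj] and aY = Y[unfolded so_adj]
  have lin: "adj (U + V) = adj U + adj V" "adj (U - V) = adj U - adj V" "adj (r *\<^sub>R U) = r *\<^sub>R adj U" for U V r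
    using linear_adj by (simp_all add: linear_add linear_diff linear_cmul)
  have f: "?f Z = X ** Y ** Z ** mat 1 - X ** Z ** Y - Y ** Z ** X + mat 1 ** Z ** (Y ** X)" for Z
    unfolding comm_def by (simp add: matrix_ring_simps)
  have XA: "qi ** transpose X ** q = - X" and YA: "qi ** transpose Y ** q = - Y" using aX aY by (simp_all add: adj_def)
  have XYA: "qi ** transpose (X ** Y) ** q = Y ** X"
  proof -
    have "qi ** transpose (X ** Y) ** q = (qi ** transpose Y ** q) ** (qi ** transpose X ** q)"
      by (simp add: matrix_transpose_mul matrix_mul_assoc[symmetric]) (simp add: matrix_mul_assoc q_inv)
    then show ?thesis unfolding XA YA by (simp add: matrix_ring_simps)
  qed
  have t: "trace (Y ** X) = trace_form X Y" "trace (X ** Y) = trace_form X Y"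
    unfolding trace_form_def by (rule trace_mul_sym) simp
  \<comment> \<open>Of the four terms of the double commutator the middle two vanish, as elements of
    \<open>so Q\<close> are traceless; each outer one gives the matrix size times tr(XY).\<close>
  have 1: "(\<Sum>e\<in>Basis. ?f e \<bullet> e) = 2 * real CARD('m) * trace_form X Y"
    unfolding f inner_add_left inner_diff_left sum.distrib sum_subtractf trace_left_right
    by (simp add: trace_so[OF X] trace_so[OF Y] trace_I t)
  \<comment> \<open>With \<open>adj\<close> inserted each of the four terms gives (-1)^n tr(XY); in
    the middle ones adj X = - X and adj Y = - Y absorb the minus signs.\<close>
  have 2: "(\<Sum>e\<in>Basis. ?f (adj e) \<bullet> e) = 4 * (-1) ^ n * trace_form X Y"
    unfolding f inner_add_left inner_diff_left sum.distrib sum_subtractf trace_adj XYA XA YA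
    by (simp add: matrix_ring_simps trace_minus t q_inv transpose_mat)
  have "killing (so Q) X Y = (\<Sum>e\<in>Basis. ?f (?P e) \<bullet> e)"
    unfolding killing_def
  proof (rule trace_on_eq)
    show "subspace (so Q)"
      using linear_0[OF linear_skew_op, of Q] by (simp add: subspace_def so_simps) (simp add: so_def)
    show "linear ?f" by (rule linearI) simp_all
    show "?f x \<in> so Q" if "x \<in> so Q" for x using comm_so X Y that by blast
    show "linear ?P" by (rule linearI) (simp_all add: lin algebra_simps)
    show "?P x \<in> so Q" for x by (simp add: so_adj lin adj_adj) (simp add: scaleR_diff_right)
    show "?P x = x" if "x \<in> so Q" for x using that by (simp add: so_adj scaleR_2[symmetric])
  qed
  also have "\<dots> = (1/2) * (\<Sum>e\<in>Basis. ?f e \<bullet> e) - (1/2) * (\<Sum>e\<in>Basis. ?f (adj e) \<bullet> e)"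
    by (simp add: inner_diff_left sum_subtractf sum_distrib_left right_diff_distrib)
  also have "\<dots> = killing_factor * trace_form X Y"
    unfolding 1 2 killing_factor_def by (simp add: algebra_simps)
  finally show ?thesis .
qed

text \<open>For even n the matrix q is symmetric, so q ** Z is antisymmetric for Z in
  \<open>so Q\<close>; in size at most 2 such matrices form at most a line.\<close>

lemma so_abelian:
  assumes N: "CARD('m) \<le> 2" and n: "even n" and X: "X \<in> so Q" and Y: "Y \<in> so Q"
  shows "comm X Y = 0"
proof -
  \<comment> \<open>i = j is allowed and covers size 1, where K is 0.\<close>
  obtain i j :: 'm where U: "UNIV = {i, j}"
  proof -
    have "CARD('m) = 1 \<or> CARD('m) = 2" using N zero_less_card_finite[where 'a='m] by linarith
    then show ?thesis
    proof
      assume "CARD('m) = 1"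
      then obtain i :: 'm where "UNIV = {i}" using card_1_singletonE by blast
      then show ?thesis using that[of i i] by simp
    next
      assume "CARD('m) = 2"
      then show ?thesis using card_2_iff[of "UNIV :: 'm set"] that by blast
    qed
  qed
  define K :: "real^'m^'m" where "K = (\<chi> a b. if i = j then 0 else if a = i \<and> b = j then 1 else if a = j \<and> b = i then - 1 else 0)"
  have ex: "\<exists>s. Z = s *\<^sub>R (qi ** K)" if Z: "Z \<in> so Q" for Z
  proof -
    let ?S = "q ** Z"
    have tS: "transpose ?S = - ?S"
      using transpose_so[OF Z] n by (simp add: matrix_transpose_mul transpose_q)
    have sk: "?S $ a $ b = - ?S $ b $ a" for a b
      using arg_cong[OF tS, of "\<lambda>M. M $ b $ a"] unfolding transpose_def by simp
    have S0: "?S $ a $ a = 0" for a using sk[of a a] by linarith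
    have "?S $ a $ b = (?S $ i $ j *\<^sub>R K) $ a $ b" for a b
    proof -
      have "a = i \<or> a = j" "b = i \<or> b = j" using U by blast+
      then consider "a = b" | "a = i" "b = j" "i \<noteq> j" | "a = j" "b = i" "i \<noteq> j" by blast
      then show ?thesis
      proof cases
        case 1
        moreover have "K $ a $ a = 0" unfolding K_def by auto
        ultimately show ?thesis using S0[of a] by simp
      next
        case 2
        moreover from this have "K $ i $ j = 1" unfolding K_def by simp
        ultimately show ?thesis by simp
      next
        case 3
        moreover from this have "K $ j $ i = - 1" unfolding K_def by simp
        ultimately show ?thesis using sk[of j i] by simp
      qed
    qed
    then have S: "?S = ?S $ i $ j *\<^sub>R K" unfolding vec_eq_iff by blast
    define r where "r = ?S $ i $ j"
    have "qi ** ?S = qi ** (r *\<^sub>R K)" unfolding r_def by (rule arg_cong[OF S])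
    then have "Z = r *\<^sub>R (qi ** K)" unfolding matrix_mul_assoc q_inv matrix_mult_scaleR_right by simp
    then show ?thesis by blast
  qed
  obtain s where s: "X = s *\<^sub>R (qi ** K)" using ex[OF X] ..
  obtain t where t: "Y = t *\<^sub>R (qi ** K)" using ex[OF Y] ..
  show ?thesis unfolding s t by simp
qed

lemma killing_factor_pos:
  assumes "X \<in> so Q" "Y \<in> so Q" "comm X Y \<noteq> 0"
  shows "0 < killing_factor"
proof (cases "even n")
  case True
  then have "CARD('m) > 2" using so_abelian assms by (meson not_le)
  then show ?thesis using True by (simp add: killing_factor_def)
next
  case False
  then show ?thesis by (simp add: killing_factor_def)
qed

text \<open>The eigenspaces of conjugation by C, an involution of \<open>so Q\<close> because C
  preserves Q and C ** C is a scalar sign.\<close>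

lemma even_part_decompose:
  assumes X: "X \<in> so Q"
  shows "\<exists>F P. X = F + P \<and> F \<in> so Q \<and> P \<in> so Q \<and> Cop ** F = F ** Cop \<and> Cop ** P = - (P ** Cop)"
proof -
  let ?Ci = "(-1) ^ n *\<^sub>R Cop"
  define X' where "X' = Cop ** X ** ?Ci"
  have CC: "Cop ** ?Ci = mat 1" "?Ci ** Cop = mat 1"
    by (simp_all add: matrix_ring_simps Cop_Cop flip: power_mult_distrib)
  have X': "X' \<in> so Q"
    unfolding so_iff X'_def
  proof (intro allI)
    fix x y
    let ?X' = "Cop ** X ** ?Ci"
    have "qform Q (?X' *v x) y = qform Q (Cop *v (X *v (?Ci *v x))) (Cop *v (?Ci *v y))"
      by (simp only: matrix_vector_mul_assoc CC matrix_mul_assoc matrix_vector_mul_lid)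
    also have "\<dots> = qform Q (X *v (?Ci *v x)) (?Ci *v y)" by (rule qform_Cop_real)
    also have "\<dots> = - qform Q (?Ci *v x) (X *v (?Ci *v y))"
      using X[unfolded so_iff, rule_format, of "?Ci *v x" "?Ci *v y"] by simp
    also have "\<dots> = - qform Q (Cop *v (?Ci *v x)) (Cop *v (X *v (?Ci *v y)))" by (simp only: qform_Cop_real)
    also have "\<dots> = - qform Q x (?X' *v y)"
      by (simp only: matrix_vector_mul_assoc CC matrix_mul_assoc matrix_vector_mul_lid)
    finally show "qform Q (?X' *v x) y + qform Q x (?X' *v y) = 0" by simp
  qed
  have C: "Cop ** X' = X ** Cop" "X' ** Cop = Cop ** X"
  proof -
    have "Cop ** X' = (-1) ^ n *\<^sub>R ((Cop ** Cop) ** X ** Cop)" by (simp add: X'_def matrix_ring_simps)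
    then show "Cop ** X' = X ** Cop" by (simp add: Cop_Cop matrix_ring_simps flip: power_mult_distrib)
    show "X' ** Cop = Cop ** X" unfolding X'_def matrix_mul_assoc[symmetric] CC by simp
  qed
  let ?F = "(1/2) *\<^sub>R (X + X')" and ?P = "(1/2) *\<^sub>R (X - X')"
  have "X = ?F + ?P" by (simp add: algebra_simps flip: scaleR_2 scaleR_left_distrib)
  moreover have "?F \<in> so Q" "?P \<in> so Q" using X X' so_simps by blast+
  moreover have "Cop ** ?F = ?F ** Cop" "Cop ** ?P = - (?P ** Cop)"
    unfolding matrix_mult_scaleR_right matrix_mult_scaleR_left matrix_add_ldistrib matrix_add_rdistrib
      matrix_mult_diff_left matrix_mult_diff_right C by (simp_all add: algebra_simps)
  ultimately show ?thesis by blast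
qed

lemma trace_form_even_odd:
  assumes X: "Cop ** X = X ** Cop" and Z: "Cop ** Z = - (Z ** Cop)"
  shows "trace_form X Z = 0"
proof -
  have "Cop ** (X ** Z) = (X ** Cop) ** Z" unfolding matrix_mul_assoc X ..
  also have "\<dots> = X ** (- (Z ** Cop))" unfolding matrix_mul_assoc[symmetric] Z ..
  finally have "Cop ** (X ** Z) = - ((X ** Z) ** Cop)" by (simp add: matrix_ring_simps)
  then have "trace ((Cop ** (X ** Z)) ** matrix_inv Cop) = - trace ((X ** Z) ** (Cop ** matrix_inv Cop))"
    by (simp add: matrix_ring_simps trace_minus)
  moreover have "trace ((Cop ** (X ** Z)) ** matrix_inv Cop) = trace (X ** Z)"
    using trace_mul_sym[of "Cop ** (X ** Z)" "matrix_inv Cop"]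
    by (simp add: matrix_mul_assoc matrix_inv_left Cop_invertible)
  ultimately show ?thesis by (simp add: trace_form_def matrix_inv_right Cop_invertible)
qed

text \<open>\<open>trace_form_even\<close> becomes strict when the orthonormal basis contains a
  vector not killed by X.\<close>

lemma trace_form_even_definite:
  assumes X: "X \<in> so Q" and C: "Cop ** X = X ** Cop" and 0: "trace_form X X = 0"
  shows "X = 0"
proof -
  interpret inner_form bform by (rule inner_form_bform)
  have sk: "bform (X *v x) y = - bform x (X *v y)" for x y
    using X[unfolded so_iff, rule_format, of "Cop *v x" y] arg_cong[OF C, of "\<lambda>A. A *v x"]
    by (simp add: bform_def add_eq_0_iff matrix_vector_mul_assoc)
  show ?thesis
  proof (rule ccontr)
    assume "X \<noteq> 0"
    then obtain u where u: "X *v u \<noteq> 0" by (metis matrix_eq matrix_vector_mult_0)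
    then have "u \<noteq> 0" by auto
    define u0 where "u0 = (1 / sqrt (bform u u)) *\<^sub>R u"
    have b1: "bform u0 u0 = 1" using pos[OF \<open>u \<noteq> 0\<close>] by (simp add: u0_def simps)
    have Xu0: "X *v u0 \<noteq> 0" using u pos[OF \<open>u \<noteq> 0\<close>] by (simp add: u0_def matrix_vector_mult_scaleR)
    obtain B where B: "orthonormal B" "u0 \<in> B" "span B = UNIV" using orthonormal_basis[OF b1] by blast
    have "trace_form X X = - (\<Sum>e\<in>B. bform (X *v e) (X *v e))"
      unfolding trace_form_orthonormal[OF B(1,3)] sk by (simp add: sum_negf)
    moreover have "0 \<le> bform z z" for z using pos[of z] by (cases "z = 0") (auto simp: simps)
    then have "0 < (\<Sum>e\<in>B. bform (X *v e) (X *v e))"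
      using pos[OF Xu0] B by (intro sum_pos2[of _ u0]) (auto simp: orthonormal_def)
    ultimately show False using 0 by simp
  qed
qed

text \<open>Orthogonality for the Killing form is orthogonality for the trace form. The even
  component F of an X orthogonal to the even part has tr F^2 = 0, hence vanishes.\<close>

lemma p_part_eq:
  assumes "killing_factor \<noteq> 0"
  shows "p_part n Q H = {X \<in> so Q. Cop ** X = - (X ** Cop)}"
  unfolding p_part_def lie_algebra_Aut f_part_eq
proof (intro equalityI subsetI)
  fix X assume "X \<in> {X \<in> so Q. \<forall>Y\<in>{X \<in> so Q. X ** Cop = Cop ** X}. killing (so Q) X Y = 0}"
  then have X: "X \<in> so Q" and orth: "\<And>Y. Y \<in> so Q \<Longrightarrow> Y ** Cop = Cop ** Y \<Longrightarrow> killing (so Q) X Y = 0" by auto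
  obtain F P where FP: "X = F + P" "F \<in> so Q" "P \<in> so Q" "Cop ** F = F ** Cop" "Cop ** P = - (P ** Cop)"
    using even_part_decompose[OF X] by blast
  have "trace_form X F = 0"
    using orth[OF FP(2)] FP(4) killing_so[OF X FP(2)] assms by simp
  then have "trace_form F F = 0"
    using trace_form_even_odd[OF FP(4,5)] by (simp add: FP(1) trace_form_commute[of P])
  then have "F = 0" using trace_form_even_definite FP by blast
  then show "X \<in> {X \<in> so Q. Cop ** X = - (X ** Cop)}" using FP by simp
next
  fix X assume "X \<in> {X \<in> so Q. Cop ** X = - (X ** Cop)}"
  then show "X \<in> {X \<in> so Q. \<forall>Y\<in>{X \<in> so Q. X ** Cop = Cop ** X}. killing (so Q) X Y = 0}"
    using killing_so trace_form_even_odd by (auto simp: trace_form_commute[of X])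
qed

text \<open>Two candidates differ by an element that commutes and anticommutes with C; its square
  has trace 0 and definiteness kills it.\<close>

lemma p_proj_eqI:
  assumes "killing_factor \<noteq> 0" "P \<in> so Q" "Cop ** P = - (P ** Cop)" "X - P \<in> so Q" "(X - P) ** Cop = Cop ** (X - P)"
  shows "p_proj n Q H X = P"
  unfolding p_proj_def p_part_eq[OF assms(1)] f_part_eq
proof (rule the_equality)
  show "P \<in> {X \<in> so Q. Cop ** X = - (X ** Cop)} \<and> X - P \<in> {X \<in> so Q. X ** Cop = Cop ** X}" using assms by simp
  fix P' assume P': "P' \<in> {X \<in> so Q. Cop ** X = - (X ** Cop)} \<and> X - P' \<in> {X \<in> so Q. X ** Cop = Cop ** X}"
  let ?D = "P' - P"
  have odd: "Cop ** ?D = - (?D ** Cop)" using P' assms by (simp add: matrix_ring_simps)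
  have "?D = (X - P) - (X - P')" by simp
  moreover have "(X - P') ** Cop = Cop ** (X - P')" using P' by simp
  then have "Cop ** ((X - P) - (X - P')) = ((X - P) - (X - P')) ** Cop"
    by (simp only: matrix_mult_diff_left[of "X - P" "X - P'"] matrix_mult_diff_right[of Cop "X - P" "X - P'"] assms(5))
  ultimately have even: "Cop ** ?D = ?D ** Cop" by simp
  have "?D \<in> so Q" using P' assms so_simps by blast
  moreover have "trace_form ?D ?D = 0" by (rule trace_form_even_odd[OF even odd])
  ultimately have "?D = 0" using trace_form_even_definite even by blast
  then show "P' = P" by simp
qed

end

section \<open>Horizontal slices\<close>

lemma complex_differentiable_on_const: "complex_differentiable_on W (\<lambda>w. c)"
  unfolding complex_differentiable_on_def by (auto intro!: exI[where x = "\<lambda>_. 0"])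

lemma complex_differentiable_on_add:
  assumes "complex_differentiable_on W f" "complex_differentiable_on W g"
  shows "complex_differentiable_on W (\<lambda>w. f w + g w)"
  unfolding complex_differentiable_on_def
proof
  fix w assume "w \<in> W"
  then obtain f' g' where "(f has_derivative f') (at w)" "\<forall>c v. f' (c *s v) = c * f' v"
      "(g has_derivative g') (at w)" "\<forall>c v. g' (c *s v) = c * g' v"
    using assms unfolding complex_differentiable_on_def by metis
  then show "\<exists>s'. ((\<lambda>w. f w + g w) has_derivative s') (at w) \<and> (\<forall>c v. s' (c *s v) = c * s' v)"
    by (intro exI[of _ "\<lambda>v. f' v + g' v"]) (auto intro: has_derivative_add simp: distrib_left)
qed

lemma complex_differentiable_on_cmult:
  assumes "complex_differentiable_on W f"
  shows "complex_differentiable_on W (\<lambda>w. a * f w)"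
  unfolding complex_differentiable_on_def
proof
  fix w assume "w \<in> W"
  then obtain f' where "(f has_derivative f') (at w)" "\<forall>c v. f' (c *s v) = c * f' v"
    using assms unfolding complex_differentiable_on_def by metis
  then show "\<exists>s'. ((\<lambda>w. a * f w) has_derivative s') (at w) \<and> (\<forall>c v. s' (c *s v) = c * s' v)"
    by (intro exI[of _ "\<lambda>v. a * f' v"]) (auto intro: has_derivative_mult_right)
qed

lemma complex_differentiable_on_sum:
  "(\<And>i. i \<in> I \<Longrightarrow> complex_differentiable_on W (f i)) \<Longrightarrow> complex_differentiable_on W (\<lambda>w. \<Sum>i\<in>I. f i w)"
  by (induction I rule: infinite_finite_induct)
     (auto intro: complex_differentiable_on_const complex_differentiable_on_add)

lemma holo_on_component:
  fixes s :: "complex^'k \<Rightarrow> complex^'m"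
  assumes "holo_on W s"
  shows "complex_differentiable_on W (\<lambda>w. s w $ i)"
  unfolding complex_differentiable_on_def
proof
  fix w assume "w \<in> W"
  then obtain s' where "(s has_derivative s') (at w)" "\<forall>c v. s' (c *s v) = c *s s' v"
    using assms unfolding holo_on_def by metis
  then show "\<exists>s'. ((\<lambda>w. s w $ i) has_derivative s') (at w) \<and> (\<forall>c v. s' (c *s v) = c * s' v)"
    by (intro exI[of _ "\<lambda>v. s' v $ i"]) (auto intro: bounded_linear.has_derivative[OF bounded_linear_vec_nth])
qed

lemma holo_on_componentI:
  fixes s :: "complex^'k \<Rightarrow> complex^'m"
  assumes "\<And>i. complex_differentiable_on W (\<lambda>w. s w $ i)"
  shows "holo_on W s"
  unfolding holo_on_def
proof
  fix w assume w: "w \<in> W"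
  have "\<forall>i. \<exists>s'. ((\<lambda>w. s w $ i) has_derivative s') (at w) \<and> (\<forall>c v. s' (c *s v) = c * s' v)"
    using assms w unfolding complex_differentiable_on_def by blast
  from choice[OF this] obtain s' where s': "\<And>i. ((\<lambda>w. s w $ i) has_derivative s' i) (at w)"
      "\<And>i c v. s' i (c *s v) = c * s' i v" by blast
  have "((\<lambda>w. \<Sum>i\<in>UNIV. s w $ i *s axis i 1) has_derivative (\<lambda>v. \<Sum>i\<in>UNIV. s' i v *s axis i 1)) (at w)"
    by (intro has_derivative_sum bounded_linear.has_derivative[OF bounded_linear_vsmult_left] s')
  moreover have "(\<Sum>i\<in>UNIV. s w $ i *s axis i 1) = s w" for w by (rule basis_expansion)
  ultimately have "(s has_derivative (\<lambda>v. \<Sum>i\<in>UNIV. s' i v *s axis i 1)) (at w)" by simp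
  moreover have "(\<Sum>i\<in>UNIV. s' i (c *s v) *s axis i 1) = c *s (\<Sum>i\<in>UNIV. s' i v *s (axis i 1 :: complex^'m))" for c v
    by (simp add: s' vec.scale_sum_right vector_smult_assoc)
  ultimately show "\<exists>s'. (s has_derivative s') (at w) \<and> (\<forall>c v. s' (c *s v) = c *s s' v)" by blast
qed

lemma span_indexed:
  fixes e :: "nat \<Rightarrow> complex^'m"
  assumes "v \<in> vec.span {e j | j. j < d}"
  shows "\<exists>c. v = (\<Sum>j<d. c j *s e j)"
proof -
  have "vec.span {e j | j. j < d} \<subseteq> {v. \<exists>c. v = (\<Sum>j<d. c j *s e j)}"
  proof (rule vec.span_minimal)
    show "{e j | j. j < d} \<subseteq> {v. \<exists>c. v = (\<Sum>j<d. c j *s e j)}"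
    proof safe
      fix j assume "j < d"
      then have "e j = (\<Sum>i<d. (if i = j then 1 else 0) *s e i)"
        by (simp add: if_distrib[of "\<lambda>x. x *s _"] cong: if_cong)
      then show "\<exists>c. e j = (\<Sum>j<d. c j *s e j)" by (intro exI[of _ "\<lambda>i. if i = j then 1 else 0"])
    qed
    show "vec.subspace {v. \<exists>c. v = (\<Sum>j<d. c j *s e j)}"
      unfolding vec.subspace_def
    proof (intro conjI ballI allI)
      show "0 \<in> {v. \<exists>c. v = (\<Sum>j<d. c j *s e j)}" by (auto intro!: exI[of _ "\<lambda>_. 0"])
      fix x assume "x \<in> {v. \<exists>c. v = (\<Sum>j<d. c j *s e j)}"
      then obtain c where c: "x = (\<Sum>j<d. c j *s e j)" by blast
      show "a *s x \<in> {v. \<exists>c. v = (\<Sum>j<d. c j *s e j)}" for a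
        unfolding c by (auto intro!: exI[of _ "\<lambda>j. a * c j"] simp: vec.scale_sum_right vector_smult_assoc)
      fix y assume "y \<in> {v. \<exists>c. v = (\<Sum>j<d. c j *s e j)}"
      then obtain c' where c': "y = (\<Sum>j<d. c' j *s e j)" by blast
      show "x + y \<in> {v. \<exists>c. v = (\<Sum>j<d. c j *s e j)}"
        unfolding c c' by (auto intro!: exI[of _ "\<lambda>j. c j + c' j"] simp: vec.scale_left_distrib sum.distrib)
    qed
  qed
  then show ?thesis using assms by blast
qed

lemma bounded_linear_matrix_vector: "bounded_linear (\<lambda>A :: complex^'n^'m. A *v x)"
  by (simp add: linear_conv_bounded_linear[symmetric] linear_iff matrix_vector_mult_add_rdistrib)
     (simp add: matrix_vector_mult_def vec_eq_iff scaleR_sum_right)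

lemma bounded_bilinear_matrix_vector: "bounded_bilinear (\<lambda>(A :: complex^'n^'m) x. A *v x)"
  unfolding bilinear_conv_bounded_bilinear[symmetric] bilinear_def
proof (intro conjI allI)
  show "linear (\<lambda>A :: complex^'n^'m. A *v x)" for x
    using bounded_linear_matrix_vector bounded_linear.linear by blast
qed simp

lemma bounded_linear_vcnj: "bounded_linear (vcnj :: complex^'m \<Rightarrow> complex^'m)"
  by (simp add: linear_conv_bounded_linear[symmetric] linear_iff) (simp add: vcnj_def vec_eq_iff)

section \<open>Projectors onto the Hodge filtration\<close>

context hodge_structure begin

text \<open>Its image is F^r and its kernel the sum of the \<open>H a\<close> with a < r, which is
  the conjugate of F^(n+1-r).\<close>

definition Fproj :: "nat \<Rightarrow> complex^'m^'m" where
  "Fproj r = cop (\<lambda>a. if r \<le> a then 1 else 0)"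

lemma Fproj_H: "a \<le> n \<Longrightarrow> x \<in> H a \<Longrightarrow> Fproj r *v x = (if r \<le> a then x else 0)"
  by (simp add: Fproj_def cop_H)

lemma Fproj_Fproj: "Fproj r *v (Fproj s *v x) = Fproj (max r s) *v x"
proof -
  have "Fproj r ** Fproj s = Fproj (max r s)" unfolding Fproj_def cop_cop by (rule cop_cong) auto
  then show ?thesis by (simp add: matrix_vector_mul_assoc)
qed

lemma filtration_eq: "filtration H r = {v. Fproj r *v v = v}"
proof (intro equalityI subsetI)
  fix v assume "v \<in> {v. Fproj r *v v = v}"
  then have "v = (\<Sum>a\<le>n. (if r \<le> a then 1 else 0) *s comp v a)" by (simp add: Fproj_def cop_mult)
  also have "\<dots> \<in> filtration H r"
    unfolding filtration_def
  proof (intro vec.span_sum)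
    show "(if r \<le> a then 1 else 0) *s comp v a \<in> vec.span (\<Union>a\<in>{r..}. H a)" for a
      by (cases "r \<le> a") (auto intro!: vec.span_base vec.span_zero simp: comp_H)
  qed
  finally show "v \<in> filtration H r" .
next
  fix v assume "v \<in> filtration H r"
  moreover have "filtration H r \<subseteq> {v. Fproj r *v v = v}"
    unfolding filtration_def
  proof (rule vec.span_minimal)
    show "vec.subspace {v. Fproj r *v v = v}"
      by (auto simp: vec.subspace_def matrix_vector_right_distrib vector_scalar_commute)
    show "(\<Union>a\<in>{r..}. H a) \<subseteq> {v. Fproj r *v v = v}"
    proof safe
      fix a x assume "r \<le> a" "x \<in> H a"
      then show "Fproj r *v x = x" using H_0[of a] by (cases "a \<le> n") (simp_all add: Fproj_H)
    qed
  qed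
  ultimately show "v \<in> {v. Fproj r *v v = v}" by blast
qed

lemma vcnj_Fproj: "r \<le> n + 1 \<Longrightarrow> vcnj (Fproj (n + 1 - r) *v vcnj x) = x - Fproj r *v x"
proof -
  assume r: "r \<le> n + 1"
  have "mcnj (Fproj (n + 1 - r)) = mat 1 - Fproj r"
    unfolding Fproj_def mcnj_cop cop_const[symmetric] cop_diff by (rule cop_cong) (use r in auto)
  then show ?thesis by (simp add: vcnj_mult matrix_vector_mult_diff_rdistrib)
qed

lemma Fproj_0: "Fproj 0 = mat 1"
  unfolding Fproj_def cop_const[symmetric] by simp

lemma Fproj_gt: "n < r \<Longrightarrow> Fproj r *v x = 0"
  unfolding Fproj_def cop_mult by (intro sum.neutral) auto

lemma cop_Fproj: "cop \<mu> *v x = (\<Sum>r\<le>n. \<mu> r *s (Fproj r *v x - Fproj (Suc r) *v x))"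
proof -
  have "Fproj r *v x - Fproj (Suc r) *v x = comp x r" if "r \<le> n" for r
  proof -
    have "Fproj r *v x - Fproj (Suc r) *v x = (\<Sum>a\<le>n. (if a = r then 1 else 0) *s comp x a)"
      unfolding Fproj_def cop_mult sum_subtractf[symmetric] by (intro sum.cong refl) auto
    then show ?thesis using that by (simp add: if_distrib[of "\<lambda>c. c *s _"] cong: if_cong)
  qed
  then show ?thesis unfolding cop_mult by (intro sum.cong refl) simp
qed

text \<open>On \<open>H a\<close> exactly the projectors of index 1, ..., a act as the identity, so
  their sum is multiplication by a.\<close>

lemma hodge_weight_Fproj: "cop (hodge_weight n) *v x = (\<Sum>r\<in>{1..n}. \<i> *s (Fproj r *v x)) - (\<i> * of_nat n / 2) *s x"
proof -
  define M where "M = matrix (\<lambda>x. (\<Sum>r\<in>{1..n}. \<i> *s (Fproj r *v x)) - (\<i> * of_nat n / 2) *s x)"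
  have M: "M *v x = (\<Sum>r\<in>{1..n}. \<i> *s (Fproj r *v x)) - (\<i> * of_nat n / 2) *s x" for x
    unfolding M_def
    by (rule matrix_works, unfold_locales)
       (simp_all add: matrix_vector_right_distrib vector_scalar_commute vec.scale_right_distrib sum.distrib
         vec.scale_right_diff_distrib vec.scale_sum_right vector_smult_assoc mult.commute mult.left_commute)
  have "cop (hodge_weight n) = M"
  proof (rule matrix_eqI)
    fix a x assume a: "a \<le> n" and x: "x \<in> H a"
    have "(\<Sum>r\<in>{1..n}. \<i> *s (Fproj r *v x)) = (\<Sum>r\<in>{1..a}. \<i> *s x)"
      by (rule sum.mono_neutral_cong_right) (use a x in \<open>auto simp: Fproj_H\<close>)
    also have "(\<Sum>r\<in>{1..k}. \<i> *s x) = (of_nat k * \<i>) *s x" for k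
      by (induction k) (simp_all add: vec.scale_left_distrib distrib_right add.commute)
    finally show "cop (hodge_weight n) *v x = M *v x"
      unfolding M cop_H[OF a x] by (simp add: hodge_weight_def vec_eq_iff algebra_simps)
  qed
  then show ?thesis using M by simp
qed

end

section \<open>The filtration projectors along a horizontal chart\<close>

locale hodge_chart =
  fixes n :: nat and Q :: "int^'m^'m" and h :: "nat \<Rightarrow> nat"
    and W :: "(complex^'k) set" and f :: "complex^'k \<Rightarrow> 'm decomp"
  assumes pol: "polarization_form n Q"
    and holo: "holo_map (classifying_space n Q h) W f"
    and horizontal: "horizontal_on n W f"
    and immersion: "immersion_on W f"
begin

lemma open_W: "open W" using holo by (simp add: holo_map_def)

lemma hs: "w \<in> W \<Longrightarrow> hodge_structure n Q h (f w)"
  using pol holo by (auto simp: hodge_structure_def holo_map_def)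

definition PF :: "complex^'k \<Rightarrow> nat \<Rightarrow> complex^'m^'m" where
  "PF w r = hodge_structure.Fproj n (f w) r"

lemma filtration_PF: "w \<in> W \<Longrightarrow> filtration (f w) r = {v. PF w r *v v = v}"
  unfolding PF_def using hodge_structure.filtration_eq[OF hs] .

lemma PF_PF: "w \<in> W \<Longrightarrow> PF w r *v (PF w s *v x) = PF w (max r s) *v x"
  unfolding PF_def using hodge_structure.Fproj_Fproj[OF hs] .

lemma vcnj_PF: "w \<in> W \<Longrightarrow> r \<le> n + 1 \<Longrightarrow> vcnj (PF w (n + 1 - r) *v vcnj x) = x - PF w r *v x"
  unfolding PF_def using hodge_structure.vcnj_Fproj[OF hs] .

text \<open>Expand the columns of \<open>PF w0 r\<close> in the holomorphic frame at w0, then move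
  the frame and freeze the coefficients. This A is a holomorphic substitute for the projector,
  agreeing with it at w0.\<close>

lemma local_frame:
  assumes w0: "w0 \<in> W"
  obtains W' A where "open W'" "w0 \<in> W'" "W' \<subseteq> W" "\<And>i j. complex_differentiable_on W' (\<lambda>w. A w $ i $ j)"
    "\<And>x. holo_on W' (\<lambda>w. A w *v x)" "A w0 = PF w0 r" "\<And>w x. w \<in> W' \<Longrightarrow> PF w r *v (A w *v x) = A w *v x"
proof -
  define d where "d = vec.dim (filtration (f w0) r)"
  have "\<forall>r. \<forall>w\<in>W. \<exists>W' e. open W' \<and> w \<in> W' \<and> W' \<subseteq> W \<and>
        (\<forall>j < vec.dim (filtration (f w) r). holo_on W' (e j)) \<and>
        (\<forall>w'\<in>W'. filtration (f w') r = vec.span {e j w' | j::nat. j < vec.dim (filtration (f w) r)})"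
    using holo unfolding holo_map_def by (elim conjE)
  from this[rule_format, OF w0, of r, folded d_def] obtain W' e where W': "open W'" "w0 \<in> W'" "W' \<subseteq> W"
    and e': "\<forall>j<d. holo_on W' (e j)"
    and sp': "\<forall>w\<in>W'. filtration (f w) r = vec.span {e j w | j. j < d}"
    by (elim exE conjE) (rule that)
  have e: "holo_on W' (e j)" if "j < d" for j using e' that by blast
  have sp: "filtration (f w) r = vec.span {e j w | j. j < d}" if "w \<in> W'" for w using sp' that by (rule bspec)
  have "\<forall>i. \<exists>c. PF w0 r *v axis i 1 = (\<Sum>j<d. c j *s e j w0)"
  proof
    fix i
    have "PF w0 r *v axis i 1 \<in> filtration (f w0) r"
      using PF_PF[OF w0] by (simp add: filtration_PF[OF w0])
    then show "\<exists>c. PF w0 r *v axis i 1 = (\<Sum>j<d. c j *s e j w0)"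
      unfolding sp[OF W'(2)] by (rule span_indexed)
  qed
  from choice[OF this] obtain c where c: "\<And>i. PF w0 r *v axis i 1 = (\<Sum>j<d. c i j *s e j w0)" by blast
  define A where "A w = (\<chi> a i. \<Sum>j<d. c i j * e j w $ a)" for w
  have cd: "complex_differentiable_on W' (\<lambda>w. A w $ i $ j)" for i j
    unfolding A_def by (auto intro!: complex_differentiable_on_sum complex_differentiable_on_cmult holo_on_component e)
  have Ax: "A w *v x = (\<Sum>i\<in>UNIV. x $ i *s (\<Sum>j<d. c i j *s e j w))" for w x
    by (simp add: A_def matrix_vector_mult_def vec_eq_iff mult.commute)
  show ?thesis
  proof (rule that[OF W' cd])
    show "holo_on W' (\<lambda>w. A w *v x)" for x
    proof (rule holo_on_componentI)
      show "complex_differentiable_on W' (\<lambda>w. (A w *v x) $ i)" for i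
        unfolding matrix_vector_mult_def using cd
        by (simp add: mult.commute[of _ "x $ _"] complex_differentiable_on_sum complex_differentiable_on_cmult)
    qed
    have "A w0 *v x = PF w0 r *v x" for x
    proof -
      have "A w0 *v x = (\<Sum>i\<in>UNIV. PF w0 r *v (x $ i *s axis i 1))"
        unfolding Ax by (simp add: c vector_scalar_commute)
      also have "\<dots> = PF w0 r *v (\<Sum>i\<in>UNIV. x $ i *s axis i 1)"
        by (rule vec.linear_sum[OF matrix_vector_mul_linear_gen, symmetric])
      finally show ?thesis by (simp add: basis_expansion)
    qed
    then show "A w0 = PF w0 r" by (simp add: matrix_eq)
    fix w x assume w: "w \<in> W'"
    have "A w *v x \<in> filtration (f w) r"
      unfolding Ax sp[OF w] using w
      by (intro vec.span_sum vec.span_scale vec.span_base) auto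
    then show "PF w r *v (A w *v x) = A w *v x"
      using w W' by (auto simp: filtration_PF)
  qed
qed

text \<open>Let B be the sum of a holomorphic A for F^r and the conjugate of one for F^(n+1-r). The
  summands have values in image and kernel of the projector, so PF ** B = A; as B is 1 at w0, it is
  invertible nearby and Cramer's rule applies.\<close>

lemma smooth_PF_entry: "smoothC W (\<lambda>w. PF w r $ k $ l)"
proof (cases "r \<le> n")
  \<comment> \<open>Here the projector is 0; for r > n + 1 the index n + 1 - r of the main case
    would be truncated.\<close>
  case False
  then have "PF w r = 0" if "w \<in> W" for w
    using hodge_structure.Fproj_gt[OF hs[OF that], of r] by (simp add: PF_def matrix_eq)
  then show ?thesis by (intro smoothC_cong[OF smoothC_const[OF open_W, of 0]]) simp
next
  case True
  show ?thesis
  proof (rule smoothC.local[OF open_W])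
    fix w0 assume w0: "w0 \<in> W"
    obtain W1 A where W1: "open W1" "w0 \<in> W1" "W1 \<subseteq> W" and A: "\<And>i j. complex_differentiable_on W1 (\<lambda>w. A w $ i $ j)"
      "A w0 = PF w0 r" "\<And>w x. w \<in> W1 \<Longrightarrow> PF w r *v (A w *v x) = A w *v x"
      by (rule local_frame[OF w0, of r]) blast
    obtain W2 A2 where W2: "open W2" "w0 \<in> W2" "W2 \<subseteq> W" and A2: "\<And>i j. complex_differentiable_on W2 (\<lambda>w. A2 w $ i $ j)"
      "A2 w0 = PF w0 (n + 1 - r)" "\<And>w x. w \<in> W2 \<Longrightarrow> PF w (n + 1 - r) *v (A2 w *v x) = A2 w *v x"
      by (rule local_frame[OF w0, of "n + 1 - r"]) blast
    define B where "B w = A w + mcnj (A2 w)" for w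
    have oW: "open (W1 \<inter> W2)" using W1 W2 by auto
    have sA: "smoothC (W1 \<inter> W2) (\<lambda>w. A w $ i $ j)" for i j
      by (rule smoothC_subset[OF smoothC.holo[OF W1(1) A(1)]]) (use oW in auto)
    have sA2: "smoothC (W1 \<inter> W2) (\<lambda>w. A2 w $ i $ j)" for i j
      by (rule smoothC_subset[OF smoothC.holo[OF W2(1) A2(1)]]) (use oW in auto)
    have sB: "smoothC (W1 \<inter> W2) (\<lambda>w. B w $ i $ j)" for i j
      unfolding B_def mcnj_def by (simp add: smoothC.add[OF sA smoothC.cnj[OF sA2]])
    have "B w0 *v x = x" for x
    proof -
      have "mcnj (A2 w0) *v x = vcnj (A2 w0 *v vcnj x)" by (simp add: vcnj_mult)
      then show ?thesis unfolding B_def matrix_vector_mult_add_rdistrib A(2) A2(2)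
        using vcnj_PF[OF w0, of r x] True by simp
    qed
    then have B0: "B w0 = mat 1" by (simp add: matrix_eq)
    have "smoothC (W1 \<inter> W2) (\<lambda>w. det (B w))" by (rule smoothC_det[OF oW sB])
    then have "continuous_on (W1 \<inter> W2) (\<lambda>w. det (B w))"
      using smoothC_has_derivative by (meson continuous_at_imp_continuous_on has_derivative_continuous)
    then have "open ((\<lambda>w. det (B w)) -` (- {0}) \<inter> (W1 \<inter> W2))"
      using oW by (simp add: continuous_on_open_vimage open_Compl)
    moreover define W3 where "W3 = (\<lambda>w. det (B w)) -` (- {0}) \<inter> (W1 \<inter> W2)"
    ultimately have oW3: "open W3" by simp
    have w03: "w0 \<in> W3" using W1 W2 B0 by (simp add: W3_def)
    have det3: "det (transpose (B w)) \<noteq> 0" if "w \<in> W3" for w using that by (simp add: W3_def det_transpose)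
    have PB: "PF w r ** B w = A w" if "w \<in> W3" for w
    proof -
      have w: "w \<in> W" "w \<in> W1" "w \<in> W2" using that W1 by (auto simp: W3_def)
      have "PF w r *v (B w *v x) = A w *v x" for x
      proof -
        have "mcnj (A2 w) *v x = vcnj (A2 w *v vcnj x)" by (simp add: vcnj_mult)
        also have "\<dots> = vcnj (PF w (n + 1 - r) *v vcnj (vcnj (A2 w *v vcnj x)))" using A2(3)[OF w(3)] by simp
        also have "\<dots> = vcnj (A2 w *v vcnj x) - PF w r *v vcnj (A2 w *v vcnj x)"
          by (rule vcnj_PF[OF w(1)]) (use True in simp)
        finally have "PF w r *v (mcnj (A2 w) *v x) = 0" by (simp add: vcnj_mult)
        then show ?thesis by (simp add: B_def matrix_vector_mult_add_rdistrib matrix_vector_right_distrib A(3)[OF w(2)])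
      qed
      then show ?thesis by (simp add: matrix_eq flip: matrix_vector_mul_assoc)
    qed
    \<comment> \<open>Row k of PF ** B = A, transposed into a linear system for row k of PF.\<close>
    have "smoothC W3 (\<lambda>w. (\<chi> j. PF w r $ k $ j) $ l)"
    proof (rule smoothC_solve[OF oW3 _ _ det3])
      show "smoothC W3 (\<lambda>w. transpose (B w) $ i $ j)" for i j
        unfolding transpose_def by (simp, rule smoothC_subset[OF sB oW3]) (auto simp: W3_def)
      show "smoothC W3 (\<lambda>w. (\<chi> j. A w $ k $ j) $ i)" for i
        by (simp, rule smoothC_subset[OF sA oW3]) (auto simp: W3_def)
      show "transpose (B w) *v (\<chi> j. PF w r $ k $ j) = (\<chi> j. A w $ k $ j)" if "w \<in> W3" for w
        unfolding PB[OF that, symmetric]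
        by (simp add: matrix_vector_mult_def matrix_matrix_mult_def transpose_def vec_eq_iff mult.commute)
    qed
    then show "\<exists>W' g. open W' \<and> w0 \<in> W' \<and> smoothC W' g \<and> (\<forall>x\<in>W' \<inter> W. PF x r $ k $ l = g x)"
      using oW3 w03 by (intro exI[of _ W3] exI[of _ "\<lambda>w. PF w r $ k $ l"]) simp
  qed
qed

lemma smooth_on_vecI:
  fixes F :: "complex^'k \<Rightarrow> 'b::euclidean_space^'c"
  assumes "\<And>i. smooth_on W (\<lambda>w. F w $ i)"
  shows "smooth_on W F"
  using assms open_W unfolding smooth_on_def by (auto simp: Basis_vec_def inner_axis)

lemma smooth_PF: "smooth_on W (\<lambda>w. PF w r)"
  by (intro smooth_on_vecI smooth_on_complex smooth_PF_entry)

definition dP :: "complex^'k \<Rightarrow> nat \<Rightarrow> complex^'k \<Rightarrow> complex^'m^'m" where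
  "dP w r v = frechet_derivative (\<lambda>z. PF z r) (at w) v"

lemma PF_der: "w \<in> W \<Longrightarrow> ((\<lambda>z. PF z r) has_derivative dP w r) (at w)"
  using smooth_on_has_derivative(1)[OF smooth_PF] by (simp add: dP_def[abs_def])

lemma PF_vec_der: "w \<in> W \<Longrightarrow> ((\<lambda>z. PF z r *v x) has_derivative (\<lambda>v. dP w r v *v x)) (at w)"
  by (rule bounded_linear.has_derivative[OF bounded_linear_matrix_vector PF_der])

text \<open>On F^r the matrix \<open>dP\<close> is the differential of the chart in Hom(F^r, H/F^r),
  with the quotient realized as the kernel of the projector.\<close>

lemma PF_section_der:
  assumes w: "w \<in> W" and s: "(s has_derivative s') (at w)" and W': "open W'" "w \<in> W'"
    and F: "\<And>z. z \<in> W' \<Longrightarrow> PF z r *v s z = s z"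
  shows "dP w r v *v s w = s' v - PF w r *v s' v"
proof -
  have "((\<lambda>z. PF z r *v s z) has_derivative (\<lambda>v. PF w r *v s' v + dP w r v *v s w)) (at w)"
    by (rule bounded_bilinear.FDERIV[OF bounded_bilinear_matrix_vector PF_der[OF w] s])
  then have "(s has_derivative (\<lambda>v. PF w r *v s' v + dP w r v *v s w)) (at w)"
    by (rule has_derivative_transform_within_open[OF _ W']) (rule F)
  from fun_cong[OF has_derivative_unique[OF this s], of v] show ?thesis by (simp add: algebra_simps)
qed

text \<open>Apply \<open>PF_section_der\<close> to a holomorphic section through x from
  \<open>local_frame\<close>: its derivative is complex linear, and horizontality puts it into
  F^(r-1).\<close>

lemma dP_F:
  assumes w: "w \<in> W" and x: "PF w r *v x = x"
  shows "dP w r (J v) *v x = \<i> *s (dP w r v *v x)" and "PF w r *v (dP w r v *v x) = 0"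
    and "r \<in> {1..n} \<Longrightarrow> PF w (r - 1) *v (dP w r v *v x) = dP w r v *v x"
proof -
  obtain W' A where W': "open W'" "w \<in> W'" "W' \<subseteq> W" and A: "\<And>x. holo_on W' (\<lambda>w. A w *v x)" "A w = PF w r"
    "\<And>w x. w \<in> W' \<Longrightarrow> PF w r *v (A w *v x) = A w *v x"
    by (rule local_frame[OF w, of r]) blast
  define s where "s z = A z *v x" for z
  have hol: "holo_on W' s" unfolding s_def using A(1) .
  then obtain s' where s': "(s has_derivative s') (at w)" "\<And>c v. s' (c *s v) = c *s s' v"
    using W'(2) unfolding holo_on_def by blast
  have sF: "PF z r *v s z = s z" if "z \<in> W'" for z unfolding s_def using A(3)[OF that] .
  have sw: "s w = x" by (simp add: s_def A(2) x)
  have d: "dP w r v *v x = s' v - PF w r *v s' v" for v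
    using PF_section_der[OF w s'(1) W'(1,2) sF] by (simp add: sw)
  show "dP w r (J v) *v x = \<i> *s (dP w r v *v x)"
    unfolding d by (simp add: J_def s'(2) vector_scalar_commute vec.scale_right_diff_distrib)
  show "PF w r *v (dP w r v *v x) = 0"
    unfolding d by (simp add: matrix_vector_mult_diff_distrib PF_PF[OF w])
  assume r: "r \<in> {1..n}"
  have "s' v + 0 \<in> differential W f w v r x"
    unfolding differential_def
  proof (intro CollectI exI conjI)
    show "s' v + 0 = s' v + 0" "s w = x" "(s has_derivative s') (at w)" "open W'" "w \<in> W'" "W' \<subseteq> W" "holo_on W' s"
      using sw s' W' hol by simp_all
    show "0 \<in> filtration (f w) r" by (simp add: filtration_PF[OF w])
    show "\<forall>w'\<in>W'. s w' \<in> filtration (f w') r"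
      using W'(3) sF by (auto simp: filtration_PF)
  qed
  moreover have "x \<in> filtration (f w) r" using x by (simp add: filtration_PF[OF w])
  ultimately have "s' v \<in> filtration (f w) (r - 1)"
    using horizontal w r unfolding horizontal_on_def by fastforce
  then have "PF w (r - 1) *v s' v = s' v" by (simp add: filtration_PF[OF w])
  moreover have "max (r - 1) r = r" by simp
  ultimately show "PF w (r - 1) *v (dP w r v *v x) = dP w r v *v x"
    unfolding d by (simp add: matrix_vector_mult_diff_distrib PF_PF[OF w])
qed

lemma dP_cnj:
  assumes w: "w \<in> W" and r: "r \<le> n + 1"
  shows "dP w r v *v x = - vcnj (dP w (n + 1 - r) v *v vcnj x)"
proof -
  have "((\<lambda>z. vcnj (PF z (n + 1 - r) *v vcnj x)) has_derivative (\<lambda>v. vcnj (dP w (n + 1 - r) v *v vcnj x))) (at w)"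
    by (rule bounded_linear.has_derivative[OF bounded_linear_vcnj PF_vec_der[OF w]])
  then have "((\<lambda>z. x - PF z r *v x) has_derivative (\<lambda>v. vcnj (dP w (n + 1 - r) v *v vcnj x))) (at w)"
    by (rule has_derivative_transform_within_open[OF _ open_W w]) (rule vcnj_PF[OF _ r])
  moreover have "((\<lambda>z. x - PF z r *v x) has_derivative (\<lambda>v. 0 - dP w r v *v x)) (at w)"
    by (intro has_derivative_diff has_derivative_const PF_vec_der w)
  ultimately have "(\<lambda>v. vcnj (dP w (n + 1 - r) v *v vcnj x)) = (\<lambda>v. 0 - dP w r v *v x)"
    by (rule has_derivative_unique)
  from fun_cong[OF this, of v] show ?thesis by simp
qed

lemma dP_0: "w \<in> W \<Longrightarrow> dP w 0 v *v x = 0" and dP_gt: "w \<in> W \<Longrightarrow> n < r \<Longrightarrow> dP w r v *v x = 0"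
proof -
  assume w: "w \<in> W"
  have c: "dP w r v *v x = 0" if "\<And>z. z \<in> W \<Longrightarrow> PF z r *v x = y" for r y
  proof -
    have "((\<lambda>z. y) has_derivative (\<lambda>v. dP w r v *v x)) (at w)"
      by (rule has_derivative_transform_within_open[OF PF_vec_der[OF w] open_W w]) (rule that)
    from fun_cong[OF has_derivative_unique[OF this has_derivative_const], of v] show ?thesis by simp
  qed
  show "dP w 0 v *v x = 0"
    by (rule c[of 0 x]) (simp add: PF_def hodge_structure.Fproj_0[OF hs])
  show "dP w r v *v x = 0" if "n < r"
    by (rule c[of r 0]) (simp add: PF_def hodge_structure.Fproj_gt[OF hs that])
qed

lemma PF_H: "w \<in> W \<Longrightarrow> a \<le> n \<Longrightarrow> x \<in> f w a \<Longrightarrow> PF w r *v x = (if r \<le> a then x else 0)"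
  unfolding PF_def using hodge_structure.Fproj_H[OF hs] .

lemma H_if_PF:
  assumes w: "w \<in> W" and a: "a \<le> n" and x: "PF w a *v x = x" "PF w (Suc a) *v x = 0"
  shows "x \<in> f w a"
proof -
  interpret hodge_structure n Q h "f w" by (rule hs[OF w])
  have "comp x r = 0" if "r \<le> n" "r \<noteq> a" for r
  proof (cases "r < a")
    case True
    have "comp (Fproj a *v x) r = (if a \<le> r then 1 else 0) *s comp x r" unfolding Fproj_def by (rule comp_cop[OF that(1)])
    then show ?thesis using True x(1) by (simp add: PF_def)
  next
    case False
    have "comp (Fproj (Suc a) *v x) r = (if Suc a \<le> r then 1 else 0) *s comp x r" unfolding Fproj_def by (rule comp_cop[OF that(1)])
    then show ?thesis using False that x(2) comp_simps(2)[of 0 0 r] by (simp add: PF_def)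
  qed
  then have "(\<Sum>r\<le>n. comp x r) = (\<Sum>r\<in>{a}. comp x r)"
    using a by (intro sum.mono_neutral_right) auto
  then show ?thesis using comp_sum[of x] comp_H[of x a] by simp
qed

lemma dP_down:
  assumes w: "w \<in> W" and r: "r \<in> {1..n}" and a: "r \<le> a" "a \<le> n" and x: "x \<in> f w a"
  shows "dP w r v *v x \<in> f w (r - 1)" and "dP w r (J v) *v x = \<i> *s (dP w r v *v x)"
proof -
  have px: "PF w r *v x = x" using PF_H[OF w a(2) x, of r] a(1) by simp
  show "dP w r (J v) *v x = \<i> *s (dP w r v *v x)" by (rule dP_F(1)[OF w px])
  show "dP w r v *v x \<in> f w (r - 1)"
    using dP_F(2,3)[OF w px] r by (intro H_if_PF w) auto
qed

text \<open>\<open>dP_down\<close> for the index n + 1 - r, transported by \<open>dP_cnj\<close>;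
  conjugation turns complex linear into antilinear dependence on v.\<close>

lemma dP_up:
  assumes w: "w \<in> W" and r: "r \<in> {1..n}" and a: "a < r" "a \<le> n" and x: "x \<in> f w a"
  shows "dP w r v *v x \<in> f w r" and "dP w r (J v) *v x = - (\<i> *s (dP w r v *v x))"
proof -
  interpret hodge_structure n Q h "f w" by (rule hs[OF w])
  have r': "n + 1 - r \<in> {1..n}" "n + 1 - r \<le> n - a" "n - a \<le> n" and rn: "r \<le> n + 1" using r a by auto
  note down = dP_down[OF w r' vcnj_H[OF a(2) x]]
  have "n + 1 - r - 1 = n - r" by simp
  then have "vcnj (dP w (n + 1 - r) v *v vcnj x) \<in> f w r"
    using vcnj_H[OF _ down(1)[of v]] r by simp
  then show "dP w r v *v x \<in> f w r"
    unfolding dP_cnj[OF w rn] by (rule vec.subspace_neg[OF H_subspace])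
  show "dP w r (J v) *v x = - (\<i> *s (dP w r v *v x))"
    unfolding dP_cnj[OF w rn] down(2) by simp
qed

text \<open>By horizontality F^(r+1) moves inside F^r only, so to first order the projector onto F^r
  goes on fixing it. Formally, differentiate PF r PF (r+1) = PF (r+1).\<close>

lemma dP_far_down:
  assumes w: "w \<in> W" and r: "1 \<le> r" and a: "Suc r \<le> a" "a \<le> n" and x: "x \<in> f w a"
  shows "dP w r v *v x = 0"
proof -
  have "((\<lambda>z. PF z r *v (PF z (Suc r) *v x)) has_derivative
      (\<lambda>v. PF w r *v (dP w (Suc r) v *v x) + dP w r v *v (PF w (Suc r) *v x))) (at w)"
    by (rule bounded_bilinear.FDERIV[OF bounded_bilinear_matrix_vector PF_der[OF w] PF_vec_der[OF w]])
  then have "((\<lambda>z. PF z (Suc r) *v x) has_derivative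
      (\<lambda>v. PF w r *v (dP w (Suc r) v *v x) + dP w r v *v (PF w (Suc r) *v x))) (at w)"
    by (rule has_derivative_transform_within_open[OF _ open_W w]) (simp add: PF_PF)
  from fun_cong[OF has_derivative_unique[OF this PF_vec_der[OF w]], of v]
  have 1: "PF w r *v (dP w (Suc r) v *v x) + dP w r v *v x = dP w (Suc r) v *v x"
    using PF_H[OF w a(2) x, of "Suc r"] a(1) by simp
  have "dP w (Suc r) v *v x \<in> f w r" using dP_down(1)[OF w _ a x, of v] a by simp
  then have "PF w r *v (dP w (Suc r) v *v x) = dP w (Suc r) v *v x"
    using PF_H[OF w, of r] a by simp
  then show ?thesis using 1 by simp
qed

text \<open>So on \<open>H a\<close> only r = a, which lowers the degree by one, and r = a + 1,
  which raises it, can act. Indices above a + 1 reduce to \<open>dP_far_down\<close> by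
  conjugation.\<close>

lemma dP_H:
  assumes w: "w \<in> W" and r: "r \<noteq> a" "r \<noteq> Suc a" and a: "a \<le> n" and x: "x \<in> f w a"
  shows "dP w r v *v x = 0"
proof -
  interpret hodge_structure n Q h "f w" by (rule hs[OF w])
  consider "r = 0" | "n < r" | "1 \<le> r" "Suc r \<le> a" | "r \<le> n" "Suc (Suc a) \<le> r" using r by linarith
  then show ?thesis
  proof cases
    case 1
    then show ?thesis using dP_0[OF w] by simp
  next
    case 2
    then show ?thesis using dP_gt[OF w] by simp
  next
    case 3
    then show ?thesis using dP_far_down[OF w _ _ a x] by simp
  next
    case 4
    then have "dP w (n + 1 - r) v *v vcnj x = 0"
      using dP_far_down[OF w _ _ _ vcnj_H[OF a x], of "n + 1 - r"] by simp
    then show ?thesis using dP_cnj[OF w, of r] 4 by simp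
  qed
qed

end

lemma bounded_linear_cmat_mult: "bounded_linear (\<lambda>M. cmat M *v x)"
  by (simp add: linear_conv_bounded_linear[symmetric] linear_iff matrix_vector_mult_add_rdistrib)
     (simp add: matrix_vector_mult_def vec_eq_iff scaleR_sum_right)

lemma bounded_linear_vsmult_right: "bounded_linear (\<lambda>x. c *s (x :: complex^'m))"
  by (simp add: linear_conv_bounded_linear[symmetric] linear_iff vec.scale_right_distrib)
     (simp add: vec_eq_iff)

lemma matrix_vector_axis: "(A *v axis j (1::'a::comm_ring_1)) $ i = A $ i $ j"
proof -
  have "A $ i $ k * axis j 1 $ k = (if k = j then A $ i $ j else 0)" for k by (simp add: axis_def)
  then show ?thesis by (simp add: matrix_vector_mult_def)
qed

lemma sum_two_terms:
  fixes F :: "nat \<Rightarrow> 'b::comm_monoid_add"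
  assumes "a \<le> n" "\<And>r. r \<noteq> a \<Longrightarrow> r \<noteq> Suc a \<Longrightarrow> F r = 0" "F (Suc n) = 0"
  shows "(\<Sum>r\<le>n. F r) = F a + F (Suc a)"
proof -
  have "(\<Sum>r\<le>n. F r) = (\<Sum>r\<le>Suc n. F r)" using assms(3) by simp
  also have "\<dots> = (\<Sum>r\<in>{a, Suc a}. F r)"
    by (rule sum.mono_neutral_right) (use assms in auto)
  finally show ?thesis by simp
qed

section \<open>Derivatives of Y and C along a horizontal chart\<close>

context hodge_chart begin

definition YY :: "complex^'k \<Rightarrow> real^'m^'m" where "YY w = hodge_structure.Yop n (f w)"
definition CC :: "complex^'k \<Rightarrow> real^'m^'m" where "CC w = hodge_structure.Cop n (f w)"
definition dY where "dY w v = frechet_derivative YY (at w) v"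
definition dC where "dC w v = frechet_derivative CC (at w) v"

lemma cmat_YY: "w \<in> W \<Longrightarrow> cmat (YY w) = hodge_structure.cop n (f w) (hodge_weight n)"
  unfolding YY_def by (rule hodge_structure.cmat_Yop[OF hs])

lemma cmat_CC: "w \<in> W \<Longrightarrow> cmat (CC w) = hodge_structure.cop n (f w) (weil_weight n)"
  unfolding CC_def by (rule hodge_structure.cmat_Cop[OF hs])

lemma YY_PF: "w \<in> W \<Longrightarrow> cmat (YY w) *v x = (\<Sum>r\<in>{1..n}. \<i> *s (PF w r *v x)) - (\<i> * of_nat n / 2) *s x"
  unfolding cmat_YY PF_def by (rule hodge_structure.hodge_weight_Fproj[OF hs])

lemma CC_PF: "w \<in> W \<Longrightarrow> cmat (CC w) *v x = (\<Sum>r\<le>n. weil_weight n r *s (PF w r *v x - PF w (Suc r) *v x))"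
  unfolding cmat_CC PF_def by (rule hodge_structure.cop_Fproj[OF hs])

lemma smooth_real_matrixI:
  fixes F :: "complex^'k \<Rightarrow> real^'m^'m"
  assumes "\<And>i j. smoothC W (\<lambda>w. (cmat (F w) *v axis j 1) $ i)"
  shows "smooth_on W F"
proof (intro smooth_on_vecI)
  fix i j
  have "(cmat (F w) *v axis j 1) $ i = complex_of_real (F w $ i $ j)" for w
    unfolding matrix_vector_axis by (simp add: cmat_def)
  then show "smooth_on W (\<lambda>w. F w $ i $ j)" using assms[of j i] by (simp add: smooth_on_real)
qed

lemma smooth_PF_mult: "smoothC W (\<lambda>w. (PF w r *v axis j 1) $ i)"
  unfolding matrix_vector_axis by (rule smooth_PF_entry)

lemma smooth_YY: "smooth_on W YY"
proof (rule smooth_real_matrixI)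
  fix i j
  have "smoothC W (\<lambda>w. (\<Sum>r\<in>{1..n}. \<i> * (PF w r *v axis j 1) $ i) - (\<i> * of_nat n / 2) * axis j 1 $ i)"
    using open_W by (intro smoothC_diff smoothC_sum smoothC.mult smoothC_const smooth_PF_mult)
  then show "smoothC W (\<lambda>w. (cmat (YY w) *v axis j 1) $ i)"
    by (rule smoothC_cong) (simp add: YY_PF)
qed

lemma smooth_CC: "smooth_on W CC"
proof (rule smooth_real_matrixI)
  fix i j
  have "smoothC W (\<lambda>w. \<Sum>r\<le>n. weil_weight n r * ((PF w r *v axis j 1) $ i - (PF w (Suc r) *v axis j 1) $ i))"
    using open_W by (intro smoothC_diff smoothC_sum smoothC.mult smoothC_const smooth_PF_mult)
  then show "smoothC W (\<lambda>w. (cmat (CC w) *v axis j 1) $ i)"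
    by (rule smoothC_cong) (simp add: CC_PF right_diff_distrib)
qed

lemma YY_der: "w \<in> W \<Longrightarrow> (YY has_derivative dY w) (at w)"
  using smooth_on_has_derivative(1)[OF smooth_YY] by (simp add: dY_def[abs_def])

lemma CC_der: "w \<in> W \<Longrightarrow> (CC has_derivative dC w) (at w)"
  using smooth_on_has_derivative(1)[OF smooth_CC] by (simp add: dC_def[abs_def])

lemma dY_dP:
  assumes w: "w \<in> W"
  shows "cmat (dY w v) *v x = (\<Sum>r\<in>{1..n}. \<i> *s (dP w r v *v x))"
proof -
  have 1: "((\<lambda>z. cmat (YY z) *v x) has_derivative (\<lambda>v. cmat (dY w v) *v x)) (at w)"
    by (rule bounded_linear.has_derivative[OF bounded_linear_cmat_mult YY_der[OF w]])
  have "((\<lambda>z. (\<Sum>r\<in>{1..n}. \<i> *s (PF z r *v x)) - (\<i> * of_nat n / 2) *s x) has_derivative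
      (\<lambda>v. (\<Sum>r\<in>{1..n}. \<i> *s (dP w r v *v x)) - 0)) (at w)"
    by (intro has_derivative_diff has_derivative_sum has_derivative_const
        bounded_linear.has_derivative[OF bounded_linear_vsmult_right] PF_vec_der w)
  then have "((\<lambda>z. cmat (YY z) *v x) has_derivative (\<lambda>v. (\<Sum>r\<in>{1..n}. \<i> *s (dP w r v *v x)) - 0)) (at w)"
    by (rule has_derivative_transform_within_open[OF _ open_W w]) (rule YY_PF[symmetric])
  from fun_cong[OF has_derivative_unique[OF 1 this], of v] show ?thesis by simp
qed

lemma dC_dP:
  assumes w: "w \<in> W"
  shows "cmat (dC w v) *v x = (\<Sum>r\<le>n. weil_weight n r *s (dP w r v *v x - dP w (Suc r) v *v x))"
proof -
  have 1: "((\<lambda>z. cmat (CC z) *v x) has_derivative (\<lambda>v. cmat (dC w v) *v x)) (at w)"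
    by (rule bounded_linear.has_derivative[OF bounded_linear_cmat_mult CC_der[OF w]])
  have "((\<lambda>z. \<Sum>r\<le>n. weil_weight n r *s (PF z r *v x - PF z (Suc r) *v x)) has_derivative
      (\<lambda>v. \<Sum>r\<le>n. weil_weight n r *s (dP w r v *v x - dP w (Suc r) v *v x))) (at w)"
    by (intro has_derivative_diff has_derivative_sum
        bounded_linear.has_derivative[OF bounded_linear_vsmult_right] PF_vec_der w)
  then have "((\<lambda>z. cmat (CC z) *v x) has_derivative
      (\<lambda>v. \<Sum>r\<le>n. weil_weight n r *s (dP w r v *v x - dP w (Suc r) v *v x))) (at w)"
    by (rule has_derivative_transform_within_open[OF _ open_W w]) (rule CC_PF[symmetric])
  from fun_cong[OF has_derivative_unique[OF 1 this], of v] show ?thesis .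
qed

context
  fixes w a x
  assumes w: "w \<in> W" and a: "a \<le> n" and x: "x \<in> f w a"
begin

lemma Y_x: "cmat (YY w) *v x = hodge_weight n a *s x"
  unfolding cmat_YY[OF w] by (rule hodge_structure.cop_H[OF hs[OF w] a x])

lemma C_x: "cmat (CC w) *v x = weil_weight n a *s x"
  unfolding cmat_CC[OF w] by (rule hodge_structure.cop_H[OF hs[OF w] a x])

text \<open>The vector lies in \<open>H (a - 1)\<close>, where Y has its eigenvalue lowered by i and
  C the opposite eigenvalue. For a = 0 it vanishes, as F^0 is all of H.\<close>

lemma YC_down:
  "cmat (YY w) *v (dP w a v *v x) = (hodge_weight n a - \<i>) *s (dP w a v *v x)"
  "cmat (CC w) *v (dP w a v *v x) = - (weil_weight n a *s (dP w a v *v x))"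
  "dP w a (J v) *v x = \<i> *s (dP w a v *v x)"
proof -
  have "(cmat (YY w) *v (dP w a v *v x) = (hodge_weight n a - \<i>) *s (dP w a v *v x) \<and>
    cmat (CC w) *v (dP w a v *v x) = - (weil_weight n a *s (dP w a v *v x))) \<and>
    dP w a (J v) *v x = \<i> *s (dP w a v *v x)"
  proof (cases "a = 0")
    case True
    then show ?thesis using dP_0[OF w] by simp
  next
    case False
    then have p: "dP w a v *v x \<in> f w (a - 1)" "dP w a (J v) *v x = \<i> *s (dP w a v *v x)"
      using dP_down[OF w _ _ a x, of a v] a by auto
    have "a - 1 \<le> n" using a by simp
    note cop = hodge_structure.cop_H[OF hs[OF w] this p(1)]
    have "hodge_weight n (a - 1) = hodge_weight n a - \<i>"
      using False by (simp add: hodge_weight_def of_nat_diff algebra_simps)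
    moreover have "weil_weight n (a - 1) = - weil_weight n a"
      using weil_weight_simps(4)[of "a - 1" n] False a by simp
    ultimately show ?thesis using p(2) unfolding cmat_YY[OF w] cmat_CC[OF w] cop by simp
  qed
  then show "cmat (YY w) *v (dP w a v *v x) = (hodge_weight n a - \<i>) *s (dP w a v *v x)"
    "cmat (CC w) *v (dP w a v *v x) = - (weil_weight n a *s (dP w a v *v x))"
    "dP w a (J v) *v x = \<i> *s (dP w a v *v x)" by blast+
qed

lemma YC_up:
  "cmat (YY w) *v (dP w (Suc a) v *v x) = (hodge_weight n a + \<i>) *s (dP w (Suc a) v *v x)"
  "cmat (CC w) *v (dP w (Suc a) v *v x) = - (weil_weight n a *s (dP w (Suc a) v *v x))"
  "dP w (Suc a) (J v) *v x = - (\<i> *s (dP w (Suc a) v *v x))"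
  "weil_weight n (Suc a) *s (dP w (Suc a) v *v x) = - (weil_weight n a *s (dP w (Suc a) v *v x))"
proof -
  have "((cmat (YY w) *v (dP w (Suc a) v *v x) = (hodge_weight n a + \<i>) *s (dP w (Suc a) v *v x) \<and>
    cmat (CC w) *v (dP w (Suc a) v *v x) = - (weil_weight n a *s (dP w (Suc a) v *v x))) \<and>
    dP w (Suc a) (J v) *v x = - (\<i> *s (dP w (Suc a) v *v x))) \<and>
    weil_weight n (Suc a) *s (dP w (Suc a) v *v x) = - (weil_weight n a *s (dP w (Suc a) v *v x))"
  proof (cases "a = n")
    case True
    then show ?thesis using dP_gt[OF w, of "Suc n"] by simp
  next
    case False
    then have an: "Suc a \<le> n" using a by simp
    then have p: "dP w (Suc a) v *v x \<in> f w (Suc a)" "dP w (Suc a) (J v) *v x = - (\<i> *s (dP w (Suc a) v *v x))"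
      using dP_up[OF w _ _ a x, of "Suc a" v] by auto
    note cop = hodge_structure.cop_H[OF hs[OF w] an p(1)]
    have "hodge_weight n (Suc a) = hodge_weight n a + \<i>"
      by (simp add: hodge_weight_def algebra_simps)
    moreover have "weil_weight n (Suc a) = - weil_weight n a"
      using weil_weight_simps(4)[of a n] an by simp
    ultimately show ?thesis using p(2) unfolding cmat_YY[OF w] cmat_CC[OF w] cop by simp
  qed
  then show "cmat (YY w) *v (dP w (Suc a) v *v x) = (hodge_weight n a + \<i>) *s (dP w (Suc a) v *v x)"
  "cmat (CC w) *v (dP w (Suc a) v *v x) = - (weil_weight n a *s (dP w (Suc a) v *v x))"
  "dP w (Suc a) (J v) *v x = - (\<i> *s (dP w (Suc a) v *v x))"
  "weil_weight n (Suc a) *s (dP w (Suc a) v *v x) = - (weil_weight n a *s (dP w (Suc a) v *v x))" by blast+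
qed

lemma dY_x: "cmat (dY w v) *v x = \<i> *s (dP w a v *v x + dP w (Suc a) v *v x)"
proof -
  have "cmat (dY w v) *v x = (\<Sum>r\<le>n. \<i> *s (dP w r v *v x))"
    unfolding dY_dP[OF w] by (rule sum.mono_neutral_left) (use dP_0[OF w] in \<open>auto simp: not_less_eq_eq\<close>)
  also have "\<dots> = \<i> *s (dP w a v *v x) + \<i> *s (dP w (Suc a) v *v x)"
    by (rule sum_two_terms[OF a]) (use dP_H[OF w _ _ a x] dP_gt[OF w] in auto)
  finally show ?thesis by (simp add: vec.scale_right_distrib)
qed

text \<open>In the sum of \<open>dC_dP\<close> each surviving derivative occurs twice, with
  neighbouring Weil weights; their opposite signs make the two occurrences add up, whence the factor
  2.\<close>

lemma dC_x: "cmat (dC w v) *v x = (2 * weil_weight n a) *s (dP w a v *v x - dP w (Suc a) v *v x)"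
proof -
  let ?p = "dP w a v *v x" and ?q = "dP w (Suc a) v *v x"
  have 1: "(\<Sum>r\<le>n. weil_weight n r *s (dP w r v *v x)) = weil_weight n a *s ?p - weil_weight n a *s ?q"
  proof -
    have "(\<Sum>r\<le>n. weil_weight n r *s (dP w r v *v x)) = weil_weight n a *s ?p + weil_weight n (Suc a) *s ?q"
      by (rule sum_two_terms[OF a]) (use dP_H[OF w _ _ a x] dP_gt[OF w] in auto)
    then show ?thesis unfolding YC_up(4) by simp
  qed
  have 2: "(\<Sum>r\<le>n. weil_weight n r *s (dP w (Suc r) v *v x)) = weil_weight n a *s ?q - weil_weight n a *s ?p"
  proof (cases a)
    case 0
    have "(\<Sum>r\<le>n. weil_weight n r *s (dP w (Suc r) v *v x)) = weil_weight n 0 *s (dP w (Suc 0) v *v x) + weil_weight n (Suc 0) *s (dP w (Suc (Suc 0)) v *v x)"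
      by (rule sum_two_terms) (use dP_H[OF w _ _ a x] dP_gt[OF w] 0 in auto)
    also have "dP w (Suc (Suc 0)) v *v x = 0" using dP_H[OF w _ _ a x, of "Suc (Suc 0)"] 0 by simp
    finally show ?thesis using 0 dP_0[OF w] by simp
  next
    case (Suc b)
    have "(\<Sum>r\<le>n. weil_weight n r *s (dP w (Suc r) v *v x)) = weil_weight n b *s (dP w (Suc b) v *v x) + weil_weight n (Suc b) *s (dP w (Suc (Suc b)) v *v x)"
      by (rule sum_two_terms) (use dP_H[OF w _ _ a x] dP_gt[OF w] Suc a in auto)
    moreover have "weil_weight n b = - weil_weight n a"
      using weil_weight_simps(4)[of b n] Suc a by simp
    ultimately show ?thesis using Suc by simp
  qed
  show ?thesis
    unfolding dC_dP[OF w] vec.scale_right_diff_distrib sum_subtractf 1 2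
    by (simp add: vec_eq_iff algebra_simps)
qed

lemma comm_YdY_x: "cmat (comm (YY w) (dY w v)) *v x = dP w a v *v x - dP w (Suc a) v *v x"
proof -
  have "cmat (comm (YY w) (dY w v)) *v x = cmat (YY w) *v (cmat (dY w v) *v x) - cmat (dY w v) *v (cmat (YY w) *v x)"
    by (simp add: cmat_comm matrix_vector_mult_diff_rdistrib matrix_vector_mul_assoc)
  also have "\<dots> = dP w a v *v x - dP w (Suc a) v *v x"
    unfolding Y_x vector_scalar_commute dY_x matrix_vector_right_distrib YC_down(1) YC_up(1)
    by (simp add: vec_eq_iff algebra_simps)
  finally show ?thesis .
qed

end

text \<open>J acts by i on the part lowering the degree and by - i on the part raising it; bracket
  with Y acts by - i and i.\<close>

lemma dY_J: "w \<in> W \<Longrightarrow> dY w (J v) = - comm (YY w) (dY w v)"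
proof -
  assume w: "w \<in> W"
  have "cmat (dY w (J v)) = cmat (- comm (YY w) (dY w v))"
  proof (rule hodge_structure.matrix_eqI[OF hs[OF w]])
    fix a x assume ax: "a \<le> n" "x \<in> f w a"
    show "cmat (dY w (J v)) *v x = cmat (- comm (YY w) (dY w v)) *v x"
      unfolding cmat_simps matrix_vector_mult_minus_left comm_YdY_x[OF w ax] dY_x[OF w ax] YC_down(3)[OF w ax] YC_up(3)[OF w ax]
      by (simp add: vec_eq_iff algebra_simps)
  qed
  then show ?thesis by (rule cmat_simps(6)[THEN iffD1])
qed

text \<open>[Y, dY] is the infinitesimal motion of the Hodge structure: its bracket with Y is dY,
  and here its bracket with C is dC. In \<open>lift_value\<close> it is compared with the derivative
  of a lift.\<close>

lemma dC_eq: "w \<in> W \<Longrightarrow> dC w v = comm (comm (YY w) (dY w v)) (CC w)"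
proof -
  assume w: "w \<in> W"
  have "cmat (dC w v) = cmat (comm (comm (YY w) (dY w v)) (CC w))"
  proof (rule hodge_structure.matrix_eqI[OF hs[OF w]])
    fix a x assume ax: "a \<le> n" "x \<in> f w a"
    let ?A = "comm (YY w) (dY w v)"
    have "cmat (comm ?A (CC w)) *v x = cmat ?A *v (cmat (CC w) *v x) - cmat (CC w) *v (cmat ?A *v x)"
      by (simp add: cmat_comm[of ?A] matrix_vector_mult_diff_rdistrib matrix_vector_mul_assoc)
    also have "\<dots> = (2 * weil_weight n a) *s (dP w a v *v x - dP w (Suc a) v *v x)"
      unfolding C_x[OF w ax] vector_scalar_commute comm_YdY_x[OF w ax] matrix_vector_mult_diff_distrib
        YC_down(2)[OF w ax] YC_up(2)[OF w ax]
      by (simp add: vec_eq_iff algebra_simps)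
    finally show "cmat (dC w v) *v x = cmat (comm ?A (CC w)) *v x" unfolding dC_x[OF w ax] by simp
  qed
  then show ?thesis by (rule cmat_simps(6)[THEN iffD1])
qed

text \<open>If dY vanishes, so does [Y, dY]; these are, up to i, sum and difference of the two parts
  of \<open>dP\<close> on \<open>H a\<close>. So \<open>dP\<close> is 0 and the differential of the
  chart is 0 in every Hom(F^r, H/F^r).\<close>

lemma dY_immersion:
  assumes w: "w \<in> W" and 0: "dY w v = 0"
  shows "v = 0"
proof (rule ccontr)
  assume "v \<noteq> 0"
  then obtain r \<phi> where \<phi>: "\<phi> \<in> filtration (f w) r" and ne: "differential W f w v r \<phi> \<noteq> filtration (f w) r"
    using immersion w unfolding immersion_on_def by blast
  have dP0: "dP w r v = 0" for r
  proof (rule hodge_structure.matrix_eqI[OF hs[OF w]])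
    fix a x assume ax: "a \<le> n" "x \<in> f w a"
    let ?p = "dP w a v *v x" and ?q = "dP w (Suc a) v *v x"
    have "\<i> *s (?p + ?q) = 0" unfolding dY_x[OF w ax, symmetric] 0 by simp
    then have 1: "?p + ?q = 0" by (simp only: vector_mul_eq_0) simp
    have 2: "?p - ?q = 0" using comm_YdY_x[OF w ax, of v] 0 by simp
    have "?p $ i = 0 \<and> ?q $ i = 0" for i
      using arg_cong[OF 1, of "\<lambda>u. u $ i"] arg_cong[OF 2, of "\<lambda>u. u $ i"] by simp
    then have "?p = 0" "?q = 0" by (simp_all add: vec_eq_iff)
    then show "dP w r v *v x = 0 *v x"
      using dP_H[OF w _ _ ax, of r v] by (cases "r = a \<or> r = Suc a") auto
  qed
  have sub: "s' v \<in> filtration (f w) r"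
    if s: "(s has_derivative s') (at w)" "open W'" "w \<in> W'" "W' \<subseteq> W" "\<forall>w'\<in>W'. s w' \<in> filtration (f w') r" for s s' W'
  proof -
    have "PF z r *v s z = s z" if "z \<in> W'" for z using s(4,5) that filtration_PF by blast
    then have "dP w r v *v s w = s' v - PF w r *v s' v" by (rule PF_section_der[OF w s(1-3)])
    then show ?thesis by (simp add: dP0 filtration_PF[OF w])
  qed
  have add: "x + y \<in> filtration (f w) r" "x - y \<in> filtration (f w) r"
    if "x \<in> filtration (f w) r" "y \<in> filtration (f w) r" for x y
    using that by (auto simp: filtration_PF[OF w] matrix_vector_right_distrib matrix_vector_mult_diff_distrib)
  have "differential W f w v r \<phi> = filtration (f w) r"
  proof (intro equalityI subsetI)
    fix y assume "y \<in> differential W f w v r \<phi>"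
    then show "y \<in> filtration (f w) r" unfolding differential_def using sub add(1) by blast
  next
    \<comment> \<open>This inclusion needs an actual holomorphic section through \<phi>, without
      which \<open>differential\<close> would be empty.\<close>
    fix y assume y: "y \<in> filtration (f w) r"
    obtain W' A where W': "open W'" "w \<in> W'" "W' \<subseteq> W" and A: "\<And>x. holo_on W' (\<lambda>w. A w *v x)" "A w = PF w r"
      "\<And>w x. w \<in> W' \<Longrightarrow> PF w r *v (A w *v x) = A w *v x"
      by (rule local_frame[OF w, of r]) blast
    define s where "s z = A z *v \<phi>" for z
    have hol: "holo_on W' s" unfolding s_def using A(1) .
    then obtain s' where s': "(s has_derivative s') (at w)" using W'(2) unfolding holo_on_def by blast
    have sw: "s w = \<phi>" using \<phi> by (simp add: s_def A(2) filtration_PF[OF w])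
    have sF: "\<forall>w'\<in>W'. s w' \<in> filtration (f w') r" using A(3) W'(3) by (auto simp: s_def filtration_PF)
    have "s' v \<in> filtration (f w) r" by (rule sub[OF s' W' sF])
    then have "y - s' v \<in> filtration (f w) r" using add y by blast
    moreover have "y = s' v + (y - s' v)" by simp
    ultimately show "y \<in> differential W f w v r \<phi>"
      unfolding differential_def using s' W' hol sw sF by blast
  qed
  then show False using ne by simp
qed

end

section \<open>The pulled back metric\<close>

text \<open>The inverse function theorem for squaring at 1, where the derivative is multiplication
  by 2. U carries the uniqueness of roots, V their existence.\<close>

lemma matrix_square_root:
  obtains r r' U V where "open (U :: (real^'m^'m) set)" "mat 1 \<in> U" "open V" "mat 1 \<in> V" "r (mat 1) = mat 1"
    "(r has_derivative r') (at (mat 1 :: real^'m^'m))"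
    "\<And>T. T \<in> V \<Longrightarrow> r T ** r T = T" "\<And>X X'. X \<in> U \<Longrightarrow> X' \<in> U \<Longrightarrow> X ** X = X' ** X' \<Longrightarrow> X = X'"
proof -
  let ?sq = "\<lambda>X :: real^'m^'m. X ** X"
  have bl: "bounded_linear (\<lambda>H. X ** H + H ** X)" for X :: "real^'m^'m"
    by (simp add: linear_conv_bounded_linear[symmetric] linear_iff matrix_ring_simps scaleR_add_right algebra_simps)
  define D where "D X = Blinfun (\<lambda>H :: real^'m^'m. X ** H + H ** X)" for X
  have D: "blinfun_apply (D X) = (\<lambda>H. X ** H + H ** X)" for X
    unfolding D_def using bl by (rule bounded_linear_Blinfun_apply)
  have d: "(?sq has_derivative blinfun_apply (D X)) (at X)" for X
    unfolding D by (rule bounded_bilinear.FDERIV[OF bounded_bilinear_matrix_mult has_derivative_ident has_derivative_ident])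
  have c: "continuous_on UNIV D"
  proof (rule continuous_on_blinfun_componentwise)
    show "continuous_on UNIV (\<lambda>X. blinfun_apply (D X) i)" for i
      unfolding D by (intro continuous_on_add bounded_bilinear.continuous_on[OF bounded_bilinear_matrix_mult] continuous_on_id continuous_on_const)
  qed
  have i: "(1/2) *\<^sub>R id_blinfun o\<^sub>L D (mat 1) = id_blinfun"
  proof (rule blinfun_eqI)
    fix H :: "real^'m^'m"
    have "(1/2) *\<^sub>R (H + H) = H" by (metis scaleR_half_double)
    then show "blinfun_apply ((1/2) *\<^sub>R id_blinfun o\<^sub>L D (mat 1)) H = blinfun_apply id_blinfun H"
      by (simp only: blinfun_apply_blinfun_compose blinfun.scaleR_left D id_blinfun.rep_eq matrix_mul_lid matrix_mul_rid id_apply)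
  qed
  obtain U' V g g' where g: "open U'" "U' \<subseteq> UNIV" "mat 1 \<in> U'" "open V" "?sq (mat 1) \<in> V" "homeomorphism U' V ?sq g"
    "\<And>y. y \<in> V \<Longrightarrow> (g has_derivative (g' y)) (at y)"
    "\<And>y. y \<in> V \<Longrightarrow> g' y = inv (blinfun_apply (D (g y)))" "\<And>y. y \<in> V \<Longrightarrow> bij (blinfun_apply (D (g y)))"
  proof (rule inverse_function_theorem[OF open_UNIV, of ?sq D "mat 1" "(1/2) *\<^sub>R id_blinfun", OF d c UNIV_I i])
    fix U' V g g'
    assume a: "open U'" "U' \<subseteq> UNIV" "mat 1 \<in> U'" "open V" "?sq (mat 1) \<in> V" "homeomorphism U' V ?sq g"
      "\<And>y. y \<in> V \<Longrightarrow> (g has_derivative (g' y)) (at y)"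
      "\<And>y. y \<in> V \<Longrightarrow> g' y = inv (blinfun_apply (D (g y)))" "\<And>y. y \<in> V \<Longrightarrow> bij (blinfun_apply (D (g y)))"
    show thesis by (rule that[OF a])
  qed
  have hom: "g (?sq X) = X" if "X \<in> U'" for X using g(6) that by (auto simp: homeomorphism_def)
  have hom2: "?sq (g T) = T" if "T \<in> V" for T using g(6) that by (auto simp: homeomorphism_def)
  show ?thesis
  proof (rule that[of U' V g "g' (mat 1)"])
    show "g (mat 1) = mat 1" using hom[OF g(3)] by simp
    show "(g has_derivative g' (mat 1)) (at (mat 1))" using g(7)[of "mat 1"] g(5) by simp
    show "X = X'" if "X \<in> U'" "X' \<in> U'" "X ** X = X' ** X'" for X X'
      using hom[OF that(1)] unfolding that(3) hom[OF that(2)] ..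
    show "mat 1 \<in> V" using g(5) by simp
    show "g T ** g T = T" if "T \<in> V" for T using hom2[OF that] .
  qed (fact g)+
qed

section \<open>Isometries, and cosets of K as Weil operators\<close>

context hodge_structure begin

lemma Aut_mult: "a \<in> Aut Q \<Longrightarrow> b \<in> Aut Q \<Longrightarrow> a ** b \<in> Aut Q"
  by (simp add: Aut_iff flip: matrix_vector_mul_assoc)

lemma Aut_inv:
  assumes "a \<in> Aut Q"
  shows "a ** matrix_inv a = mat 1" "matrix_inv a ** a = mat 1" "matrix_inv a \<in> Aut Q"
proof -
  have inv: "invertible a" using assms by (simp add: Aut_def)
  then show 1: "a ** matrix_inv a = mat 1" and "matrix_inv a ** a = mat 1"
    by (rule matrix_inv_right, rule matrix_inv_left)
  have "qform Q (matrix_inv a *v x) (matrix_inv a *v y) = qform Q (a *v (matrix_inv a *v x)) (a *v (matrix_inv a *v y))" for x y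
    using assms by (simp add: Aut_iff)
  then show "matrix_inv a \<in> Aut Q" by (simp add: Aut_iff matrix_vector_mul_assoc 1)
qed

lemma Aut_adj: "a \<in> Aut Q \<longleftrightarrow> adj a ** a = mat 1"
proof -
  have e: "qform Q (a *v x) (a *v y) = x \<bullet> ((transpose a ** q ** a) *v y)" for x y
    using dot_lmul_matrix[of "q *v (a *v y)" a x]
    by (simp add: qform_gram inner_commute flip: matrix_vector_mul_assoc)
  have "a \<in> Aut Q \<longleftrightarrow> transpose a ** q ** a = q"
  proof
    assume "a \<in> Aut Q"
    then have "x \<bullet> ((transpose a ** q ** a - q) *v y) = 0" for x y
      using e[of x y] by (simp add: Aut_iff matrix_vector_mult_diff_rdistrib inner_diff_right qform_gram)
    then show "transpose a ** q ** a = q" using inner_eq_0_matrix[of "transpose a ** q ** a - q"] by simp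
  next
    assume "transpose a ** q ** a = q"
    then show "a \<in> Aut Q" using e by (simp add: Aut_iff qform_gram)
  qed
  also have "\<dots> \<longleftrightarrow> adj a ** a = mat 1"
  proof
    assume "transpose a ** q ** a = q"
    then have "qi ** (transpose a ** q ** a) = qi ** q" by simp
    then show "adj a ** a = mat 1" by (simp add: adj_def matrix_mul_assoc q_inv)
  next
    assume "adj a ** a = mat 1"
    then have "q ** (adj a ** a) = q" by simp
    then show "transpose a ** q ** a = q" unfolding adj_def matrix_mul_assoc q_inv by simp
  qed
  finally show ?thesis .
qed

lemma adj_mult: "adj (a ** b) = adj b ** adj a"
proof -
  have "adj b ** adj a = qi ** transpose b ** (q ** qi) ** transpose a ** q" by (simp add: adj_def matrix_mul_assoc)
  then show ?thesis by (simp add: q_inv adj_def matrix_transpose_mul matrix_mul_assoc)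
qed

lemma Cop_Aut: "Cop \<in> Aut Q"
  using qform_Cop_real by (simp add: Aut_iff)

lemma Cop_inv: "matrix_inv Cop = (-1) ^ n *\<^sub>R Cop"
proof -
  have "matrix_inv Cop = matrix_inv Cop ** (Cop ** ((-1) ^ n *\<^sub>R Cop))"
    by (simp add: matrix_ring_simps Cop_Cop flip: power_mult_distrib)
  also have "\<dots> = (-1) ^ n *\<^sub>R Cop"
    unfolding matrix_mul_assoc matrix_inv_left[OF Cop_invertible] by simp
  finally show ?thesis .
qed

lemma conj_so:
  assumes a: "a \<in> Aut Q" and X: "X \<in> so Q"
  shows "matrix_inv a ** X ** a \<in> so Q"
  unfolding so_iff
proof (intro allI)
  fix x y
  have iso: "qform Q (a *v x) (a *v y) = qform Q x y" for x y using a by (simp add: Aut_iff)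
  have aX: "a *v ((matrix_inv a ** X ** a) *v x) = X *v (a *v x)" for x
  proof -
    have "a ** (matrix_inv a ** X ** a) = X ** a"
      using Aut_inv(1)[OF a] by (simp add: matrix_mul_assoc)
    then show ?thesis by (simp add: matrix_vector_mul_assoc)
  qed
  have "qform Q ((matrix_inv a ** X ** a) *v x) y = qform Q (X *v (a *v x)) (a *v y)"
    "qform Q x ((matrix_inv a ** X ** a) *v y) = qform Q (a *v x) (X *v (a *v y))"
    unfolding aX[symmetric] iso by simp_all
  then show "qform Q ((matrix_inv a ** X ** a) *v x) y + qform Q x ((matrix_inv a ** X ** a) *v y) = 0"
    using X[unfolded so_iff, rule_format, of "a *v x" "a *v y"] by simp
qed

text \<open>K is the centralizer of C, so the coset a K is determined by the conjugate of C by a. Z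
  is that conjugate for b, stated without inverses.\<close>

lemma coset_eq_iff:
  assumes a: "a \<in> Aut Q" and b: "b \<in> Aut Q" and Z: "Z ** b = b ** Cop"
  shows "coset n Q H a = coset n Q H b \<longleftrightarrow> Z ** a = a ** Cop"
proof
  assume eq: "coset n Q H a = coset n Q H b"
  have "mat 1 \<in> stab_K n (Aut Q) H" by (simp add: stab_K_eq Aut_iff)
  then have "a \<in> coset n Q H a" unfolding coset_def by (metis image_eqI matrix_mul_rid)
  then have "a \<in> coset n Q H b" using eq by simp
  then obtain k where k: "k ** Cop = Cop ** k" "a = b ** k" by (auto simp: coset_def stab_K_eq)
  have "Z ** a = b ** (Cop ** k)" unfolding k(2) matrix_mul_assoc Z ..
  then show "Z ** a = a ** Cop" unfolding k(1)[symmetric] k(2) by (simp add: matrix_mul_assoc)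
next
  assume Za: "Z ** a = a ** Cop"
  have sub: "coset n Q H a \<subseteq> coset n Q H b"
    if a: "a \<in> Aut Q" and b: "b \<in> Aut Q" and Z: "Z ** b = b ** Cop" and Za: "Z ** a = a ** Cop" for a b
  proof -
    define k where "k = matrix_inv b ** a"
    have ak: "a = b ** k" unfolding k_def matrix_mul_assoc Aut_inv(1)[OF b] by simp
    have "matrix_inv b ** Z = matrix_inv b ** (Z ** b) ** matrix_inv b"
      by (simp add: Aut_inv[OF b] flip: matrix_mul_assoc)
    also have "\<dots> = Cop ** matrix_inv b"
      unfolding Z by (simp add: Aut_inv[OF b] matrix_mul_assoc)
    finally have bZ: "matrix_inv b ** Z = Cop ** matrix_inv b" .
    have kC: "k ** Cop = Cop ** k"
      unfolding k_def matrix_mul_assoc[symmetric] Za[symmetric] unfolding matrix_mul_assoc bZ ..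
    have kA: "k \<in> Aut Q" unfolding k_def by (intro Aut_mult Aut_inv(3) a b)
    show ?thesis
    proof
      fix c assume "c \<in> coset n Q H a"
      then obtain k' where k': "k' \<in> Aut Q" "k' ** Cop = Cop ** k'" "c = a ** k'" by (auto simp: coset_def stab_K_eq)
      have "(k ** k') ** Cop = Cop ** (k ** k')"
        unfolding matrix_mul_assoc[symmetric] k'(2) unfolding matrix_mul_assoc kC ..
      then have "k ** k' \<in> stab_K n (Aut Q) H" using kA k' Aut_mult by (simp add: stab_K_eq)
      moreover have "c = b ** (k ** k')" using k'(3) ak by (simp add: matrix_mul_assoc)
      ultimately show "c \<in> coset n Q H b" by (auto simp: coset_def)
    qed
  qed
  show "coset n Q H a = coset n Q H b" using sub[OF a b Z Za] sub[OF b a Za Z] by blast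
qed

end

lemma (in two_hodge_structures) act_operators:
  assumes a: "H' = act a H"
  shows "H'.Cop ** a = a ** Cop" "H'.Yop ** a = a ** Yop"
proof -
  have "cmat a *v x \<in> H' r" if "x \<in> H r" for x r
    using that by (auto simp: a act_def cmul_eq)
  then have "H'.cop \<mu> ** cmat a = cmat a ** cop \<mu>" for \<mu>
    by (intro matrix_eqI) (simp add: cop_H H'.cop_H vector_scalar_commute flip: matrix_vector_mul_assoc)
  then have "cmat (H'.Cop ** a) = cmat (a ** Cop)" "cmat (H'.Yop ** a) = cmat (a ** Yop)"
    by (simp_all only: cmat_mult cmat_Cop H'.cmat_Cop cmat_Yop H'.cmat_Yop)
  then show "H'.Cop ** a = a ** Cop" "H'.Yop ** a = a ** Yop" by (simp_all only: cmat_simps(6))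
qed

text \<open>All group elements carrying H to H' conjugate \<open>Cop\<close> to the same operator,
  hence lie in one coset; so the description in \<open>proj\<close> is met exactly once.\<close>

lemma (in two_hodge_structures) proj_eq:
  assumes b: "b \<in> Aut Q" "H' = act b H"
  shows "proj n Q H H' = coset n Q H b"
  unfolding proj_def
proof (rule the_equality)
  show "\<exists>a\<in>Aut Q. H' = act a H \<and> coset n Q H b = coset n Q H a" using b by blast
  fix c assume "\<exists>a\<in>Aut Q. H' = act a H \<and> c = coset n Q H a"
  then obtain a where a: "a \<in> Aut Q" "H' = act a H" "c = coset n Q H a" by blast
  show "c = coset n Q H b"
    unfolding a(3) coset_eq_iff[OF a(1) b(1) act_operators(1)[OF b(2)]] by (rule act_operators(1)[OF a(2)])
qed

section \<open>Lifts to the group and the pulled back metric\<close>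

locale based_chart = hodge_chart n Q h W f + base: hodge_structure n Q h H0
  for n Q h W and f :: "complex^'k \<Rightarrow> 'm::finite decomp" and H0
begin

lemma two: "w \<in> W \<Longrightarrow> two_hodge_structures n Q h H0 (f w)"
  using hs base.hodge_structure_axioms by (simp add: two_hodge_structures_def)

lemma base_point:
  assumes w: "w \<in> W"
  obtains b where "b \<in> Aut Q" "f w = act b H0" "CC w ** b = b ** base.Cop" "YY w ** b = b ** base.Yop"
proof -
  interpret two_hodge_structures n Q h H0 "f w" by (rule two[OF w])
  obtain b where "b \<in> Aut Q" "f w = act b H0" using transitive by blast
  then show ?thesis using that act_operators unfolding CC_def YY_def by blast
qed

text \<open>By \<open>coset_eq_iff\<close> the point of the symmetric space below f w is recorded by
  the Weil operator \<open>CC w\<close>; lifts become solutions of a matrix equation.\<close>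

lemma proj_iff:
  assumes w: "w \<in> W" and a: "a \<in> Aut Q"
  shows "proj n Q H0 (f w) = coset n Q H0 a \<longleftrightarrow> CC w ** a = a ** base.Cop"
proof -
  obtain b where b: "b \<in> Aut Q" "f w = act b H0" "CC w ** b = b ** base.Cop" "YY w ** b = b ** base.Yop"
    by (rule base_point[OF w])
  have "proj n Q H0 (f w) = coset n Q H0 b"
    using two_hodge_structures.proj_eq[OF two[OF w] b(1,2)] .
  then show ?thesis using base.coset_eq_iff[OF a b(1,3)] by auto
qed

lemma CC_facts:
  assumes w: "w \<in> W"
  shows "CC w \<in> Aut Q" "matrix_inv (CC w) = (-1) ^ n *\<^sub>R CC w" "CC w ** CC w = (-1) ^ n *\<^sub>R mat 1"
  unfolding CC_def
  using hodge_structure.Cop_Aut[OF hs[OF w]] hodge_structure.Cop_inv[OF hs[OF w]] hodge_structure.Cop_Cop[OF hs[OF w]]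
  by auto

text \<open>
  The matrix \<open>C(z) C(w)\<^sup>-\<^sup>1\<close> is an isometry, and conjugation by \<open>C(w)\<close> inverts it; by local uniqueness
  of square roots near \<open>1\<close>, its root has the same two properties, so it conjugates \<open>C(w)\<close> to \<open>C(z)\<close>.
\<close>

lemma exists_lift:
  assumes w: "w \<in> W"
  shows "\<exists>a a'. (\<forall>\<^sub>F z in nhds w. a z \<in> Aut Q \<and> proj n Q H0 (f z) = coset n Q H0 (a z)) \<and> (a has_derivative a') (at w)"
proof -
  obtain b where b: "b \<in> Aut Q" "f w = act b H0" "CC w ** b = b ** base.Cop" "YY w ** b = b ** base.Yop"
    by (rule base_point[OF w])
  obtain r r' U V where UV: "open (U :: (real^'m^'m) set)" "mat 1 \<in> U" "open V" "mat 1 \<in> V" and r1: "r (mat 1) = mat 1"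
    and r': "(r has_derivative r') (at (mat 1 :: real^'m^'m))"
    and rr: "\<And>T. T \<in> V \<Longrightarrow> r T ** r T = T" and inj: "\<And>X X'. X \<in> U \<Longrightarrow> X' \<in> U \<Longrightarrow> X ** X = X' ** X' \<Longrightarrow> X = X'"
    by (rule matrix_square_root) blast
  define e :: real where "e = (-1) ^ n"
  have ee: "e * e = 1" by (simp add: e_def flip: power_mult_distrib)
  \<comment> \<open>The inverse of \<open>CC w\<close> is e times itself, so T z is C(z) C(w)^(-1),
    and Ti z below is its inverse.\<close>
  define T where "T z = e *\<^sub>R (CC z ** CC w)" for z
  define Ti where "Ti z = e *\<^sub>R (CC w ** CC z)" for z
  have CCe: "CC z ** CC z = e *\<^sub>R mat 1" if "z \<in> W" for z using CC_facts(3)[OF that] by (simp add: e_def)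
  have Tw: "T w = mat 1" "Ti w = mat 1" using CCe[OF w] ee by (simp_all add: T_def Ti_def)
  have TTi: "T z ** Ti z = mat 1" "Ti z ** T z = mat 1" if z: "z \<in> W" for z
  proof -
    have "T z ** Ti z = (e * e) *\<^sub>R (CC z ** (CC w ** CC w) ** CC z)" by (simp add: T_def Ti_def matrix_ring_simps)
    then show "T z ** Ti z = mat 1" by (simp add: CCe[OF w] CCe[OF z] matrix_ring_simps ee)
    have "Ti z ** T z = (e * e) *\<^sub>R (CC w ** (CC z ** CC z) ** CC w)" by (simp add: T_def Ti_def matrix_ring_simps)
    then show "Ti z ** T z = mat 1" by (simp add: CCe[OF w] CCe[OF z] matrix_ring_simps ee)
  qed
  have derT: "(T has_derivative (\<lambda>v. e *\<^sub>R (CC w ** 0 + dC w v ** CC w))) (at w)"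
    unfolding T_def by (intro has_derivative_scaleR_right bounded_bilinear.FDERIV[OF bounded_bilinear_matrix_mult CC_der[OF w] has_derivative_const])
  then have cT: "isCont T w" by (rule has_derivative_continuous)
  have "isCont CC w" using CC_der[OF w] by (rule has_derivative_continuous)
  then have cTi: "isCont Ti w" unfolding Ti_def
    by (intro continuous_intros bounded_bilinear.isCont[OF bounded_bilinear_matrix_mult])
  have cr: "isCont r (mat 1)" using r' by (rule has_derivative_continuous)
  have crT: "isCont (\<lambda>z. r (T z)) w" using isCont_o2[OF cT] cr by (simp add: Tw)
  define B where "B z = r (T z)" for z
  have cB: "isCont B w" unfolding B_def by (rule crT)
  have Bw: "B w = mat 1" by (simp add: B_def Tw r1)
  have c1: "isCont (\<lambda>z. base.adj (B z)) w"
    by (rule bounded_linear.isCont[OF base.linear_adj[unfolded linear_conv_bounded_linear] cB])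
  have c2: "isCont (\<lambda>z. Ti z ** B z) w" by (intro bounded_bilinear.isCont[OF bounded_bilinear_matrix_mult] cTi cB)
  have c3: "isCont (\<lambda>z. e *\<^sub>R (CC w ** B z ** CC w)) w"
    by (intro continuous_intros bounded_bilinear.isCont[OF bounded_bilinear_matrix_mult] cB)
  have adj1: "base.adj (mat 1) = mat 1" by (simp add: base.adj_def transpose_mat base.q_inv)
  have ev': "\<forall>\<^sub>F z in nhds w. F z \<in> S" if "isCont F w" "F w \<in> S" "open S" for F :: "complex^'k \<Rightarrow> real^'m^'m" and S
  proof -
    have "(F \<longlongrightarrow> F w) (nhds w)" using that(1) by (simp add: isCont_def tendsto_at_iff_tendsto_nhds)
    from topological_tendstoD[OF this that(3,2)] show ?thesis .
  qed
  have ev: "\<forall>\<^sub>F z in nhds w. F z \<in> U" if "isCont F w" "F w = mat 1" for F :: "complex^'k \<Rightarrow> real^'m^'m"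
    using ev'[OF that(1) _ UV(1)] that(2) UV(2) by simp
  have evV: "\<forall>\<^sub>F z in nhds w. T z \<in> V" using ev'[OF cT _ UV(3)] Tw UV(4) by simp
  have evW: "\<forall>\<^sub>F z in nhds w. z \<in> W" using open_W w by (rule eventually_nhds_in_open)
  have "\<forall>\<^sub>F z in nhds w. base.adj (B z) \<in> U" by (rule ev[OF c1]) (simp add: Bw adj1)
  moreover have "\<forall>\<^sub>F z in nhds w. Ti z ** B z \<in> U" by (rule ev[OF c2]) (simp add: Bw Tw)
  moreover have "\<forall>\<^sub>F z in nhds w. e *\<^sub>R (CC w ** B z ** CC w) \<in> U"
    by (rule ev[OF c3]) (simp add: Bw CCe[OF w] ee)
  ultimately have "\<forall>\<^sub>F z in nhds w. z \<in> W \<and> T z \<in> V \<and> base.adj (B z) \<in> U \<and> Ti z ** B z \<in> U \<and> e *\<^sub>R (CC w ** B z ** CC w) \<in> U"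
    using evW evV by (intro eventually_conj)
  then have lift: "\<forall>\<^sub>F z in nhds w. B z ** b \<in> Aut Q \<and> proj n Q H0 (f z) = coset n Q H0 (B z ** b)"
  proof eventually_elim
    case (elim z)
    then have z: "z \<in> W" and BB: "B z ** B z = T z" using rr by (auto simp: B_def)
    have BTi: "B z ** Ti z = Ti z ** B z"
    proof -
      have "Ti z ** B z ** T z = B z"
      proof -
        have "B z ** T z = T z ** B z" unfolding BB[symmetric] by (simp add: matrix_mul_assoc)
        then have "Ti z ** (B z ** T z) = Ti z ** T z ** B z" by (simp add: matrix_mul_assoc)
        then show ?thesis using TTi(2)[OF z] by (simp add: matrix_mul_assoc)
      qed
      then have "Ti z ** B z ** (T z ** Ti z) = B z ** Ti z" by (simp add: matrix_mul_assoc)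
      then show ?thesis using TTi(1)[OF z] by simp
    qed
    \<comment> \<open>The inverse of B. It is compared with \<open>adj B\<close> and with the
      conjugate of B by C(w): all three are square roots of Ti z in U, hence equal.\<close>
    let ?Bi = "Ti z ** B z"
    have BiB: "?Bi ** B z = mat 1" unfolding matrix_mul_assoc[symmetric] BB using TTi[OF z] by simp
    have Bi2: "?Bi ** ?Bi = Ti z"
    proof -
      have "?Bi ** ?Bi = Ti z ** (B z ** Ti z) ** B z" by (simp add: matrix_mul_assoc)
      also have "\<dots> = Ti z ** Ti z ** (B z ** B z)" unfolding BTi by (simp add: matrix_mul_assoc)
      also have "\<dots> = Ti z" unfolding BB using TTi[OF z] by (simp flip: matrix_mul_assoc)
      finally show ?thesis .
    qed
    have TA: "base.adj (T z) = Ti z"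
    proof -
      have CA: "base.adj (CC z) = e *\<^sub>R CC z" if "z \<in> W" for z
      proof -
        have "base.adj (CC z) = base.adj (CC z) ** (CC z ** (e *\<^sub>R CC z))"
          by (simp add: matrix_ring_simps CCe[OF that] ee)
        also have "\<dots> = e *\<^sub>R CC z" using CC_facts(1)[OF that] by (simp add: base.Aut_adj matrix_mul_assoc)
        finally show ?thesis .
      qed
      have "base.adj (T z) = e *\<^sub>R (base.adj (CC w) ** base.adj (CC z))"
        using base.linear_adj by (simp add: T_def linear_cmul base.adj_mult)
      also have "\<dots> = Ti z" unfolding CA[OF z] CA[OF w] by (simp add: Ti_def matrix_ring_simps ee)
      finally show ?thesis .
    qed
    have "base.adj (B z) ** base.adj (B z) = Ti z" unfolding base.adj_mult[symmetric] BB TA ..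
    then have adjB: "base.adj (B z) = ?Bi" using inj elim Bi2 by simp
    have BA: "B z \<in> Aut Q" unfolding base.Aut_adj adjB by (rule BiB)
    let ?Bc = "e *\<^sub>R (CC w ** B z ** CC w)"
    have "?Bc ** ?Bc = (e * e) *\<^sub>R (CC w ** B z ** (CC w ** CC w) ** B z ** CC w)" by (simp add: matrix_ring_simps)
    also have "\<dots> = e *\<^sub>R (CC w ** (B z ** B z) ** CC w)" by (simp add: CCe[OF w] matrix_ring_simps ee)
    also have "\<dots> = (e * e) *\<^sub>R (CC w ** CC z ** (CC w ** CC w))" unfolding BB T_def by (simp add: matrix_ring_simps)
    also have "\<dots> = Ti z" unfolding CCe[OF w] by (simp add: Ti_def matrix_ring_simps ee)
    finally have Bc: "?Bc = ?Bi" using inj elim Bi2 by simp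
    have "CC w ** ?Bc = (e * e) *\<^sub>R (B z ** CC w)"
    proof -
      have "CC w ** ?Bc = e *\<^sub>R ((CC w ** CC w) ** B z ** CC w)" by (simp add: matrix_ring_simps)
      then show ?thesis by (simp add: CCe[OF w] matrix_ring_simps)
    qed
    then have BC: "B z ** CC w = CC w ** ?Bi" unfolding Bc ee by simp
    have "CC z = T z ** CC w"
    proof -
      have "T z ** CC w = e *\<^sub>R (CC z ** (CC w ** CC w))" by (simp add: T_def matrix_ring_simps)
      then show ?thesis by (simp add: CCe[OF w] matrix_ring_simps ee)
    qed
    then have "CC z ** B z = B z ** (B z ** CC w) ** B z" unfolding BB[symmetric] by (simp add: matrix_mul_assoc)
    also have "\<dots> = B z ** (CC w ** ?Bi) ** B z" unfolding BC ..
    also have "\<dots> = B z ** CC w ** (?Bi ** B z)" by (simp add: matrix_mul_assoc)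
    finally have CB: "CC z ** B z = B z ** CC w" unfolding BiB by simp
    have "CC z ** (B z ** b) = B z ** (CC w ** b)" unfolding matrix_mul_assoc CB ..
    then have "CC z ** (B z ** b) = (B z ** b) ** base.Cop" unfolding b(3) by (simp add: matrix_mul_assoc)
    moreover have A: "B z ** b \<in> Aut Q" by (rule base.Aut_mult[OF BA b(1)])
    ultimately show ?case using proj_iff[OF z A] by simp
  qed
  have "(r has_derivative r') (at (T w))" using r' by (simp add: Tw)
  then have "(B has_derivative (\<lambda>v. r' (e *\<^sub>R (CC w ** 0 + dC w v ** CC w)))) (at w)"
    unfolding B_def by (rule has_derivative_compose[OF derT])
  then have der: "((\<lambda>z. B z ** b) has_derivative (\<lambda>v. B w ** 0 + r' (e *\<^sub>R (CC w ** 0 + dC w v ** CC w)) ** b)) (at w)"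
    by (rule bounded_bilinear.FDERIV[OF bounded_bilinear_matrix_mult _ has_derivative_const])
  show ?thesis by (rule exI[of _ "\<lambda>z. B z ** b"], rule exI, rule conjI[OF lift der])
qed


lemma period_chart:
  assumes "0 < \<kappa>"
  shows "period_chart W YY CC (skew_op Q) (so Q) \<kappa>"
proof (rule period_chart.intro)
  show "smooth_on W YY" by (rule smooth_YY)
  show "linear (skew_op Q)" by (rule linear_skew_op)
  show "so Q = {X. skew_op Q X = 0}" by (rule so_def)
  show "comm X Z \<in> so Q" if "X \<in> so Q" "Z \<in> so Q" for X Z using comm_so that by blast
  fix w assume w: "w \<in> W"
  interpret hodge_structure n Q h "f w" by (rule hs[OF w])
  show "YY w \<in> so Q" unfolding YY_def so_iff using qform_Yop_real by blast
  show "invertible (CC w)" unfolding CC_def by (rule Cop_invertible)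
  show "CC w ** YY w = YY w ** CC w" unfolding CC_def YY_def by (rule Cop_Yop)
  show "CC w ** X = - (X ** CC w)" if "comm (YY w) (comm (YY w) X) = - X" for X
    using that unfolding CC_def YY_def by (rule odd_if_grade_one)
  show "trace_form X X \<le> 0" if "X \<in> so Q" "CC w ** X = X ** CC w" for X
    using that trace_form_even unfolding CC_def so_iff by blast
  show "0 < trace_form X X" if "X \<in> so Q" "CC w ** X = - (X ** CC w)" "X \<noteq> 0" for X
    using that trace_form_odd unfolding CC_def so_iff by blast
  show "frechet_derivative YY (at w) (J u) = - comm (YY w) (frechet_derivative YY (at w) u)" for u
    using dY_J[OF w] by (simp add: dY_def)
  show "u = 0" if "frechet_derivative YY (at w) u = 0" for u
    using dY_immersion[OF w] that by (simp add: dY_def)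
qed (rule assms)

text \<open>Differentiating CC a = a C0 shows that a^(-1) a' minus P commutes with C0, where P is
  [Y, dY] conjugated to the base point by a. As P anticommutes with C0, it is the component in
  \<open>p_part\<close>, whatever the lift; its trace products do not depend on a.\<close>

lemma lift_value:
  assumes w: "w \<in> W" and K: "base.killing_factor \<noteq> 0"
    and lift: "\<forall>\<^sub>F z in nhds w. a z \<in> Aut Q \<and> proj n Q H0 (f z) = coset n Q H0 (a z)"
    and a': "(a has_derivative a') (at w)"
  shows "killing (lie_algebra (Aut Q)) (p_proj n Q H0 (matrix_inv (a w) ** a' u)) (p_proj n Q H0 (matrix_inv (a w) ** a' v))
    = base.killing_factor * trace_form (dY w u) (dY w v)"
proof -
  interpret pc: period_chart W YY CC "skew_op Q" "so Q" 1 by (rule period_chart) simp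
  let ?C0 = "base.Cop"
  have aw: "a w \<in> Aut Q" using eventually_nhds_x_imp_x[OF lift] by blast
  note inv = base.Aut_inv[OF aw]
  have ev: "\<forall>\<^sub>F z in nhds w. CC z ** a z = a z ** ?C0"
    using lift eventually_nhds_in_open[OF open_W w]
    by eventually_elim (use proj_iff in blast)
  have Ca: "CC w ** a w = a w ** ?C0" using eventually_nhds_x_imp_x[OF ev] .
  have D: "CC w ** a' v + dC w v ** a w = a' v ** ?C0" for v
  proof -
    have "((\<lambda>z. CC z ** a z) has_derivative (\<lambda>v. CC w ** a' v + dC w v ** a w)) (at w)"
      by (rule bounded_bilinear.FDERIV[OF bounded_bilinear_matrix_mult CC_der[OF w] a'])
    then have "((\<lambda>z. a z ** ?C0) has_derivative (\<lambda>v. CC w ** a' v + dC w v ** a w)) (at w)"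
    proof (rule has_derivative_transform_eventually)
      show "\<forall>\<^sub>F z in at w. CC z ** a z = a z ** ?C0"
        using ev unfolding eventually_nhds_conv_at by blast
    qed (use Ca in auto)
    moreover have "((\<lambda>z. a z ** ?C0) has_derivative (\<lambda>v. a w ** 0 + a' v ** ?C0)) (at w)"
      by (rule bounded_bilinear.FDERIV[OF bounded_bilinear_matrix_mult a' has_derivative_const])
    ultimately have "(\<lambda>v. CC w ** a' v + dC w v ** a w) = (\<lambda>v. a w ** 0 + a' v ** ?C0)"
      by (rule has_derivative_unique)
    from fun_cong[OF this, of v] show ?thesis by (simp add: matrix_mult_zero_right)
  qed
  define A where "A v = comm (YY w) (dY w v)" for v
  define P where "P v = matrix_inv (a w) ** A v ** a w" for v
  have dYso: "dY w v \<in> so Q" for v using pc.d1_\<gg>[OF w, of v] by (simp add: pc.d1_def dY_def)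
  have YYso: "YY w \<in> so Q" by (rule pc.Y_\<gg>[OF w])
  have Aso: "A v \<in> so Q" for v unfolding A_def by (rule comm_so[OF YYso dYso])
  have DD: "comm (YY w) (comm (YY w) (dY w v)) = - dY w v" for v
    using pc.comm_comm_d1[OF w, of v] by (simp add: pc.d1_def dY_def)
  have Aodd: "CC w ** A v = - (A v ** CC w)" for v
    by (rule pc.odd_C[OF w]) (simp add: A_def DD)
  have Ca': "matrix_inv (a w) ** CC w = ?C0 ** matrix_inv (a w)"
  proof -
    have "matrix_inv (a w) ** CC w = matrix_inv (a w) ** (CC w ** a w) ** matrix_inv (a w)"
      by (simp add: inv flip: matrix_mul_assoc)
    also have "\<dots> = ?C0 ** matrix_inv (a w)" unfolding Ca by (simp add: inv matrix_mul_assoc)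
    finally show ?thesis .
  qed
  have Pso: "P v \<in> so Q" for v unfolding P_def by (rule base.conj_so[OF aw Aso])
  have PC: "P v ** ?C0 = matrix_inv (a w) ** (A v ** CC w) ** a w" for v
    unfolding P_def matrix_mul_assoc[symmetric] Ca ..
  have CP: "?C0 ** P v = matrix_inv (a w) ** (CC w ** A v) ** a w" for v
    unfolding P_def matrix_mul_assoc Ca' ..
  have Podd: "?C0 ** P v = - (P v ** ?C0)" for v
    unfolding PC CP Aodd by (simp add: matrix_ring_simps)
  have proj: "p_proj n Q H0 (matrix_inv (a w) ** a' v) = P v" for v
  proof (rule base.p_proj_eqI[OF K Pso Podd])
    let ?X = "matrix_inv (a w) ** a' v"
    have aX: "a w ** ?X = a' v" unfolding matrix_mul_assoc inv by simp
    have "?X \<in> so Q"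
      unfolding so_iff
    proof (intro allI)
      fix x y
      have iso: "qform Q (a w *v x) (a w *v y) = qform Q x y" for x y using aw by (simp add: base.Aut_iff)
      have "qform Q (a' v *v x) (a w *v y) + qform Q (a w *v x) (a' v *v y) = 0"
        by (rule has_derivative_skew[OF a']) (use lift in \<open>auto simp: base.Aut_iff elim: eventually_mono\<close>)
      then have "qform Q (a w *v (?X *v x)) (a w *v y) + qform Q (a w *v x) (a w *v (?X *v y)) = 0"
        unfolding matrix_vector_mul_assoc aX .
      then show "qform Q (?X *v x) y + qform Q x (?X *v y) = 0" unfolding iso .
    qed
    then show "?X - P v \<in> so Q" using Pso so_simps by blast
    have "?X ** ?C0 = matrix_inv (a w) ** CC w ** a' v + matrix_inv (a w) ** dC w v ** a w"
      unfolding matrix_mul_assoc[symmetric] D[symmetric] by (simp add: matrix_ring_simps)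
    also have "\<dots> = ?C0 ** ?X + (P v ** ?C0 - ?C0 ** P v)"
      unfolding Ca' PC CP dC_eq[OF w] A_def[symmetric] comm_def[of "A v"] by (simp add: matrix_ring_simps)
    finally show "(?X - P v) ** ?C0 = ?C0 ** (?X - P v)"
      by (simp add: matrix_mult_diff_left matrix_mult_diff_right algebra_simps)
  qed
  have "trace_form (P u) (P v) = trace (matrix_inv (a w) ** (A u ** A v ** a w))"
  proof -
    have "P u ** P v = matrix_inv (a w) ** A u ** (a w ** matrix_inv (a w)) ** A v ** a w"
      by (simp add: P_def matrix_mul_assoc)
    then show ?thesis by (simp add: trace_form_def inv matrix_mul_assoc)
  qed
  also have "\<dots> = trace_form (A u) (A v)"
    using trace_mul_sym[of "matrix_inv (a w)" "A u ** A v ** a w"] by (simp add: trace_form_def inv flip: matrix_mul_assoc)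
  \<comment> \<open>By invariance of the trace form and [Y, [Y, dY]] = - dY the matrices [Y, dY]
    have the same products as dY.\<close>
  also have "\<dots> = trace_form (dY w u) (dY w v)"
    unfolding A_def by (simp add: trace_form_comm DD)
  finally have "trace_form (P u) (P v) = trace_form (dY w u) (dY w v)" .
  then show ?thesis unfolding proj base.lie_algebra_Aut base.killing_so[OF Pso Pso] by simp
qed

text \<open>\<open>exists_lift\<close> supplies a value for the description and
  \<open>lift_value\<close> shows that every lift yields the same one.\<close>

lemma pullback_metric_eq:
  assumes w: "w \<in> W" and K: "base.killing_factor \<noteq> 0"
  shows "pullback_metric n Q H0 \<kappa> f w u v = \<kappa> * (base.killing_factor * trace_form (dY w u) (dY w v))"
  unfolding pullback_metric_def
proof (rule the_equality)
  obtain a a' where "\<forall>\<^sub>F z in nhds w. a z \<in> Aut Q \<and> proj n Q H0 (f z) = coset n Q H0 (a z)" "(a has_derivative a') (at w)"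
    using exists_lift[OF w] by blast
  moreover from lift_value[OF w K this, of u v]
  have "\<kappa> * (base.killing_factor * trace_form (dY w u) (dY w v)) =
      \<kappa> * killing (lie_algebra (Aut Q)) (p_proj n Q H0 (matrix_inv (a w) ** a' u)) (p_proj n Q H0 (matrix_inv (a w) ** a' v))"
    by simp
  ultimately show "\<exists>a a'. (\<forall>\<^sub>F w' in nhds w. a w' \<in> Aut Q \<and> proj n Q H0 (f w') = coset n Q H0 (a w')) \<and>
     (a has_derivative a') (at w) \<and>
     \<kappa> * (base.killing_factor * trace_form (dY w u) (dY w v)) =
     \<kappa> * killing (lie_algebra (Aut Q)) (p_proj n Q H0 (matrix_inv (a w) ** a' u)) (p_proj n Q H0 (matrix_inv (a w) ** a' v))"
    by blast
next
  fix y assume "\<exists>a a'. (\<forall>\<^sub>F w' in nhds w. a w' \<in> Aut Q \<and> proj n Q H0 (f w') = coset n Q H0 (a w')) \<and>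
     (a has_derivative a') (at w) \<and>
     y = \<kappa> * killing (lie_algebra (Aut Q)) (p_proj n Q H0 (matrix_inv (a w) ** a' u)) (p_proj n Q H0 (matrix_inv (a w) ** a' v))"
  then show "y = \<kappa> * (base.killing_factor * trace_form (dY w u) (dY w v))"
    using lift_value[OF w K] by auto
qed

text \<open>Index types are nonempty, so there is a nonzero u; the nonzero dY(u) does not commute
  with Y, and \<open>so Q\<close> is not abelian.\<close>

lemma killing_factor_pos:
  assumes w: "w \<in> W"
  shows "0 < base.killing_factor"
proof -
  interpret pc: period_chart W YY CC "skew_op Q" "so Q" 1 by (rule period_chart) simp
  obtain u :: "complex^'k" where u: "u \<noteq> 0" using zero_neq_one by blast
  have "dY w u \<noteq> 0" using dY_immersion[OF w] u by blast
  moreover have "comm (YY w) (comm (YY w) (dY w u)) = - dY w u"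
    using pc.comm_comm_d1[OF w, of u] by (simp add: pc.d1_def dY_def)
  ultimately have "comm (YY w) (dY w u) \<noteq> 0" by auto
  moreover have "dY w u \<in> so Q" using pc.d1_\<gg>[OF w, of u] by (simp add: pc.d1_def dY_def)
  ultimately show ?thesis using base.killing_factor_pos pc.Y_\<gg>[OF w] by blast
qed

text \<open>All Y w are conjugate to the one at the base point; this makes the curvature bound
  uniform over points and charts.\<close>

lemma trace_YY:
  assumes w: "w \<in> W"
  shows "trace_form (YY w) (YY w) = trace_form base.Yop base.Yop"
proof -
  obtain b where b: "b \<in> Aut Q" "f w = act b H0" "CC w ** b = b ** base.Cop" "YY w ** b = b ** base.Yop"
    by (rule base_point[OF w])
  have YY: "YY w = b ** base.Yop ** matrix_inv b"
    unfolding b(4)[symmetric] matrix_mul_assoc[symmetric] base.Aut_inv(1)[OF b(1)] by simp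
  have "YY w ** YY w = b ** (base.Yop ** (matrix_inv b ** b) ** base.Yop ** matrix_inv b)"
    unfolding YY by (simp add: matrix_mul_assoc)
  then have "trace_form (YY w) (YY w) = trace ((base.Yop ** base.Yop ** matrix_inv b) ** b)"
    using trace_mul_sym[of b "base.Yop ** base.Yop ** matrix_inv b"]
    by (simp add: trace_form_def base.Aut_inv[OF b(1)])
  then show ?thesis by (simp add: trace_form_def base.Aut_inv[OF b(1)] flip: matrix_mul_assoc)
qed

end

text \<open>\<open>pullback_metric\<close> is identified with the metric of
  \<open>period_chart\<close> only at points of W. Since W is open, derivatives at its points depend
  on values in W alone; the next congruence lemmas rest on the same remark.\<close>

lemma christoffel_cong:
  assumes "open W" "w \<in> W" "\<And>z u v. z \<in> W \<Longrightarrow> g z u v = g' z u v"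
  shows "christoffel g w u v = christoffel g' w u v"
proof -
  have "frechet_derivative (\<lambda>z. g z u v) (at w) = frechet_derivative (\<lambda>z. g' z u v) (at w)" for u v
    by (rule frechet_derivative_cong_open[OF assms(1,2)]) (rule assms(3))
  then show ?thesis using assms(2,3) by (simp add: christoffel_def)
qed

lemma curvature_cong:
  assumes "open W" "w \<in> W" "\<And>z u v. z \<in> W \<Longrightarrow> g z u v = g' z u v"
  shows "curvature g w u v x = curvature g' w u v x"
proof -
  have "frechet_derivative (\<lambda>z. christoffel g z u v) (at w) = frechet_derivative (\<lambda>z. christoffel g' z u v) (at w)" for u v
    by (rule frechet_derivative_cong_open[OF assms(1,2)]) (rule christoffel_cong[OF assms(1) _ assms(3)])
  then show ?thesis using christoffel_cong[OF assms] by (simp add: curvature_def)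
qed

lemma Ck_on_cong:
  assumes "open W" "\<And>z. z \<in> W \<Longrightarrow> F z = F' z" "Ck_on k W F"
  shows "Ck_on k W F'"
proof (cases k)
  case 0
  then show ?thesis using assms by (auto intro: continuous_on_eq)
next
  case (Suc j)
  then obtain D where D: "\<forall>w\<in>W. (F has_derivative D w) (at w)" "\<forall>v. Ck_on j W (\<lambda>w. D w v)"
    using assms(3) by auto
  have "(F' has_derivative D w) (at w)" if "w \<in> W" for w
    by (rule has_derivative_transform_within_open[OF D(1)[rule_format, OF that] assms(1) that]) (rule assms(2))
  then show ?thesis using D(2) Suc by auto
qed

lemma kaehler_metric_cong:
  assumes W: "open W" and g: "\<And>z u v. z \<in> W \<Longrightarrow> g z u v = g' z u v" and K: "kaehler_metric W g"
  shows "kaehler_metric W g'"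
proof -
  have g_eq: "g' z = g z" if "z \<in> W" for z using g[OF that] by (simp add: fun_eq_iff)
  have form: "frechet_derivative (\<lambda>z. kaehler_form g' z u v) (at w) = frechet_derivative (\<lambda>z. kaehler_form g z u v) (at w)"
    if "w \<in> W" for w u v
    by (rule frechet_derivative_cong_open[OF W that]) (simp add: kaehler_form_def g)
  have Ck: "Ck_on k W (\<lambda>w. g' w u v)" for k u v
    by (rule Ck_on_cong[OF W g]) (use K in \<open>auto simp: kaehler_metric_def riemannian_metric_def\<close>)
  show ?thesis
    using K Ck by (simp add: kaehler_metric_def riemannian_metric_def g_eq form cong: ball_cong)
qed

theorem theorem1p2:
  fixes n :: nat and Q :: "int^'m^'m" and hodge :: "nat \<Rightarrow> nat" and H0 :: "'m decomp"
    and U :: "'m decomp set"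
    and A :: "((complex^'k) set \<times> (complex^'k \<Rightarrow> 'm decomp)) set"
    and \<kappa> :: real
  assumes "n \<ge> 1"
    and "polarization_form n Q"
    and "H0 \<in> classifying_space n Q hodge"
    and "standing_assumptions n Q H0"
    and "horizontal_slice n (classifying_space n Q hodge) U A"
    and "\<kappa> > 0"
  shows "(\<forall>(W, f)\<in>A. kaehler_metric W (pullback_metric n Q H0 \<kappa> f)) \<and>
    (\<forall>(W, f)\<in>A. \<forall>w\<in>W. \<forall>u v. u \<noteq> 0 \<longrightarrow> v \<noteq> 0 \<longrightarrow>
       bisectional_curvature (pullback_metric n Q H0 \<kappa> f) w u v \<le> 0) \<and>
    (\<exists>c>0. \<forall>(W, f)\<in>A. \<forall>w\<in>W. \<forall>u. u \<noteq> 0 \<longrightarrow>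
       ricci_curvature (pullback_metric n Q H0 \<kappa> f) w u \<le> - c \<and>
       holomorphic_sectional_curvature (pullback_metric n Q H0 \<kappa> f) w u \<le> - c)"
proof -
  interpret base: hodge_structure n Q hodge H0
    using assms(2,3) by (simp add: hodge_structure_def)
  define l where "l = base.killing_factor"
  \<comment> \<open>The summand 1 makes M positive, so that the bound may be divided by it.\<close>
  define M where "M = 1 + \<bar>trace_form base.Yop base.Yop\<bar>"
  have M: "0 < M" by (simp add: M_def)
  \<comment> \<open>For l \<le> 0 no chart has a point, by \<open>killing_factor_pos\<close>; the
    value 1 then only keeps c positive.\<close>
  define \<kappa>' where "\<kappa>' = (if 0 < l then \<kappa> * l else 1)"
  have \<kappa>': "0 < \<kappa>'" using assms(6) by (simp add: \<kappa>'_def)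
  \<comment> \<open>The Ricci bound, which is the weaker of the two; it depends only on the base
    point and the scale of the metric, so one c serves all charts.\<close>
  define c where "c = 1 / (2 * \<kappa>' * M)"
  have c: "0 < c" using \<kappa>' M by (simp add: c_def)
  have main: "kaehler_metric W (pullback_metric n Q H0 \<kappa> f) \<and>
    (\<forall>w\<in>W. \<forall>u v. u \<noteq> 0 \<longrightarrow> v \<noteq> 0 \<longrightarrow> bisectional_curvature (pullback_metric n Q H0 \<kappa> f) w u v \<le> 0) \<and>
    (\<forall>w\<in>W. \<forall>u. u \<noteq> 0 \<longrightarrow>
       ricci_curvature (pullback_metric n Q H0 \<kappa> f) w u \<le> - c \<and>
       holomorphic_sectional_curvature (pullback_metric n Q H0 \<kappa> f) w u \<le> - c)"
    if Wf: "(W, f) \<in> A" for W f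
  proof -
    have "hodge_chart n Q hodge W f"
      using assms(2,5) Wf unfolding horizontal_slice_def complex_submanifold_def hodge_chart_def by blast
    then interpret based_chart n Q hodge W f H0
      by (intro based_chart.intro base.hodge_structure_axioms)
    interpret pc: period_chart W YY CC "skew_op Q" "so Q" \<kappa>' by (rule period_chart[OF \<kappa>'])
    let ?g = "pullback_metric n Q H0 \<kappa> f"
    have eq: "pc.g z u v = ?g z u v" if "z \<in> W" for z u v
    proof -
      have l: "\<kappa>' = \<kappa> * l" "l \<noteq> 0" using killing_factor_pos[OF that] by (simp_all add: \<kappa>'_def l_def)
      have "?g z u v = \<kappa>' * trace_form (dY z u) (dY z v)"
        using pullback_metric_eq[OF that, of \<kappa> u v] l(2) by (simp add: l(1) flip: l_def)
      then show ?thesis by (simp only: pc.g_def pc.d1_def dY_def)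
    qed
    have g_eq: "pc.g z = ?g z" if "z \<in> W" for z using eq[OF that] by (simp add: fun_eq_iff)
    have curv: "curvature pc.g w = curvature ?g w" if "w \<in> W" for w
      using curvature_cong[OF open_W that eq] by (simp add: fun_eq_iff)
    have trM: "- trace_form (YY w) (YY w) \<le> M" if "w \<in> W" for w
      unfolding trace_YY[OF that] M_def by linarith
    show ?thesis
    proof (intro conjI ballI allI impI)
      show "kaehler_metric W ?g" by (rule kaehler_metric_cong[OF open_W eq pc.kaehler_metric_g])
      fix w assume w: "w \<in> W"
      show "bisectional_curvature ?g w u v \<le> 0" for u v
        using pc.bisectional_curvature_nonpos[OF w, of u v] by (simp add: bisectional_curvature_def g_eq[OF w] curv[OF w])
      fix u :: "complex^'k" assume u: "u \<noteq> 0"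
      show "ricci_curvature ?g w u \<le> - c"
        using pc.ricci_curvature_bound[OF w trM[OF w] M u]
        by (simp add: ricci_curvature_def ricci_tensor_def g_eq[OF w] curv[OF w] c_def)
      have "holomorphic_sectional_curvature ?g w u \<le> - 1 / (\<kappa>' * M)"
        using pc.holomorphic_sectional_curvature_bound[OF w trM[OF w] M u]
        by (simp add: holomorphic_sectional_curvature_def g_eq[OF w] curv[OF w])
      also have "- 1 / (\<kappa>' * M) \<le> - c"
        unfolding c_def using \<kappa>' M by (simp add: field_simps)
      finally show "holomorphic_sectional_curvature ?g w u \<le> - c" .
    qed
  qed
  show ?thesis
    using main c by (intro conjI exI[of _ c]) (auto split: prod.splits)
qed

end
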